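(* The functors $$D:\mathbf{C^{\ast}\text{-}Alg}\to\mathbf{AlexAlg}_c\quad\text{and}\quad \mathcal R:\mathbf{AlexAlg}_c\to\mathbf{C^{\ast}\text{-}Alg}$$ (or equivalently, $D$ and $\mathcal M:\mathbf{AlexAlg}_c\to\mathbf{C^{\ast}\text{-}Alg}$), defined in the context, are categorical inverses to each other and yield an equivalence between the category $\mathbf{C^{\ast}\text{-}Alg}$ of (real, commutative) $C^{\ast}$-algebras and the category $\mathbf{AlexAlg}_c$ of countably compact Alexandrov algebras.
   Context: A (real) $C^\ast$-algebra here is a commutative ring with unit isomorphic to the ring of continuous real-valued functions on some compact Hausdorff space; $\mathbf{C^{\ast}\text{-}Alg}$ is the full subcategory of the category of commutative rings with unit on these rings. All distributive lattices are bounded. A distributive lattice $S$ is normal if for all $a,b$ with $a\vee b=1$ there are $c,d$ with $c\vee a=b\vee d=1$ and $c\wedge d=0$. An Alexandrov algebra is a normal distributive lattice $S$ in which countable joins exist and distribute over finite meets, and such that for every $a\in S$ there are sequences $(b_n)$, $(c_n)$ in $S$ with $\bigvee_n c_n=a$ and $b_n\wedge c_n=0$, $b_n\vee a=1$ for all $n$. It is countably compact if every countable family with join $1$ has a finite subfamily with join $1$. $\mathbf{AlexAlg}_c$ is the category of countably compact Alexandrov algebras and lattice homomorphisms preserving countable joins. The functor $D$: for a $C^\ast$-algebra $A$, $Max(A)$ is the space of maximal ideals of $A$ (Zariski topology), and $D_A$ is the sublattice of $\mathcal O(Max(A))$ consisting of the sets $\{M\in Max(A)\mid a\notin M\}$,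 $a\in A$ (it equals the lattice of co-zero sets of $Max(A)$). For a homomorphism $f:A\to B$, $D_f:D_A\to D_B$ sends $\{M\in Max(A)\mid a\notin M\}$ to $\{N\in Max(B)\mid f(a)\notin N\}$. The functor $\mathcal R$: for a countably compact Alexandrov algebra $S$, $\mathcal R_S$ is the set of finite-meet-preserving (including the top element) maps $f:\mathcal O(\mathbb R)\to S$ such that for every family $\{U_i\mid i\in I\}$ of open subsets of $\mathbb R$ there is $J\subseteq I$ such that $\{f(U_i)\mid i\in J\}$ is countable and $f(\bigcup_{i\in I}U_i)=\bigvee_{i\in J}f(U_i)$. Let $Max(S)$ be the space of maximal ideals of the lattice $S$, with basic open sets $\{M\mid d\notin M\}$, $d\in S$; it is compact Hausdorff and $d\mapsto\{M\mid d\notin M\}$ is an isomorphism of $S$ onto the lattice of co-zero sets of $Max(S)$. Sending a continuous $\varphi:Max(S)\to\mathbb R$ to the map $U\mapsto$ (the unique $d\in S$ with $\varphi^{-1}(U)=\{M\mid d\notin M\}$) is a bijection from the ring of continuous maps $Max(S)\to\mathbb R$ to $\mathcal R_S$; $\mathcal R_S$ carries the $C^\ast$-algebra structure transferred along this bijection. For $g:S\to S'$, $\mathcal R_g=g\circ-$. The functor $\mathcal M$: let $\mathbb Q^{+}=\mathbb Q\cup\{\infty\}$ and $\mathbb Q^{-}=\mathbb Q\cup\{-\infty\}$. $\mathcal M_S$ is the set of maps $f:\mathbb Q^{-}\times\mathbb Q^{+}\to S$ such that (a) $f(-\infty,\infty)=1$; (b) $f(\max\{p,p'\},\min\{q,q'\})=f(p,q)\wedge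 f(p',q')$; (c) $f(p,q)=0$ whenever $p>q$; (d) $f(p,r)\vee f(q,s)=f(p,s)$ whenever $p\le q<r\le s$; (e) $\bigvee_{p<p'<q'<q}f(p',q')=f(p,q)$ for all $(p,q)$. Continuous maps $\varphi:Max(S)\to\mathbb R$ correspond bijectively to elements of $\mathcal M_S$ by sending $\varphi$ to $(p,q)\mapsto$ (the unique $d$ with $\varphi^{-1}((p,q))=\{M\mid d\notin M\}$), where $(p,q)$ is the open interval, empty if $p\ge q$; $\mathcal M_S$ carries the transferred $C^\ast$-algebra structure, and $\mathcal M_g=g\circ-$. *)

theory Defs
  imports "HOL-Analysis.Analysis" "HOL-Algebra.Lattice" "HOL-Algebra.QuotRing"
begin

section \<open>Real commutative C*-algebras\<close>

text \<open>Continuous functions are extensional outside the space, so that equality in the ring is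
  equality of functions on the space.\<close>

definition C_ring :: "'x topology \<Rightarrow> ('x \<Rightarrow> real) ring" where
  "C_ring X =
    \<lparr>carrier = {\<phi>. continuous_map X euclideanreal \<phi>} \<inter> extensional (topspace X),
     mult = (\<lambda>\<phi> \<psi>. \<lambda>x\<in>topspace X. \<phi> x * \<psi> x),
     one = (\<lambda>x\<in>topspace X. 1),
     zero = (\<lambda>x\<in>topspace X. 0),
     add = (\<lambda>\<phi> \<psi>. \<lambda>x\<in>topspace X. \<phi> x + \<psi> x)\<rparr>"

text \<open>A type cannot be quantified existentially, so the points of the space are taken from
  \<open>'a set\<close>. This is no restriction: the lemma \<open>cstar_algebraI\<close> below
  allows a compact Hausdorff space over any type.\<close>

definition cstar_algebra :: "'a ring \<Rightarrow> bool" where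
  "cstar_algebra A \<longleftrightarrow> cring A \<and>
    (\<exists>X :: 'a set topology. compact_space X \<and> Hausdorff_space X \<and> A \<simeq> C_ring X)"

lemma C_ring_homeomorphic:
  assumes "homeomorphic_maps X Y e e'"
  shows "C_ring X \<simeq> C_ring Y"
proof -
  have ce: "continuous_map X Y e" and ce': "continuous_map Y X e'"
    and e'e: "\<And>x. x \<in> topspace X \<Longrightarrow> e' (e x) = x"
    and ee': "\<And>y. y \<in> topspace Y \<Longrightarrow> e (e' y) = y"
    using assms by (auto simp: homeomorphic_maps_def)
  have eX: "\<And>x. x \<in> topspace X \<Longrightarrow> e x \<in> topspace Y"
    and eY: "\<And>y. y \<in> topspace Y \<Longrightarrow> e' y \<in> topspace X"
    using ce ce' by (auto simp: continuous_map_def)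
  define F where "F = (\<lambda>\<phi> :: _ \<Rightarrow> real. \<lambda>y\<in>topspace Y. \<phi> (e' y))"
  define G where "G = (\<lambda>\<psi> :: _ \<Rightarrow> real. \<lambda>x\<in>topspace X. \<psi> (e x))"
  have F: "F \<phi> \<in> carrier (C_ring Y)" if "\<phi> \<in> carrier (C_ring X)" for \<phi>
  proof -
    have "continuous_map Y euclideanreal (\<phi> \<circ> e')"
      by (rule continuous_map_compose[OF ce']) (use that in \<open>simp add: C_ring_def\<close>)
    then have "continuous_map Y euclideanreal (F \<phi>)"
      by (rule continuous_map_eq) (simp add: F_def)
    then show ?thesis by (simp add: C_ring_def F_def)
  qed
  have G: "G \<psi> \<in> carrier (C_ring X)" if "\<psi> \<in> carrier (C_ring Y)" for \<psi>
  proof -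
    have "continuous_map X euclideanreal (\<psi> \<circ> e)"
      by (rule continuous_map_compose[OF ce]) (use that in \<open>simp add: C_ring_def\<close>)
    then have "continuous_map X euclideanreal (G \<psi>)"
      by (rule continuous_map_eq) (simp add: G_def)
    then show ?thesis by (simp add: C_ring_def G_def)
  qed
  have "bij_betw F (carrier (C_ring X)) (carrier (C_ring Y))"
  proof (rule bij_betwI[where g = G])
    show "G (F \<phi>) = \<phi>" if "\<phi> \<in> carrier (C_ring X)" for \<phi>
      using that by (simp add: F_def G_def C_ring_def extensional_def fun_eq_iff eX e'e)
    show "F (G \<psi>) = \<psi>" if "\<psi> \<in> carrier (C_ring Y)" for \<psi>
      using that by (simp add: F_def G_def C_ring_def extensional_def fun_eq_iff eY ee')
  qed (use F G in auto)
  moreover have "F \<in> ring_hom (C_ring X) (C_ring Y)"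
    by (rule ring_hom_memI)
       (use F in \<open>auto simp: F_def C_ring_def fun_eq_iff eY\<close>)
  ultimately show ?thesis
    by (auto simp: is_ring_iso_def ring_iso_def)
qed

lemma cstar_algebraI:
  fixes A :: "'a ring" and X :: "'x topology"
  assumes "cring A" "compact_space X" "Hausdorff_space X" "A \<simeq> C_ring X"
  shows "cstar_algebra A"
proof -
  obtain h where h: "h \<in> ring_iso A (C_ring X)"
    using assms(4) by (auto simp: is_ring_iso_def)
  then have hsurj: "h ` carrier A = carrier (C_ring X)"
    by (auto simp: ring_iso_def bij_betw_def)
  define e where "e = (\<lambda>x. {a \<in> carrier A. h a x = 0})"
  have inj: "inj_on e (topspace X)"
  proof (rule inj_onI, rule ccontr)
    fix x y assume x: "x \<in> topspace X" and y: "y \<in> topspace X"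
      and eq: "e x = e y" and ne: "x \<noteq> y"
    have cr: "completely_regular_space X"
    proof (rule normal_imp_completely_regular_space)
      show "normal_space X"
        by (rule compact_Hausdorff_or_regular_imp_normal_space) (simp_all add: assms(2,3))
    qed (simp add: assms(3))
    have "closedin X {y}"
      by (rule closedin_Hausdorff_singleton[OF assms(3) y])
    then obtain f :: "'x \<Rightarrow> real" where f: "continuous_map X euclideanreal f" "f x = 0" "f y = 1"
      using cr[unfolded completely_regular_space_alt, rule_format, of "{y}" x] x ne by auto
    define f' where "f' = restrict f (topspace X)"
    have "f' \<in> carrier (C_ring X)"
      using continuous_map_eq[OF f(1), of f'] by (simp add: C_ring_def f'_def)
    then have "f' \<in> h ` carrier A"
      by (simp only: hsurj)
    then obtain a where a: "a \<in> carrier A" "h a = f'"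
      by (elim imageE) simp
    then have "a \<in> e x" "a \<notin> e y"
      using f x y by (auto simp: e_def f'_def)
    then show False using eq by simp
  qed
  define e' where "e' = inv_into (topspace X) e"
  define Y where "Y = pullback_topology (e ` topspace X) e' X"
  have e'e: "e' (e x) = x" if "x \<in> topspace X" for x
    using that inj by (simp add: e'_def)
  have topY: "topspace Y = e ` topspace X"
    by (auto simp: Y_def topspace_pullback_topology e'e)
  have c': "continuous_map Y X e'"
    using continuous_map_pullback[of X X id "e ` topspace X" e'] by (simp add: Y_def)
  have c: "continuous_map X Y e"
    unfolding Y_def
  proof (rule continuous_map_pullback')
    show "continuous_map X X (e' \<circ> e)"
      by (rule continuous_map_eq[OF continuous_map_id]) (simp add: e'e)
  qed auto
  have hm: "homeomorphic_maps X Y e e'"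
    using c c' by (auto simp: homeomorphic_maps_def e'e topY)
  then have "X homeomorphic_space Y"
    by (auto simp: homeomorphic_space_def)
  then have "compact_space Y" "Hausdorff_space Y"
    using assms(2,3) by (simp_all add: homeomorphic_compact_space homeomorphic_Hausdorff_space)
  moreover have "A \<simeq> C_ring Y"
    by (rule ring_iso_trans[OF assms(4) C_ring_homeomorphic[OF hm]])
  ultimately show ?thesis
    using assms(1) unfolding cstar_algebra_def by blast
qed

section \<open>Alexandrov algebras\<close>

locale distributive_lattice = bounded_lattice L for L (structure) +
  assumes meet_join_distrib:
    "\<lbrakk>x \<in> carrier L; y \<in> carrier L; z \<in> carrier L\<rbrakk>
      \<Longrightarrow> x \<sqinter> (y \<squnion> z) = (x \<sqinter> y) \<squnion> (x \<sqinter> z)"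

locale normal_distributive_lattice = distributive_lattice L for L (structure) +
  assumes normal:
    "\<lbrakk>a \<in> carrier L; b \<in> carrier L; a \<squnion> b = \<top>\<rbrakk>
      \<Longrightarrow> \<exists>c\<in>carrier L. \<exists>d\<in>carrier L. c \<squnion> a = \<top> \<and> b \<squnion> d = \<top> \<and> c \<sqinter> d = \<bottom>"

locale alexandrov_algebra = normal_distributive_lattice L for L (structure) +
  assumes countable_join_exists:
    "\<lbrakk>countable B; B \<subseteq> carrier L\<rbrakk> \<Longrightarrow> \<exists>s. is_lub L s B"
  and meet_countable_join_distrib:
    "\<lbrakk>x \<in> carrier L; countable B; B \<subseteq> carrier L\<rbrakk>
      \<Longrightarrow> x \<sqinter> (\<Squnion>B) = \<Squnion>((\<lambda>b. x \<sqinter> b) ` B)"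
  and approximating_sequences:
    "a \<in> carrier L \<Longrightarrow>
      \<exists>b c :: nat \<Rightarrow> _. range b \<subseteq> carrier L \<and> range c \<subseteq> carrier L \<and> \<Squnion>(range c) = a \<and>
        (\<forall>n. b n \<sqinter> c n = \<bottom> \<and> b n \<squnion> a = \<top>)"

locale cc_alexandrov_algebra = alexandrov_algebra L for L (structure) +
  assumes countably_compact:
    "\<lbrakk>countable B; B \<subseteq> carrier L; \<Squnion>B = \<top>\<rbrakk>
      \<Longrightarrow> \<exists>F. finite F \<and> F \<subseteq> B \<and> \<Squnion>F = \<top>"

text \<open>As with \<^const>\<open>ring_hom\<close>, morphisms are considered up to equality on the carrier.\<close>

definition alex_hom :: "'a gorder \<Rightarrow> 'b gorder \<Rightarrow> ('a \<Rightarrow> 'b) set" where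
  "alex_hom S T = {f \<in> carrier S \<rightarrow> carrier T.
     f \<top>\<^bsub>S\<^esub> = \<top>\<^bsub>T\<^esub> \<and> f \<bottom>\<^bsub>S\<^esub> = \<bottom>\<^bsub>T\<^esub> \<and>
     (\<forall>x\<in>carrier S. \<forall>y\<in>carrier S.
        f (x \<sqinter>\<^bsub>S\<^esub> y) = f x \<sqinter>\<^bsub>T\<^esub> f y \<and> f (x \<squnion>\<^bsub>S\<^esub> y) = f x \<squnion>\<^bsub>T\<^esub> f y) \<and>
     (\<forall>B. countable B \<and> B \<subseteq> carrier S \<longrightarrow> f (\<Squnion>\<^bsub>S\<^esub>B) = \<Squnion>\<^bsub>T\<^esub>(f ` B))}"

definition alex_iso :: "'a gorder \<Rightarrow> 'b gorder \<Rightarrow> ('a \<Rightarrow> 'b) set" where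
  "alex_iso S T = {f \<in> alex_hom S T. \<exists>g\<in>alex_hom T S.
     (\<forall>x\<in>carrier S. g (f x) = x) \<and> (\<forall>y\<in>carrier T. f (g y) = y)}"

section \<open>The functor D\<close>

definition max_ideals :: "'a ring \<Rightarrow> 'a set set" where
  "max_ideals A = {M. maximalideal M A}"

definition coz :: "'a ring \<Rightarrow> 'a \<Rightarrow> 'a set set" where
  "coz A a = {M \<in> max_ideals A. a \<notin> M}"

text \<open>The sets \<open>coz A a\<close> are the basic open sets of the Zariski topology; as a sublattice of its
  lattice of open sets, \<open>D_alg A\<close> is ordered by inclusion.\<close>

definition D_alg :: "'a ring \<Rightarrow> 'a set set gorder" where
  "D_alg A = \<lparr>carrier = coz A ` carrier A, eq = (=), le = (\<subseteq>)\<rparr>"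

definition D_hom :: "'a ring \<Rightarrow> 'b ring \<Rightarrow> ('a \<Rightarrow> 'b) \<Rightarrow> 'a set set \<Rightarrow> 'b set set" where
  "D_hom A B f U = (THE V. \<exists>a\<in>carrier A. U = coz A a \<and> V = coz B (f a))"

section \<open>The space of maximal ideals of a lattice\<close>

definition lattice_ideal :: "'a gorder \<Rightarrow> 'a set \<Rightarrow> bool" where
  "lattice_ideal L I \<longleftrightarrow> I \<subseteq> carrier L \<and> I \<noteq> {} \<and>
     (\<forall>x\<in>I. \<forall>y\<in>carrier L. y \<sqsubseteq>\<^bsub>L\<^esub> x \<longrightarrow> y \<in> I) \<and>
     (\<forall>x\<in>I. \<forall>y\<in>I. x \<squnion>\<^bsub>L\<^esub> y \<in> I)"

definition maximal_lattice_ideal :: "'a gorder \<Rightarrow> 'a set \<Rightarrow> bool" where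
  "maximal_lattice_ideal L M \<longleftrightarrow> lattice_ideal L M \<and> M \<noteq> carrier L \<and>
     (\<forall>J. lattice_ideal L J \<and> M \<subseteq> J \<longrightarrow> J = M \<or> J = carrier L)"

definition basic_open :: "'a gorder \<Rightarrow> 'a \<Rightarrow> 'a set set" where
  "basic_open S d = {M. maximal_lattice_ideal S M \<and> d \<notin> M}"

definition Max_space :: "'a gorder \<Rightarrow> 'a set topology" where
  "Max_space S = topology_generated_by (basic_open S ` carrier S)"

text \<open>The ring with carrier \<open>T\<close> and with operations transferred from \<open>R\<close> along a bijection
  \<open>\<Phi>\<close> from the carrier of \<open>R\<close> to \<open>T\<close>.\<close>

definition transfer_ring :: "'a ring \<Rightarrow> ('a \<Rightarrow> 'b) \<Rightarrow> 'b set \<Rightarrow> 'b ring" where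
  "transfer_ring R \<Phi> T = (let \<Psi> = inv_into (carrier R) \<Phi> in
    \<lparr>carrier = T,
     mult = (\<lambda>x y. \<Phi> (\<Psi> x \<otimes>\<^bsub>R\<^esub> \<Psi> y)),
     one = \<Phi> \<one>\<^bsub>R\<^esub>,
     zero = \<Phi> \<zero>\<^bsub>R\<^esub>,
     add = (\<lambda>x y. \<Phi> (\<Psi> x \<oplus>\<^bsub>R\<^esub> \<Psi> y))\<rparr>)"

text \<open>For continuous \<open>\<phi>\<close> and open \<open>U\<close>, the preimage is a co-zero set of the maximal ideal space,
  and the co-zero sets are exactly the basic open sets, each given by a unique element.\<close>

definition preimage_elt :: "'a gorder \<Rightarrow> ('a set \<Rightarrow> real) \<Rightarrow> real set \<Rightarrow> 'a" where
  "preimage_elt S \<phi> U =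
     (THE d. d \<in> carrier S \<and> {M \<in> topspace (Max_space S). \<phi> M \<in> U} = basic_open S d)"

section \<open>The functor R\<close>

text \<open>A family of open sets enters the defining condition only through its set of members and
  the sets of members of its subfamilies, so families are rendered as sets of open sets.\<close>

definition R_carrier :: "'a gorder \<Rightarrow> (real set \<Rightarrow> 'a) set" where
  "R_carrier S = {f \<in> {U. open U} \<rightarrow>\<^sub>E carrier S.
     f UNIV = \<top>\<^bsub>S\<^esub> \<and>
     (\<forall>U V. open U \<and> open V \<longrightarrow> f (U \<inter> V) = f U \<sqinter>\<^bsub>S\<^esub> f V) \<and>
     (\<forall>\<U>. (\<forall>U\<in>\<U>. open U) \<longrightarrow>
        (\<exists>\<V>\<subseteq>\<U>. countable (f ` \<V>) \<and> f (\<Union>\<U>) = \<Squnion>\<^bsub>S\<^esub>(f ` \<V>)))}"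

definition R_of_map :: "'a gorder \<Rightarrow> ('a set \<Rightarrow> real) \<Rightarrow> real set \<Rightarrow> 'a" where
  "R_of_map S \<phi> = (\<lambda>U\<in>{U. open U}. preimage_elt S \<phi> U)"

definition R_alg :: "'a gorder \<Rightarrow> (real set \<Rightarrow> 'a) ring" where
  "R_alg S = transfer_ring (C_ring (Max_space S)) (R_of_map S) (R_carrier S)"

definition R_hom :: "('a \<Rightarrow> 'b) \<Rightarrow> (real set \<Rightarrow> 'a) \<Rightarrow> real set \<Rightarrow> 'b" where
  "R_hom g f = (\<lambda>U\<in>{U. open U}. g (f U))"

section \<open>The functor M\<close>

definition Q_minus :: "ereal set" where
  "Q_minus = insert (-\<infinity>) (range (\<lambda>q :: rat. ereal (of_rat q)))"

definition Q_plus :: "ereal set" where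
  "Q_plus = insert \<infinity> (range (\<lambda>q :: rat. ereal (of_rat q)))"

definition M_carrier :: "'a gorder \<Rightarrow> (ereal \<times> ereal \<Rightarrow> 'a) set" where
  "M_carrier S = {f \<in> Q_minus \<times> Q_plus \<rightarrow>\<^sub>E carrier S.
     f (-\<infinity>, \<infinity>) = \<top>\<^bsub>S\<^esub> \<and>
     (\<forall>p\<in>Q_minus. \<forall>p'\<in>Q_minus. \<forall>q\<in>Q_plus. \<forall>q'\<in>Q_plus.
        f (max p p', min q q') = f (p, q) \<sqinter>\<^bsub>S\<^esub> f (p', q')) \<and>
     (\<forall>p\<in>Q_minus. \<forall>q\<in>Q_plus. p > q \<longrightarrow> f (p, q) = \<bottom>\<^bsub>S\<^esub>) \<and>
     (\<forall>p\<in>Q_minus. \<forall>q\<in>Q_minus. \<forall>r\<in>Q_plus. \<forall>s\<in>Q_plus. p \<le> q \<and> q < r \<and> r \<le> s \<longrightarrow>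
        f (p, r) \<squnion>\<^bsub>S\<^esub> f (q, s) = f (p, s)) \<and>
     (\<forall>p\<in>Q_minus. \<forall>q\<in>Q_plus.
        \<Squnion>\<^bsub>S\<^esub>{f (p', q') | p' q'. p' \<in> Q_minus \<and> q' \<in> Q_plus \<and> p < p' \<and> p' < q' \<and> q' < q}
          = f (p, q))}"

definition open_interval :: "ereal \<times> ereal \<Rightarrow> real set" where
  "open_interval = (\<lambda>(p, q). {x. p < ereal x \<and> ereal x < q})"

definition M_of_map :: "'a gorder \<Rightarrow> ('a set \<Rightarrow> real) \<Rightarrow> ereal \<times> ereal \<Rightarrow> 'a" where
  "M_of_map S \<phi> = (\<lambda>I\<in>Q_minus \<times> Q_plus. preimage_elt S \<phi> (open_interval I))"

definition M_alg :: "'a gorder \<Rightarrow> (ereal \<times> ereal \<Rightarrow> 'a) ring" where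
  "M_alg S = transfer_ring (C_ring (Max_space S)) (M_of_map S) (M_carrier S)"

definition M_hom :: "('a \<Rightarrow> 'b) \<Rightarrow> (ereal \<times> ereal \<Rightarrow> 'a) \<Rightarrow> ereal \<times> ereal \<Rightarrow> 'b" where
  "M_hom g f = (\<lambda>I\<in>Q_minus \<times> Q_plus. g (f I))"

section \<open>Units and counits\<close>

definition real_ring :: "real ring" where
  "real_ring = \<lparr>carrier = UNIV, mult = (*), one = 1, zero = 0, add = (+)\<rparr>"

text \<open>The value of \<open>a\<close> at the maximal ideal \<open>M\<close>: for a C*-algebra there is exactly one unital
  ring homomorphism to the reals with kernel \<open>M\<close>.\<close>

definition gelfand :: "'a ring \<Rightarrow> 'a \<Rightarrow> 'a set \<Rightarrow> real" where
  "gelfand A a M = (THE r. \<exists>h \<in> ring_hom A real_ring.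
     {x \<in> carrier A. h x = 0} = M \<and> h a = r)"

definition R_unit :: "'a ring \<Rightarrow> 'a \<Rightarrow> real set \<Rightarrow> 'a set set" where
  "R_unit A a = (\<lambda>U\<in>{U. open U}. {M \<in> max_ideals A. gelfand A a M \<in> U})"

definition M_unit :: "'a ring \<Rightarrow> 'a \<Rightarrow> ereal \<times> ereal \<Rightarrow> 'a set set" where
  "M_unit A a = (\<lambda>I\<in>Q_minus \<times> Q_plus. {M \<in> max_ideals A. gelfand A a M \<in> open_interval I})"

text \<open>The counits send the co-zero set of \<open>f\<close>, which is an element of \<open>D\<close> of the ring of all such
  \<open>f\<close>, to the element of \<open>S\<close> that \<open>f\<close> assigns to the open set of non-zero reals; in the second
  case this set is covered by the intervals from \<open>-\<infinity>\<close> to \<open>0\<close> and from \<open>0\<close> to \<open>\<infinity>\<close>.\<close>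

definition R_counit :: "'a gorder \<Rightarrow> (real set \<Rightarrow> 'a) set set \<Rightarrow> 'a" where
  "R_counit S W = (THE d. \<exists>f\<in>carrier (R_alg S). W = coz (R_alg S) f \<and> d = f (- {0}))"

definition M_counit :: "'a gorder \<Rightarrow> (ereal \<times> ereal \<Rightarrow> 'a) set set \<Rightarrow> 'a" where
  "M_counit S W = (THE d. \<exists>f\<in>carrier (M_alg S).
     W = coz (M_alg S) f \<and> d = f (-\<infinity>, 0) \<squnion>\<^bsub>S\<^esub> f (0, \<infinity>))"

end

(* Both R and M encode a continuous function phi on Max(S) by the lattice elements that correspond
   to the preimages under phi of the members of a base of the real line; only this feature of the
   two constructions matters, so both are instances of one functor. For a countably compact
   Alexandrov algebra S, the space Max(S) is compact Hausdorff, and S is the lattice of its cozero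
   sets: an element is the countable join of its approximations from below, which exhibits the
   corresponding open set as an F-sigma set, and conversely compactness makes each cozero set a
   countable union of basic open sets. Hence R(S) and M(S) are isomorphic to C(Max(S)), with
   D(C(Max(S))) = S. In the other direction, a C*-algebra A is C(X) with X its space of maximal
   ideals by Gelfand representation, D(A) is the lattice of cozero sets of X, and
   the maximal ideal space of that lattice is X again. *)

theory Submission
  imports Defs
begin

section \<open>Cozero sets\<close>

text \<open>Three obstacles shape the argument. First, lattice elements must be recognised by the
  maximal ideals that omit them. If a countable join is outside \<open>M\<close>, it has a
  complement \<open>m\<close> in \<open>M\<close>, and countable compactness applied to
  \<open>m\<close> and the family puts a member outside \<open>M\<close>; so maximal ideals respect
  countable joins. With the approximating sequences this makes \<open>basic_open\<close> an order
  embedding, and identities in \<open>S\<close> can be checked pointwise. Second, an element of R(S)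
  or M(S) has to become a map on Max(S): for each \<open>M\<close>, the indices whose value is
  outside \<open>M\<close> are those of the base sets around one real number, and this is where the
  axioms of R and M are used. Third, a C*-algebra is given as a bare ring, without norm or scalars.
  The values of its elements are recovered because the only unital ring endomorphism of the reals is
  the identity, so real-valued homomorphisms fix constants and are determined by their kernels. The
  same fact makes contractions of maximal ideals maximal, as D needs in order to act on
  homomorphisms; on the lattice side, preservation of countable joins does the corresponding
  work.\<close>

lemma C_ring_carrier_iff:
  "\<phi> \<in> carrier (C_ring X) \<longleftrightarrow> continuous_map X euclideanreal \<phi> \<and> \<phi> \<in> extensional (topspace X)"
  by (simp add: C_ring_def)

lemma C_ring_simps [simp]:
  "mult (C_ring X) \<phi> \<psi> = (\<lambda>x\<in>topspace X. \<phi> x * \<psi> x)"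
  "add (C_ring X) \<phi> \<psi> = (\<lambda>x\<in>topspace X. \<phi> x + \<psi> x)"
  "one (C_ring X) = (\<lambda>x\<in>topspace X. 1)"
  "zero (C_ring X) = (\<lambda>x\<in>topspace X. 0)"
  by (simp_all add: C_ring_def)

lemma restrict_in_C_ring:
  "continuous_map X euclideanreal \<phi> \<Longrightarrow> restrict \<phi> (topspace X) \<in> carrier (C_ring X)"
  using continuous_map_eq[of X euclideanreal \<phi> "restrict \<phi> (topspace X)"]
  by (simp add: C_ring_carrier_iff)

lemma C_ring_continuous: "\<phi> \<in> carrier (C_ring X) \<Longrightarrow> continuous_map X euclideanreal \<phi>"
  by (simp add: C_ring_carrier_iff)

lemma C_ring_eqI:
  assumes "\<phi> \<in> carrier (C_ring X)" "\<psi> \<in> carrier (C_ring X)"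
    and "\<And>x. x \<in> topspace X \<Longrightarrow> \<phi> x = \<psi> x"
  shows "\<phi> = \<psi>"
  using assms by (auto simp: C_ring_carrier_iff intro: extensionalityI)

lemma cring_C_ring: "cring (C_ring X)"
proof (rule cringI)
  have add: "\<phi> \<oplus>\<^bsub>C_ring X\<^esub> \<psi> \<in> carrier (C_ring X)"
    if "\<phi> \<in> carrier (C_ring X)" "\<psi> \<in> carrier (C_ring X)" for \<phi> \<psi>
    using that by (auto intro!: restrict_in_C_ring continuous_map_add simp: C_ring_continuous)
  have mult: "\<phi> \<otimes>\<^bsub>C_ring X\<^esub> \<psi> \<in> carrier (C_ring X)"
    if "\<phi> \<in> carrier (C_ring X)" "\<psi> \<in> carrier (C_ring X)" for \<phi> \<psi>
    using that by (auto intro!: restrict_in_C_ring continuous_map_real_mult simp: C_ring_continuous)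
  have const: "(\<lambda>x\<in>topspace X. c) \<in> carrier (C_ring X)" for c
    by (rule restrict_in_C_ring) simp
  show "abelian_group (C_ring X)"
  proof (rule abelian_groupI)
    fix \<phi> assume \<phi>: "\<phi> \<in> carrier (C_ring X)"
    have "(\<lambda>x\<in>topspace X. - \<phi> x) \<in> carrier (C_ring X)"
      by (rule restrict_in_C_ring) (use \<phi> in \<open>simp add: C_ring_continuous\<close>)
    then show "\<exists>\<psi>\<in>carrier (C_ring X). \<psi> \<oplus>\<^bsub>C_ring X\<^esub> \<phi> = \<zero>\<^bsub>C_ring X\<^esub>"
      by (rule bexI[rotated]) (auto simp: fun_eq_iff)
    show "\<zero>\<^bsub>C_ring X\<^esub> \<oplus>\<^bsub>C_ring X\<^esub> \<phi> = \<phi>"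
      using \<phi> by (auto simp: C_ring_carrier_iff extensional_def fun_eq_iff)
  qed (use add const in \<open>auto simp: fun_eq_iff\<close>)
  show "Group.comm_monoid (C_ring X)"
  proof (rule comm_monoidI)
    fix \<phi> assume \<phi>: "\<phi> \<in> carrier (C_ring X)"
    show "\<one>\<^bsub>C_ring X\<^esub> \<otimes>\<^bsub>C_ring X\<^esub> \<phi> = \<phi>"
      using \<phi> by (auto simp: C_ring_carrier_iff extensional_def fun_eq_iff)
  qed (use mult const in \<open>auto simp: fun_eq_iff\<close>)
qed (auto simp: fun_eq_iff algebra_simps)

definition cozero_set :: "'x topology \<Rightarrow> 'x set \<Rightarrow> bool" where
  "cozero_set X U \<longleftrightarrow> (\<exists>\<phi>\<in>carrier (C_ring X). U = {x \<in> topspace X. \<phi> x \<noteq> 0})"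

lemma cozero_setI:
  assumes "continuous_map X euclideanreal \<phi>"
    and "\<And>x. x \<in> U \<longleftrightarrow> x \<in> topspace X \<and> \<phi> x \<noteq> 0"
  shows "cozero_set X U"
  unfolding cozero_set_def
  by (rule bexI[OF _ restrict_in_C_ring[OF assms(1)]]) (use assms(2) in auto)

lemma cozero_setE:
  assumes "cozero_set X U"
  obtains \<phi> where "continuous_map X euclideanreal \<phi>" "U = {x \<in> topspace X. \<phi> x \<noteq> 0}"
  using assms that by (auto simp: cozero_set_def C_ring_carrier_iff)

lemma cozero_set_subset: "cozero_set X U \<Longrightarrow> U \<subseteq> topspace X"
  by (auto simp: cozero_set_def)

lemma cozero_set_openin:
  assumes "cozero_set X U" shows "openin X U"
proof -
  obtain \<phi> where \<phi>: "continuous_map X euclideanreal \<phi>"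
    and U: "U = {x \<in> topspace X. \<phi> x \<noteq> 0}"
    using cozero_setE[OF assms] .
  have "openin X {x \<in> topspace X. \<phi> x \<in> - {0}}"
    by (rule openin_continuous_map_preimage[OF \<phi>]) auto
  also have "{x \<in> topspace X. \<phi> x \<in> - {0}} = U" using U by auto
  finally show ?thesis .
qed

lemma cozero_set_empty [simp]: "cozero_set X {}"
  by (rule cozero_setI[of X "\<lambda>_. 0"]) auto

lemma cozero_set_topspace [simp]: "cozero_set X (topspace X)"
  by (rule cozero_setI[of X "\<lambda>_. 1"]) auto

lemma cozero_set_Int:
  assumes "cozero_set X U" "cozero_set X V" shows "cozero_set X (U \<inter> V)"
proof -
  obtain \<phi> where \<phi>: "continuous_map X euclideanreal \<phi>" "U = {x \<in> topspace X. \<phi> x \<noteq> 0}"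
    using cozero_setE[OF assms(1)] .
  obtain \<psi> where \<psi>: "continuous_map X euclideanreal \<psi>" "V = {x \<in> topspace X. \<psi> x \<noteq> 0}"
    using cozero_setE[OF assms(2)] .
  show ?thesis
    by (rule cozero_setI[OF continuous_map_real_mult[OF \<phi>(1) \<psi>(1)]]) (auto simp: \<phi>(2) \<psi>(2))
qed

text \<open>The union is the nonzero set of the sum of the truncations
  \<open>min 1 \<bar>\<phi> n x\<bar>\<close> weighted by \<open>(1/2)^n\<close>: the bound on the
  terms gives uniform convergence, hence continuity, and since no term is negative the sum vanishes
  only where every term does.\<close>

lemma cozero_set_UN:
  fixes U :: "nat \<Rightarrow> 'x set"
  assumes "\<And>n. cozero_set X (U n)" shows "cozero_set X (\<Union>n. U n)"
proof -
  have "\<exists>\<phi>. continuous_map X euclideanreal \<phi> \<and> U n = {x \<in> topspace X. \<phi> x \<noteq> 0}" for n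
    using cozero_setE[OF assms[of n]] by metis
  then obtain \<phi> where \<phi>: "\<And>n. continuous_map X euclideanreal (\<phi> n)"
    and U: "\<And>n. U n = {x \<in> topspace X. \<phi> n x \<noteq> 0}" by metis
  define \<psi> where "\<psi> = (\<lambda>n x. (1/2)^n * min 1 \<bar>\<phi> n x\<bar>)"
  have \<psi>: "continuous_map X euclideanreal (\<psi> n)" for n
    unfolding \<psi>_def by (intro continuous_map_real_mult_left continuous_map_real_min continuous_map_real_abs \<phi>) auto
  have nonneg: "\<psi> n x \<ge> 0" and le: "\<psi> n x \<le> (1/2)^n" for n x
    by (auto simp: \<psi>_def mult_left_le)
  have geo: "summable (\<lambda>n. (1/2 :: real)^n)" by (simp add: summable_geometric)
  have sm: "summable (\<lambda>n. \<psi> n x)" for x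
    by (rule summable_comparison_test'[OF geo, of 0]) (use nonneg le in \<open>simp add: abs_of_nonneg\<close>)
  have ul: "uniform_limit (topspace X) (\<lambda>n x. \<Sum>i<n. \<psi> i x) (\<lambda>x. \<Sum>i. \<psi> i x) sequentially"
    by (rule Weierstrass_m_test[OF _ geo]) (use nonneg le in \<open>simp add: abs_of_nonneg\<close>)
  have cont: "continuous_map X euclideanreal (\<lambda>x. \<Sum>i. \<psi> i x)"
    unfolding mtopology_is_euclidean[symmetric]
  proof (rule Met_TC.continuous_map_uniform_limit[where F = sequentially and f = "\<lambda>n x. \<Sum>i<n. \<psi> i x"])
    show "\<forall>\<^sub>F n in sequentially. continuous_map X Met_TC.mtopology (\<lambda>x. \<Sum>i<n. \<psi> i x)"
      unfolding mtopology_is_euclidean by (intro always_eventually allI continuous_map_sum \<psi>) auto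
    show "\<forall>\<^sub>F n in sequentially. \<forall>x\<in>topspace X. (\<Sum>i. \<psi> i x) \<in> UNIV \<and> dist (\<Sum>i<n. \<psi> i x) (\<Sum>i. \<psi> i x) < e"
      if "e > 0" for e
      using uniform_limitD[OF ul that] by simp
  qed simp
  show ?thesis
  proof (rule cozero_setI[OF cont])
    fix x
    have "(\<Sum>i. \<psi> i x) = 0 \<longleftrightarrow> (\<forall>n. \<psi> n x = 0)"
      by (rule suminf_eq_zero_iff[OF sm]) (rule nonneg)
    also have "\<dots> \<longleftrightarrow> (\<forall>n. \<phi> n x = 0)"
      by (auto simp: \<psi>_def min_def)
    finally show "x \<in> (\<Union>n. U n) \<longleftrightarrow> x \<in> topspace X \<and> (\<Sum>i. \<psi> i x) \<noteq> 0"
      using U by auto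
  qed
qed

lemma cozero_set_Union:
  assumes "countable \<U>" "\<And>U. U \<in> \<U> \<Longrightarrow> cozero_set X U" shows "cozero_set X (\<Union>\<U>)"
proof (cases "\<U> = {}")
  case False
  then have "\<Union>\<U> = (\<Union>n. from_nat_into \<U> n)"
    using assms(1) by (simp add: range_from_nat_into)
  then show ?thesis
    using cozero_set_UN[of X "from_nat_into \<U>"] assms(2) False by (simp add: from_nat_into)
qed simp

lemma cozero_set_Un:
  assumes "cozero_set X U" "cozero_set X V" shows "cozero_set X (U \<union> V)"
  using cozero_set_Union[of "{U, V}" X] assms by auto

text \<open>Compare absolute values: \<open>C\<close> is where \<open>\<psi>\<close> is larger than
  \<open>\<phi>\<close> in absolute value and \<open>D\<close> is the reverse, so they are disjoint.
  Where \<open>\<phi>\<close> vanishes \<open>\<psi>\<close> does not, so \<open>C\<close> covers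
  what \<open>U\<close> misses, and symmetrically for \<open>D\<close> and \<open>V\<close>.\<close>

lemma cozero_set_normal:
  assumes "cozero_set X U" "cozero_set X V" "U \<union> V = topspace X"
  obtains C D where "cozero_set X C" "cozero_set X D" "C \<union> U = topspace X" "V \<union> D = topspace X" "C \<inter> D = {}"
proof -
  obtain \<phi> where \<phi>: "continuous_map X euclideanreal \<phi>" "U = {x \<in> topspace X. \<phi> x \<noteq> 0}"
    using cozero_setE[OF assms(1)] .
  obtain \<psi> where \<psi>: "continuous_map X euclideanreal \<psi>" "V = {x \<in> topspace X. \<psi> x \<noteq> 0}"
    using cozero_setE[OF assms(2)] .
  define c where "c = (\<lambda>x. max 0 (\<bar>\<psi> x\<bar> - \<bar>\<phi> x\<bar>))"
  define d where "d = (\<lambda>x. max 0 (\<bar>\<phi> x\<bar> - \<bar>\<psi> x\<bar>))"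
  have "cozero_set X {x \<in> topspace X. c x \<noteq> 0}" "cozero_set X {x \<in> topspace X. d x \<noteq> 0}"
    by (rule cozero_setI[of X c] cozero_setI[of X d];
        auto simp: c_def d_def intro!: continuous_map_real_max continuous_map_diff continuous_map_real_abs \<phi>(1) \<psi>(1))+
  moreover have "\<phi> x \<noteq> 0 \<or> \<psi> x \<noteq> 0" if "x \<in> topspace X" for x
    using that assms(3) \<phi>(2) \<psi>(2) by blast
  then have "{x \<in> topspace X. c x \<noteq> 0} \<union> U = topspace X" "V \<union> {x \<in> topspace X. d x \<noteq> 0} = topspace X"
    using \<phi>(2) \<psi>(2) by (fastforce simp: c_def d_def max_def)+
  moreover have "{x \<in> topspace X. c x \<noteq> 0} \<inter> {x \<in> topspace X. d x \<noteq> 0} = {}"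
    by (auto simp: c_def d_def max_def)
  ultimately show ?thesis using that by blast
qed

text \<open>The threshold \<open>1/(n+1)\<close> for the absolute value of \<open>\<phi>\<close>
  separates \<open>B n\<close> (below) from \<open>C n\<close> (above). Strict inequalities make
  them disjoint, and points outside \<open>U\<close> have value 0, hence lie in
  \<open>B n\<close>.\<close>

lemma cozero_set_approximation:
  assumes "cozero_set X U"
  obtains B C :: "nat \<Rightarrow> 'x set" where "\<And>n. cozero_set X (B n)" "\<And>n. cozero_set X (C n)"
    "(\<Union>n. C n) = U" "\<And>n. B n \<inter> C n = {}" "\<And>n. B n \<union> U = topspace X"
proof -
  obtain \<phi> where c: "continuous_map X euclideanreal \<phi>"
    and U: "U = {x \<in> topspace X. \<phi> x \<noteq> 0}"
    using cozero_setE[OF assms] .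
  define B where "B = (\<lambda>n. {x \<in> topspace X. max 0 (inverse (real (Suc n)) - \<bar>\<phi> x\<bar>) \<noteq> 0})"
  define C where "C = (\<lambda>n. {x \<in> topspace X. max 0 (\<bar>\<phi> x\<bar> - inverse (real (Suc n))) \<noteq> 0})"
  have "cozero_set X (B n)" for n
    by (rule cozero_setI[of X "\<lambda>x. max 0 (inverse (real (Suc n)) - \<bar>\<phi> x\<bar>)"])
      (auto simp: B_def intro!: continuous_map_real_max continuous_map_diff continuous_map_real_abs c)
  moreover have "cozero_set X (C n)" for n
    by (rule cozero_setI[of X "\<lambda>x. max 0 (\<bar>\<phi> x\<bar> - inverse (real (Suc n)))"])
      (auto simp: C_def intro!: continuous_map_real_max continuous_map_diff continuous_map_real_abs c)
  moreover have "x \<in> (\<Union>n. C n) \<longleftrightarrow> x \<in> U" for x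
  proof
    assume "x \<in> U"
    then have "\<bar>\<phi> x\<bar> > 0" "x \<in> topspace X" using U by auto
    then obtain n where "inverse (real (Suc n)) < \<bar>\<phi> x\<bar>" using reals_Archimedean by blast
    then show "x \<in> (\<Union>n. C n)" using \<open>x \<in> topspace X\<close> by (auto simp: C_def max_def intro!: exI[of _ n])
  next
    assume "x \<in> (\<Union>n. C n)"
    then obtain n where n: "x \<in> topspace X" "max 0 (\<bar>\<phi> x\<bar> - inverse (real (Suc n))) \<noteq> 0"
      by (auto simp: C_def)
    have "inverse (real (Suc n)) > 0" by simp
    with n have "\<phi> x \<noteq> 0" by (auto simp: max_def split: if_splits)
    with n U show "x \<in> U" by simp
  qed
  moreover have "B n \<inter> C n = {}" for n by (auto simp: B_def C_def max_def)
  moreover have "B n \<union> U = topspace X" for n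
  proof -
    have p: "inverse (real (Suc n)) > 0" by simp
    have "x \<in> B n \<or> x \<in> U" if "x \<in> topspace X" for x
      using p that U by (cases "\<phi> x = 0") (auto simp: B_def max_def)
    then show ?thesis using U by (auto simp: B_def)
  qed
  ultimately show ?thesis by (intro that[of B C]) auto
qed

lemma cozero_set_preimage:
  fixes W :: "real set"
  assumes "continuous_map X euclideanreal \<phi>" "open W"
  shows "cozero_set X {x \<in> topspace X. \<phi> x \<in> W}"
\<comment> \<open>The distance to the complement of \<open>W\<close> vanishes exactly off
  \<open>W\<close>, except that \<open>infdist\<close> to the empty set is 0; hence the case
  split.\<close>
proof (cases "W = UNIV")
  case False
  have "continuous_map X euclideanreal ((\<lambda>t. infdist t (- W)) \<circ> \<phi>)"
    by (rule continuous_map_compose[OF assms(1)]) (simp add: continuous_on_infdist continuous_on_id)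
  then show ?thesis
  proof (rule cozero_setI)
    fix x
    have "infdist (\<phi> x) (- W) = 0 \<longleftrightarrow> \<phi> x \<in> - W"
      using in_closed_iff_infdist_zero[of "- W" "\<phi> x"] assms(2) False by auto
    then show "x \<in> {x \<in> topspace X. \<phi> x \<in> W} \<longleftrightarrow>
        x \<in> topspace X \<and> ((\<lambda>t. infdist t (- W)) \<circ> \<phi>) x \<noteq> 0" by auto
  qed
qed simp

text \<open>Urysohn functions that are 0 off \<open>U\<close> and 1 on \<open>K n\<close> give
  cozero sets between \<open>K n\<close> and \<open>U\<close>; their countable union is
  \<open>U\<close>.\<close>

lemma cozero_set_fsigma:
  fixes K :: "nat \<Rightarrow> 'x set"
  assumes "normal_space X" "openin X U" "\<And>n. closedin X (K n)" "(\<Union>n. K n) = U"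
  shows "cozero_set X U"
proof -
  have "\<exists>V. cozero_set X V \<and> K n \<subseteq> V \<and> V \<subseteq> U" for n
  proof -
    have "closedin X (topspace X - U)" using assms(2) by blast
    moreover have "disjnt (topspace X - U) (K n)" using assms(4) by (auto simp: disjnt_def)
    ultimately obtain f :: "'x \<Rightarrow> real" where f: "continuous_map X euclideanreal f"
      "f ` (topspace X - U) \<subseteq> {0}" "f ` K n \<subseteq> {1}"
      using Urysohn_lemma_alt[OF assms(1) _ assms(3)] by metis
    have "cozero_set X {x \<in> topspace X. f x \<noteq> 0}" by (rule cozero_setI[OF f(1)]) simp
    moreover have "K n \<subseteq> {x \<in> topspace X. f x \<noteq> 0}"
      using f(3) closedin_subset[OF assms(3)[of n]] by force
    moreover have "{x \<in> topspace X. f x \<noteq> 0} \<subseteq> U" using f(2) by auto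
    ultimately show ?thesis by blast
  qed
  then obtain V where V: "\<And>n. cozero_set X (V n)" "\<And>n. K n \<subseteq> V n" "\<And>n. V n \<subseteq> U" by metis
  then have "(\<Union>n. V n) = U" using assms(4) by blast
  with cozero_set_UN[of X V] V(1) show ?thesis by simp
qed

section \<open>Maximal ideals of countably compact Alexandrov algebras\<close>

text \<open>Used as introduction rules, these two let proof search guess the set of which the element is
  least or greatest.\<close>

declare least_closed [rule del, simp del] greatest_closed [rule del, simp del]

text \<open>\<open>sup\<close> chooses some least upper bound; in a partial order there is at most
  one, so any that is exhibited is the value.\<close>

lemma (in partial_order) sup_eqI: "is_lub L s B \<Longrightarrow> \<Squnion>B = s"
  unfolding sup_def by (rule some_equality) (auto dest: least_unique)

lemma (in partial_order) inf_eqI: "is_glb L s B \<Longrightarrow> \<Sqinter>B = s"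
  unfolding inf_def by (rule some_equality) (auto dest: greatest_unique)

context alexandrov_algebra
begin

lemma countable_sup_lub: "countable B \<Longrightarrow> B \<subseteq> carrier L \<Longrightarrow> is_lub L (\<Squnion>B) B"
  using countable_join_exists[of B] sup_eqI by auto

lemma countable_sup_closed: "countable B \<Longrightarrow> B \<subseteq> carrier L \<Longrightarrow> \<Squnion>B \<in> carrier L"
  by (rule least_closed[OF countable_sup_lub])

lemma countable_sup_upper: "countable B \<Longrightarrow> B \<subseteq> carrier L \<Longrightarrow> b \<in> B \<Longrightarrow> b \<sqsubseteq> \<Squnion>B"
  by (rule least_Upper_above[OF countable_sup_lub])

lemma countable_sup_le:
  "countable B \<Longrightarrow> B \<subseteq> carrier L \<Longrightarrow> x \<in> carrier L \<Longrightarrow> (\<And>b. b \<in> B \<Longrightarrow> b \<sqsubseteq> x) \<Longrightarrow> \<Squnion>B \<sqsubseteq> x"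
  by (rule least_le[OF countable_sup_lub]) (simp_all add: Upper_def)

end

section \<open>Ideals of bounded and of distributive lattices\<close>

locale ideal_lattice = bounded_lattice L for L :: "'a gorder" (structure)
begin

lemma top_unique_above: "x \<in> carrier L \<Longrightarrow> \<top> \<sqsubseteq> x \<Longrightarrow> x = \<top>"
  by (rule le_antisym) simp_all

lemma le_joinI1: "z \<sqsubseteq> x \<Longrightarrow> x \<in> carrier L \<Longrightarrow> y \<in> carrier L \<Longrightarrow> z \<in> carrier L \<Longrightarrow> z \<sqsubseteq> x \<squnion> y"
  by (rule le_trans[OF _ join_left]) simp_all

lemma le_joinI2: "z \<sqsubseteq> y \<Longrightarrow> x \<in> carrier L \<Longrightarrow> y \<in> carrier L \<Longrightarrow> z \<in> carrier L \<Longrightarrow> z \<sqsubseteq> x \<squnion> y"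
  by (rule le_trans[OF _ join_right]) simp_all

lemma lattice_ideal_closed: "lattice_ideal L I \<Longrightarrow> x \<in> I \<Longrightarrow> x \<in> carrier L"
  by (auto simp: lattice_ideal_def)

lemma lattice_ideal_down: "lattice_ideal L I \<Longrightarrow> x \<in> I \<Longrightarrow> y \<in> carrier L \<Longrightarrow> y \<sqsubseteq> x \<Longrightarrow> y \<in> I"
  by (auto simp: lattice_ideal_def)

lemma lattice_ideal_join: "lattice_ideal L I \<Longrightarrow> x \<in> I \<Longrightarrow> y \<in> I \<Longrightarrow> x \<squnion> y \<in> I"
  by (auto simp: lattice_ideal_def)

lemma lattice_ideal_bottom:
  assumes "lattice_ideal L I" shows "\<bottom> \<in> I"
proof -
  obtain x where "x \<in> I" using assms by (auto simp: lattice_ideal_def)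
  then show ?thesis
    using lattice_ideal_down[OF assms] lattice_ideal_closed[OF assms] by blast
qed

lemma lattice_ideal_top:
  assumes "lattice_ideal L I" shows "\<top> \<in> I \<longleftrightarrow> I = carrier L"
proof
  assume "\<top> \<in> I"
  then have "x \<in> I" if "x \<in> carrier L" for x
    using lattice_ideal_down[OF assms _ that top_higher[OF that]] by simp
  then show "I = carrier L" using lattice_ideal_closed[OF assms] by (intro subset_antisym subsetI)
qed simp

lemma maximal_imp_ideal: "maximal_lattice_ideal L M \<Longrightarrow> lattice_ideal L M"
  by (simp add: maximal_lattice_ideal_def)

lemma maximal_top: "maximal_lattice_ideal L M \<Longrightarrow> \<top> \<notin> M"
  using lattice_ideal_top[of M] by (simp add: maximal_lattice_ideal_def)

text \<open>The ideal generated by \<open>M\<close> and \<open>x\<close> is strictly larger than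
  \<open>M\<close>, so it contains the top, which therefore lies below some
  \<open>m \<squnion> x\<close>.\<close>

lemma maximal_complement:
  assumes M: "maximal_lattice_ideal L M" and x: "x \<in> carrier L" "x \<notin> M"
  obtains m where "m \<in> M" "m \<squnion> x = \<top>"
proof -
  note I = maximal_imp_ideal[OF M]
  note cl = lattice_ideal_closed[OF I]
  let ?J = "{y \<in> carrier L. \<exists>m\<in>M. y \<sqsubseteq> m \<squnion> x}"
  have JI: "lattice_ideal L ?J"
    unfolding lattice_ideal_def
  proof (intro conjI ballI impI)
    have "x \<sqsubseteq> \<bottom> \<squnion> x" using x by (simp add: join_right)
    then show "?J \<noteq> {}" using lattice_ideal_bottom[OF I] x(1) by blast
    fix y z assume y: "y \<in> ?J"
    show "z \<in> ?J" if z: "z \<in> carrier L" "z \<sqsubseteq> y"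
    proof -
      obtain m where m: "m \<in> M" "y \<sqsubseteq> m \<squnion> x" "y \<in> carrier L" using y by blast
      have "z \<sqsubseteq> m \<squnion> x" by (rule le_trans[OF z(2) m(2)]) (use z m x cl in auto)
      then show ?thesis using z m by blast
    qed
    assume z: "z \<in> ?J"
    obtain m where m: "y \<in> carrier L" "m \<in> M" "y \<sqsubseteq> m \<squnion> x" using y by blast
    obtain n where n: "z \<in> carrier L" "n \<in> M" "z \<sqsubseteq> n \<squnion> x" using z by blast
    note mn = m n
    have mnc: "m \<in> carrier L" "n \<in> carrier L" using mn cl by simp_all
    have "m \<squnion> x \<sqsubseteq> (m \<squnion> n) \<squnion> x" "n \<squnion> x \<sqsubseteq> (m \<squnion> n) \<squnion> x"
      by (simp_all add: join_le join_left join_right le_joinI1 le_joinI2 mnc x(1))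
    then have "y \<sqsubseteq> (m \<squnion> n) \<squnion> x" "z \<sqsubseteq> (m \<squnion> n) \<squnion> x"
      using le_trans[OF m(3)] le_trans[OF n(3)] mnc m(1) n(1) x(1) by simp_all
    then have "y \<squnion> z \<sqsubseteq> (m \<squnion> n) \<squnion> x" using mnc m(1) n(1) x(1) by (simp add: join_le)
    moreover have "m \<squnion> n \<in> M" by (rule lattice_ideal_join[OF I m(2) n(2)])
    ultimately show "y \<squnion> z \<in> ?J" using m(1) n(1) by auto
  qed simp
  have MJ: "M \<subseteq> ?J"
  proof
    fix m assume "m \<in> M"
    then show "m \<in> ?J" using cl[of m] join_left[OF _ x(1), of m] by auto
  qed
  have xJ: "x \<in> ?J"
    using lattice_ideal_bottom[OF I] x(1) join_right[OF bottom_closed x(1)] by auto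
  have "J = M \<or> J = carrier L" if "lattice_ideal L J" "M \<subseteq> J" for J
    using M that unfolding maximal_lattice_ideal_def by simp
  from this[OF JI MJ] have "?J = carrier L"
  proof
    assume e: "?J = M"
    have "x \<in> M" using xJ unfolding e .
    then show ?thesis using x(2) by contradiction
  qed
  then have "\<top> \<in> ?J" by simp
  then obtain m where m: "m \<in> M" "\<top> \<sqsubseteq> m \<squnion> x" by blast
  show ?thesis by (rule that[OF m(1) top_unique_above[OF _ m(2)]]) (simp add: m(1) x(1) cl)
qed

text \<open>Zorn's lemma for the ideals above \<open>I\<close> that omit the top. An ideal is proper
  exactly if it omits the top, and this condition passes to unions of chains.\<close>

lemma maximal_lattice_ideal_extend:
  assumes I: "lattice_ideal L I" "\<top> \<notin> I"
  obtains M where "maximal_lattice_ideal L M" "I \<subseteq> M"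
proof -
  let ?A = "{J. lattice_ideal L J \<and> I \<subseteq> J \<and> \<top> \<notin> J}"
  have "\<exists>M\<in>?A. \<forall>X\<in>?A. M \<subseteq> X \<longrightarrow> X = M"
  proof (rule subset_Zorn_nonempty)
    show "?A \<noteq> {}" using I by auto
    fix \<C> assume ne: "\<C> \<noteq> {}" and ch: "subset.chain ?A \<C>"
    then have id: "lattice_ideal L J" "I \<subseteq> J" "\<top> \<notin> J" if "J \<in> \<C>" for J
      using that by (auto simp: subset.chain_def)
    have "lattice_ideal L (\<Union>\<C>)"
      unfolding lattice_ideal_def
    proof (intro conjI ballI impI)
      show "\<Union>\<C> \<subseteq> carrier L" using id(1) lattice_ideal_closed by blast
      show "\<Union>\<C> \<noteq> {}" using ne id(1) lattice_ideal_bottom by blast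
      fix x y assume x: "x \<in> \<Union>\<C>"
      show "y \<in> \<Union>\<C>" if "y \<in> carrier L" "y \<sqsubseteq> x"
        using x that id(1) lattice_ideal_down by blast
      assume y: "y \<in> \<Union>\<C>"
      obtain J K where JK: "J \<in> \<C>" "x \<in> J" "K \<in> \<C>" "y \<in> K" using x y by blast
      then have "J \<subseteq> K \<or> K \<subseteq> J" using ch unfolding subset.chain_def by blast
      then show "x \<squnion> y \<in> \<Union>\<C>" using JK id(1) lattice_ideal_join by blast
    qed
    then show "\<Union>\<C> \<in> ?A" using id ne by blast
  qed
  then obtain M where MA: "M \<in> ?A" and mx: "\<forall>X\<in>?A. M \<subseteq> X \<longrightarrow> X = M" ..
  have M: "lattice_ideal L M" "I \<subseteq> M" "\<top> \<notin> M" using MA by auto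
  have "J = M \<or> J = carrier L" if J: "lattice_ideal L J" "M \<subseteq> J" for J
  proof (cases "\<top> \<in> J")
    case False
    then have "J \<in> ?A" using J M by auto
    with mx J(2) show ?thesis by simp
  qed (simp add: lattice_ideal_top[OF J(1)])
  then have "maximal_lattice_ideal L M"
    unfolding maximal_lattice_ideal_def using M lattice_ideal_top[OF M(1)] by simp
  then show ?thesis using that M(2) by blast
qed

end

locale ideal_distributive_lattice = distributive_lattice L for L :: "'a gorder" (structure)

sublocale ideal_distributive_lattice \<subseteq> ideal_lattice ..

context ideal_distributive_lattice
begin

text \<open>If \<open>y\<close> is outside \<open>M\<close>, some \<open>m\<close> in
  \<open>M\<close> joins with \<open>y\<close> to the top, so by distributivity \<open>x\<close> is
  the join of \<open>x \<sqinter> m\<close> and \<open>x \<sqinter> y\<close>, both in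
  \<open>M\<close>.\<close>

lemma maximal_prime:
  assumes M: "maximal_lattice_ideal L M" and xy: "x \<in> carrier L" "y \<in> carrier L" "x \<sqinter> y \<in> M"
  shows "x \<in> M \<or> y \<in> M"
proof (rule ccontr)
  assume n: "\<not> (x \<in> M \<or> y \<in> M)"
  note I = maximal_imp_ideal[OF M]
  obtain m where m: "m \<in> M" "m \<squnion> y = \<top>"
    using maximal_complement[OF M xy(2)] n by blast
  note mc = lattice_ideal_closed[OF I m(1)]
  have "x \<sqinter> m \<in> M" using lattice_ideal_down[OF I m(1)] mc xy meet_right by simp
  then have "(x \<sqinter> m) \<squnion> (x \<sqinter> y) \<in> M" using xy(3) lattice_ideal_join[OF I] by blast
  then have "x \<sqinter> \<top> \<in> M" using meet_join_distrib[OF xy(1) mc xy(2)] m by simp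
  moreover have "x \<sqsubseteq> x \<sqinter> \<top>" using xy by (simp add: meet_le)
  ultimately show False using n lattice_ideal_down[OF I _ xy(1)] by simp
qed

end

section \<open>Separation of lattice elements by maximal ideals\<close>

locale cc_alexandrov = cc_alexandrov_algebra L for L :: "'a gorder" (structure)

sublocale cc_alexandrov \<subseteq> ideal_distributive_lattice ..

context cc_alexandrov
begin

text \<open>Bridges two kinds of joins: countable compactness speaks of joins of finite sets, ideals
  are closed under binary joins.\<close>

lemma lattice_ideal_finite_sup:
  assumes I: "lattice_ideal L I" and F: "finite F" "F \<subseteq> I" shows "\<Squnion>F \<in> I"
  using F
proof (induction F rule: finite_induct)
  case empty
  have "\<Squnion>{} \<sqsubseteq> \<bottom>" by (rule countable_sup_le) simp_all
  then show ?case
    using lattice_ideal_down[OF I lattice_ideal_bottom[OF I]] countable_sup_closed[of "{}"] by simp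
next
  case (insert x F)
  have c: "x \<in> carrier L" "F \<subseteq> carrier L" "countable F"
    using insert.prems lattice_ideal_closed[OF I] insert.hyps(1) by (auto intro: countable_finite)
  have sc: "\<Squnion>F \<in> carrier L" using c countable_sup_closed by simp
  have "\<Squnion>(insert x F) \<sqsubseteq> x \<squnion> \<Squnion>F"
  proof (rule countable_sup_le)
    fix b assume "b \<in> insert x F"
    then show "b \<sqsubseteq> x \<squnion> \<Squnion>F"
    proof
      assume "b \<in> F"
      then have "b \<sqsubseteq> \<Squnion>F" "b \<in> carrier L" using c countable_sup_upper by auto
      then show ?thesis using sc c(1) by (simp add: le_joinI2)
    qed (simp add: c sc join_left)
  qed (simp_all add: c sc)
  moreover have "x \<squnion> \<Squnion>F \<in> I" using insert lattice_ideal_join[OF I] by simp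
  moreover have "\<Squnion>(insert x F) \<in> carrier L" using c countable_sup_closed by simp
  ultimately show ?case using lattice_ideal_down[OF I] by simp
qed

text \<open>The source of points: by hypothesis the ideal of elements below finite joins from
  \<open>B\<close> omits the top. \<open>B\<close> may be uncountable, as it is when compactness of
  the maximal ideal space is derived from an arbitrary open cover.\<close>

lemma maximal_superset:
  assumes B: "B \<subseteq> carrier L" and n: "\<And>F. finite F \<Longrightarrow> F \<subseteq> B \<Longrightarrow> \<Squnion>F \<noteq> \<top>"
  obtains M where "maximal_lattice_ideal L M" "B \<subseteq> M"
proof -
  let ?I = "{y \<in> carrier L. \<exists>F. finite F \<and> F \<subseteq> B \<and> y \<sqsubseteq> \<Squnion>F}"
  have cl: "\<Squnion>F \<in> carrier L" if "finite F" "F \<subseteq> B" for F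
    using that B by (intro countable_sup_closed) (auto intro: countable_finite)
  have "lattice_ideal L ?I"
    unfolding lattice_ideal_def
  proof (intro conjI ballI impI)
    have "\<bottom> \<sqsubseteq> \<Squnion>{}" using cl[of "{}"] by simp
    then have "\<bottom> \<in> ?I" by auto
    then show "?I \<noteq> {}" by blast
    fix y z assume y: "y \<in> ?I"
    show "z \<in> ?I" if z: "z \<in> carrier L" "z \<sqsubseteq> y"
    proof -
      obtain F where F: "y \<in> carrier L" "finite F" "F \<subseteq> B" "y \<sqsubseteq> \<Squnion>F" using y by blast
      have "z \<sqsubseteq> \<Squnion>F" by (rule le_trans[OF z(2) F(4)]) (simp_all add: z F cl)
      then show ?thesis using z F by blast
    qed
    assume z: "z \<in> ?I"
    obtain F where F: "y \<in> carrier L" "finite F" "F \<subseteq> B" "y \<sqsubseteq> \<Squnion>F" using y by blast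
    obtain G where G: "z \<in> carrier L" "finite G" "G \<subseteq> B" "z \<sqsubseteq> \<Squnion>G" using z by blast
    note FG = F G
    have u: "finite (F \<union> G)" "F \<union> G \<subseteq> B" using FG by auto
    have "\<Squnion>H \<sqsubseteq> \<Squnion>(F \<union> G)" if "H \<subseteq> F \<union> G" for H
    proof (rule countable_sup_le)
      show "countable H" using that u(1) finite_subset countable_finite by blast
      show "b \<sqsubseteq> \<Squnion>(F \<union> G)" if "b \<in> H" for b
        using that \<open>H \<subseteq> F \<union> G\<close> u B by (intro countable_sup_upper) (auto intro: countable_finite)
    qed (use that u B cl[OF u] in auto)
    then have "\<Squnion>F \<sqsubseteq> \<Squnion>(F \<union> G)" "\<Squnion>G \<sqsubseteq> \<Squnion>(F \<union> G)" by simp_all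
    then have "y \<sqsubseteq> \<Squnion>(F \<union> G)" "z \<sqsubseteq> \<Squnion>(F \<union> G)"
      using le_trans[OF F(4)] le_trans[OF G(4)] F G cl u by simp_all
    then have "y \<squnion> z \<sqsubseteq> \<Squnion>(F \<union> G)" using F(1) G(1) cl[OF u] by (simp add: join_le)
    moreover have "y \<squnion> z \<in> carrier L" using F(1) G(1) by simp
    ultimately show "y \<squnion> z \<in> ?I" using u by blast
  qed simp
  moreover have "\<top> \<notin> ?I" using n top_unique_above[OF cl] by auto
  ultimately obtain M where M: "maximal_lattice_ideal L M" "?I \<subseteq> M"
    by (rule maximal_lattice_ideal_extend)
  have "b \<in> ?I" if "b \<in> B" for b
  proof -
    have "b \<sqsubseteq> \<Squnion>{b}" using that B by (intro countable_sup_upper) auto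
    then show ?thesis using that B by blast
  qed
  then have "B \<subseteq> M" using M(2) by blast
  then show ?thesis by (rule that[OF M(1)])
qed

lemma basic_open_iff: "M \<in> basic_open L d \<longleftrightarrow> maximal_lattice_ideal L M \<and> d \<notin> M"
  by (simp add: basic_open_def)

lemma basic_open_top: "basic_open L \<top> = {M. maximal_lattice_ideal L M}"
  unfolding basic_open_def using maximal_top by blast

lemma basic_open_subset: "basic_open L d \<subseteq> {M. maximal_lattice_ideal L M}"
  unfolding basic_open_def by blast

lemma maximal_bottom: "maximal_lattice_ideal L M \<Longrightarrow> \<bottom> \<in> M"
  by (rule lattice_ideal_bottom[OF maximal_imp_ideal])

lemma maximal_join:
  assumes M: "maximal_lattice_ideal L M" and xy: "x \<in> carrier L" "y \<in> carrier L"
  shows "x \<squnion> y \<in> M \<longleftrightarrow> x \<in> M \<and> y \<in> M"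
proof
  note I = maximal_imp_ideal[OF M]
  show "x \<squnion> y \<in> M" if "x \<in> M \<and> y \<in> M" using that lattice_ideal_join[OF I] by simp
  assume "x \<squnion> y \<in> M"
  from lattice_ideal_down[OF I this xy(1) join_left[OF xy]] lattice_ideal_down[OF I this xy(2) join_right[OF xy]]
  show "x \<in> M \<and> y \<in> M" ..
qed

lemma maximal_meet:
  assumes M: "maximal_lattice_ideal L M" and xy: "x \<in> carrier L" "y \<in> carrier L"
  shows "x \<sqinter> y \<in> M \<longleftrightarrow> x \<in> M \<or> y \<in> M"
proof
  note I = maximal_imp_ideal[OF M]
  show "x \<in> M \<or> y \<in> M" if "x \<sqinter> y \<in> M" by (rule maximal_prime[OF M xy that])
  assume "x \<in> M \<or> y \<in> M"
  then show "x \<sqinter> y \<in> M"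
    using lattice_ideal_down[OF I, of x "x \<sqinter> y"] lattice_ideal_down[OF I, of y "x \<sqinter> y"] xy
    by (elim disjE) (simp_all add: meet_left meet_right)
qed

lemma basic_open_bottom: "basic_open L \<bottom> = {}"
  unfolding basic_open_def using maximal_bottom by blast

lemma basic_open_mono:
  assumes "a \<in> carrier L" "b \<in> carrier L" "a \<sqsubseteq> b"
  shows "basic_open L a \<subseteq> basic_open L b"
proof
  fix M assume M: "M \<in> basic_open L a"
  then have "b \<notin> M"
    using lattice_ideal_down[OF maximal_imp_ideal, of M b a] assms by (auto simp: basic_open_iff)
  then show "M \<in> basic_open L b" using M by (simp add: basic_open_iff)
qed

lemma basic_open_meet:
  assumes "a \<in> carrier L" "b \<in> carrier L"
  shows "basic_open L (a \<sqinter> b) = basic_open L a \<inter> basic_open L b"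
  using maximal_meet[OF _ assms] unfolding basic_open_def by blast

lemma basic_open_join:
  assumes "a \<in> carrier L" "b \<in> carrier L"
  shows "basic_open L (a \<squnion> b) = basic_open L a \<union> basic_open L b"
  using maximal_join[OF _ assms] unfolding basic_open_def by blast

text \<open>Countable compactness gives the nontrivial inclusion: if the join of \<open>B\<close> is
  outside \<open>M\<close>, some \<open>m\<close> in \<open>M\<close> complements it, so finitely
  many elements of \<open>insert m B\<close> already join to the top. They cannot all lie in
  \<open>M\<close>, so some member of \<open>B\<close> is outside.\<close>

lemma basic_open_sup:
  assumes "countable B" "B \<subseteq> carrier L"
  shows "basic_open L (\<Squnion>B) = (\<Union>b\<in>B. basic_open L b)"
proof
  show "(\<Union>b\<in>B. basic_open L b) \<subseteq> basic_open L (\<Squnion>B)"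
    using assms by (intro UN_least basic_open_mono countable_sup_upper countable_sup_closed) auto
  show "basic_open L (\<Squnion>B) \<subseteq> (\<Union>b\<in>B. basic_open L b)"
  proof
    fix M assume "M \<in> basic_open L (\<Squnion>B)"
    then have M: "maximal_lattice_ideal L M" "\<Squnion>B \<notin> M" by (auto simp: basic_open_iff)
    note I = maximal_imp_ideal[OF M(1)]
    obtain m where m: "m \<in> M" "m \<squnion> \<Squnion>B = \<top>"
      using maximal_complement[OF M(1) countable_sup_closed[OF assms] M(2)] .
    note mc = lattice_ideal_closed[OF I m(1)]
    have c: "countable (insert m B)" "insert m B \<subseteq> carrier L" using assms mc by auto
    have "m \<squnion> \<Squnion>B \<sqsubseteq> \<Squnion>(insert m B)"
    proof (rule join_le)
      show "m \<sqsubseteq> \<Squnion>(insert m B)" using c by (intro countable_sup_upper) auto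
      show "\<Squnion>B \<sqsubseteq> \<Squnion>(insert m B)"
        using c assms by (intro countable_sup_le countable_sup_closed countable_sup_upper) auto
    qed (use c assms mc countable_sup_closed in auto)
    then have "\<Squnion>(insert m B) = \<top>"
      using m(2) top_unique_above countable_sup_closed[OF c] by simp
    then obtain F where F: "finite F" "F \<subseteq> insert m B" "\<Squnion>F = \<top>"
      using countably_compact[OF c] by blast
    have "\<not> B \<subseteq> M"
      using lattice_ideal_finite_sup[OF I F(1)] F(2,3) m(1) maximal_top[OF M(1)] by auto
    then show "M \<in> (\<Union>b\<in>B. basic_open L b)" using M(1) by (auto simp: basic_open_iff)
  qed
qed

text \<open>Take approximating sequences for \<open>a\<close>. If \<open>B n\<close> and
  \<open>b\<close> did not join to the top, a maximal ideal would contain both, hence also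
  \<open>a\<close> by the inclusion, and then the top. Meeting \<open>C n\<close> with
  \<open>B n \<squnion> b = \<top>\<close> puts \<open>C n\<close> below \<open>b\<close>, and
  \<open>a\<close> is the join of the \<open>C n\<close>.\<close>

lemma basic_open_le:
  assumes ab: "a \<in> carrier L" "b \<in> carrier L" and sub: "basic_open L a \<subseteq> basic_open L b"
  shows "a \<sqsubseteq> b"
proof -
  obtain B C :: "nat \<Rightarrow> 'a" where BC: "range B \<subseteq> carrier L" "range C \<subseteq> carrier L" "\<Squnion>(range C) = a"
    and n: "\<And>n. B n \<sqinter> C n = \<bottom>" "\<And>n. B n \<squnion> a = \<top>"
    using approximating_sequences[OF ab(1)] by blast
  have Bc: "B n \<in> carrier L" and Cc: "C n \<in> carrier L" for n using BC by auto
  have "C n \<sqsubseteq> b" for n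
  proof -
    have "B n \<squnion> b = \<top>"
    proof (rule ccontr)
      assume ne: "B n \<squnion> b \<noteq> \<top>"
      have "\<Squnion>F \<noteq> \<top>" if F: "finite F" "F \<subseteq> {B n, b}" for F
      proof
        assume "\<Squnion>F = \<top>"
        moreover have "\<Squnion>F \<sqsubseteq> B n \<squnion> b"
          using F Bc ab by (intro countable_sup_le) (auto simp: countable_finite join_left join_right)
        ultimately show False using ne top_unique_above Bc ab by simp
      qed
      then obtain M where M: "maximal_lattice_ideal L M" "B n \<in> M" "b \<in> M"
        using maximal_superset[of "{B n, b}"] Bc ab by (metis bot.extremum empty_subsetI insert_subset)
      then have "a \<in> M" using sub by (auto simp: basic_open_iff)
      then have "\<top> \<in> M" using n(2)[of n] M lattice_ideal_join[OF maximal_imp_ideal[OF M(1)]] by metis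
      then show False using maximal_top M(1) by blast
    qed
    then have eq: "C n \<sqinter> \<top> = \<bottom> \<squnion> (C n \<sqinter> b)"
      using meet_join_distrib[OF Cc Bc ab(2), of n n] n(1)[of n] by (simp add: meet_comm)
    have "C n \<sqsubseteq> C n \<sqinter> \<top>" using Cc by (simp add: meet_le)
    moreover have "C n \<sqinter> \<top> \<sqsubseteq> b" using Cc ab unfolding eq by (simp add: join_le meet_right)
    ultimately show ?thesis by (rule le_trans) (use Cc ab in simp_all)
  qed
  then show ?thesis unfolding BC(3)[symmetric] using BC(2) ab(2) by (intro countable_sup_le) auto
qed

lemma basic_open_inj:
  "a \<in> carrier L \<Longrightarrow> b \<in> carrier L \<Longrightarrow> basic_open L a = basic_open L b \<Longrightarrow> a = b"
  by (rule le_antisym) (simp_all add: basic_open_le)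

section \<open>The topology of the maximal ideal space\<close>

lemma topspace_Max_space: "topspace (Max_space L) = {M. maximal_lattice_ideal L M}"
  using basic_open_top basic_open_subset top_closed by (fastforce simp: Max_space_def)

lemma openin_Max_space_basic: "d \<in> carrier L \<Longrightarrow> openin (Max_space L) (basic_open L d)"
  by (auto simp: Max_space_def intro: topology_generated_by_Basis)

text \<open>The basic sets form a base and not only a subbase, because \<open>basic_open\<close>
  turns meets into intersections.\<close>

lemma openin_Max_spaceD:
  assumes "openin (Max_space L) U" "M \<in> U"
  obtains d where "d \<in> carrier L" "M \<in> basic_open L d" "basic_open L d \<subseteq> U"
proof -
  have "generate_topology_on (basic_open L ` carrier L) U"
    using assms(1) by (simp add: Max_space_def openin_topology_generated_by)
  then have "\<forall>M\<in>U. \<exists>d\<in>carrier L. M \<in> basic_open L d \<and> basic_open L d \<subseteq> U"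
  proof induction
    case (Int U V)
    show ?case
    proof
      fix M assume "M \<in> U \<inter> V"
      then obtain d e where "d \<in> carrier L" "M \<in> basic_open L d" "basic_open L d \<subseteq> U"
        "e \<in> carrier L" "M \<in> basic_open L e" "basic_open L e \<subseteq> V" using Int.IH by blast
      then show "\<exists>d\<in>carrier L. M \<in> basic_open L d \<and> basic_open L d \<subseteq> U \<inter> V"
        by (intro bexI[of _ "d \<sqinter> e"]) (auto simp: basic_open_meet)
    qed
  next
    case (UN K) then show ?case by (meson UnionE Union_upper subset_trans)
  qed auto
  then show ?thesis using assms(2) that by blast
qed

text \<open>Let \<open>B\<close> consist of the elements whose basic set lies inside a member of the
  cover. No member could cover a maximal ideal that contains \<open>B\<close>, so by
  \<open>maximal_superset\<close> a finite part of \<open>B\<close> joins to the top; one member for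
  each of its elements gives the finite subcover.\<close>

lemma compact_space_Max_space: "compact_space (Max_space L)"
  unfolding compact_space_alt
proof (intro allI impI)
  fix \<U> assume "(\<forall>U\<in>\<U>. openin (Max_space L) U) \<and> topspace (Max_space L) \<subseteq> \<Union>\<U>"
  then have op: "\<forall>U\<in>\<U>. openin (Max_space L) U" and cov: "topspace (Max_space L) \<subseteq> \<Union>\<U>" by simp_all
  define B where "B = {d \<in> carrier L. \<exists>U\<in>\<U>. basic_open L d \<subseteq> U}"
  have "\<exists>F. finite F \<and> F \<subseteq> B \<and> \<Squnion>F = \<top>"
  proof (rule ccontr)
    assume "\<not> ?thesis"
    then obtain M where M: "maximal_lattice_ideal L M" "B \<subseteq> M"
      using maximal_superset[of B] by (auto simp: B_def)
    then obtain U where "U \<in> \<U>" "M \<in> U" using cov by (auto simp: topspace_Max_space)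
    then obtain d where "d \<in> carrier L" "M \<in> basic_open L d" "basic_open L d \<subseteq> U"
      using op openin_Max_spaceD by metis
    then show False using M \<open>U \<in> \<U>\<close> by (auto simp: B_def basic_open_iff)
  qed
  then obtain F where F: "finite F" "F \<subseteq> B" "\<Squnion>F = \<top>" by blast
  then have "\<forall>d\<in>F. \<exists>U\<in>\<U>. basic_open L d \<subseteq> U" by (auto simp: B_def)
  then obtain U where U: "\<And>d. d \<in> F \<Longrightarrow> U d \<in> \<U> \<and> basic_open L d \<subseteq> U d" by metis
  have "F \<subseteq> carrier L" using F by (auto simp: B_def)
  then have "topspace (Max_space L) = (\<Union>d\<in>F. basic_open L d)"
    using basic_open_sup[of F] F basic_open_top by (simp add: topspace_Max_space countable_finite)
  then have "topspace (Max_space L) \<subseteq> \<Union>(U ` F)" using U by auto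
  then show "\<exists>\<F>. finite \<F> \<and> \<F> \<subseteq> \<U> \<and> topspace (Max_space L) \<subseteq> \<Union>\<F>"
    using F(1) U by (intro exI[of _ "U ` F"]) auto
qed

text \<open>Pick \<open>b\<close> in \<open>N\<close> outside \<open>M\<close> and a complement
  \<open>a\<close> of it in \<open>M\<close>. The disjoint pair that normality supplies for
  \<open>a\<close> and \<open>b\<close> has \<open>c\<close> outside \<open>M\<close> and
  \<open>d\<close> outside \<open>N\<close>.\<close>

lemma Hausdorff_space_Max_space: "Hausdorff_space (Max_space L)"
  unfolding Hausdorff_space_def topspace_Max_space
proof (intro allI impI)
  fix M N assume "M \<in> {M. maximal_lattice_ideal L M} \<and> N \<in> {M. maximal_lattice_ideal L M} \<and> M \<noteq> N"
  then have M: "maximal_lattice_ideal L M" and N: "maximal_lattice_ideal L N" and ne: "M \<noteq> N" by auto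
  note I = maximal_imp_ideal[OF M] and J = maximal_imp_ideal[OF N]
  have "\<not> N \<subseteq> M" using M N ne unfolding maximal_lattice_ideal_def by blast
  then obtain b where b: "b \<in> N" "b \<notin> M" by blast
  then have bc: "b \<in> carrier L" using lattice_ideal_closed[OF J] by blast
  obtain a where a: "a \<in> M" "a \<squnion> b = \<top>" using maximal_complement[OF M bc b(2)] .
  then have ac: "a \<in> carrier L" using lattice_ideal_closed[OF I] by blast
  obtain c d where cd: "c \<in> carrier L" "d \<in> carrier L" "c \<squnion> a = \<top>" "b \<squnion> d = \<top>" "c \<sqinter> d = \<bottom>"
    using normal[OF ac bc a(2)] by blast
  have "c \<notin> M" using cd(3) a(1) lattice_ideal_join[OF I] maximal_top[OF M] by metis
  moreover have "d \<notin> N" using cd(4) b(1) lattice_ideal_join[OF J] maximal_top[OF N] by metis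
  moreover have "disjnt (basic_open L c) (basic_open L d)"
    using basic_open_meet[OF cd(1,2)] cd(5) basic_open_bottom by (simp add: disjnt_def)
  ultimately show "\<exists>U V. openin (Max_space L) U \<and> openin (Max_space L) V \<and> M \<in> U \<and> N \<in> V \<and> disjnt U V"
    using M N cd openin_Max_space_basic by (intro exI[of _ "basic_open L c"] exI[of _ "basic_open L d"]) (auto simp: basic_open_iff)
qed

lemma normal_space_Max_space: "normal_space (Max_space L)"
  by (rule compact_Hausdorff_or_regular_imp_normal_space)
    (simp_all add: compact_space_Max_space Hausdorff_space_Max_space)

lemma cozero_set_Max_space_iff:
  "cozero_set (Max_space L) U \<longleftrightarrow> U \<in> basic_open L ` carrier L"
proof
  assume "U \<in> basic_open L ` carrier L"
  then obtain a where a: "a \<in> carrier L" and U: "U = basic_open L a" by blast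
  obtain B C :: "nat \<Rightarrow> 'a" where BC: "range B \<subseteq> carrier L" "range C \<subseteq> carrier L" "\<Squnion>(range C) = a"
    and n: "\<And>n. B n \<sqinter> C n = \<bottom>" "\<And>n. B n \<squnion> a = \<top>"
    using approximating_sequences[OF a] by blast
  have Bc: "B n \<in> carrier L" and Cc: "C n \<in> carrier L" for n using BC by auto
  \<comment> \<open>The complement of \<open>basic_open L (B n)\<close> is squeezed between
    \<open>basic_open L (C n)\<close> and \<open>U\<close>, so these closed sets exhaust
    \<open>U\<close>.\<close>
  let ?K = "\<lambda>n. topspace (Max_space L) - basic_open L (B n)"
  show "cozero_set (Max_space L) U"
  proof (rule cozero_set_fsigma[OF normal_space_Max_space])
    show "openin (Max_space L) U" using a U openin_Max_space_basic by simp
    show "closedin (Max_space L) (?K n)" for n using openin_Max_space_basic[OF Bc] by blast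
    have "basic_open L (C n) \<subseteq> ?K n" for n
      using basic_open_meet[OF Bc[of n] Cc[of n]] n(1)[of n] basic_open_bottom basic_open_subset
      by (auto simp: topspace_Max_space)
    moreover have "?K n \<subseteq> U" for n
      using basic_open_join[OF Bc[of n] a] n(2)[of n] basic_open_top U by (auto simp: topspace_Max_space)
    moreover have "U = (\<Union>n. basic_open L (C n))"
      using basic_open_sup[of "range C"] BC U by simp
    ultimately show "(\<Union>n. ?K n) = U" by blast
  qed
next
  assume U: "cozero_set (Max_space L) U"
  obtain B C where BC: "\<And>n. cozero_set (Max_space L) (B n)" "(\<Union>n::nat. C n) = U"
    "\<And>n. B n \<inter> C n = {}" "\<And>n. B n \<union> U = topspace (Max_space L)"
    and C: "\<And>n. cozero_set (Max_space L) (C n)"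
    using cozero_set_approximation[OF U] by metis
  have "\<exists>F. finite F \<and> F \<subseteq> carrier L \<and> C n \<subseteq> (\<Union>d\<in>F. basic_open L d) \<and> (\<Union>d\<in>F. basic_open L d) \<subseteq> U" for n
  proof -
    \<comment> \<open>This closed, hence compact, set contains \<open>C n\<close> and lies in
      \<open>U\<close>, so finitely many basic sets inside \<open>U\<close> cover it; collecting
      them over all \<open>n\<close> keeps the family countable.\<close>
    let ?K = "topspace (Max_space L) - B n"
    have "compactin (Max_space L) ?K"
      using closedin_compact_space[OF compact_space_Max_space] cozero_set_openin[OF BC(1)] by blast
    moreover have "?K \<subseteq> \<Union>(basic_open L ` {d \<in> carrier L. basic_open L d \<subseteq> U})"
    proof
      fix M assume "M \<in> ?K"
      then have "M \<in> U" using BC(4) by blast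
      then show "M \<in> \<Union>(basic_open L ` {d \<in> carrier L. basic_open L d \<subseteq> U})"
        using openin_Max_spaceD[OF cozero_set_openin[OF U]] by (metis (mono_tags, lifting) UN_I mem_Collect_eq)
    qed
    moreover have "openin (Max_space L) V" if "V \<in> basic_open L ` {d \<in> carrier L. basic_open L d \<subseteq> U}" for V
      using that openin_Max_space_basic by auto
    ultimately have "\<exists>\<F>. finite \<F> \<and> \<F> \<subseteq> basic_open L ` {d \<in> carrier L. basic_open L d \<subseteq> U} \<and> ?K \<subseteq> \<Union>\<F>"
      by (intro compactinD)
    then obtain \<F> where \<F>: "finite \<F>" "\<F> \<subseteq> basic_open L ` {d \<in> carrier L. basic_open L d \<subseteq> U}" "?K \<subseteq> \<Union>\<F>"
      by (elim exE conjE)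
    then obtain F where F: "F \<subseteq> {d \<in> carrier L. basic_open L d \<subseteq> U}" "finite F" "\<F> = basic_open L ` F"
      using finite_subset_image[OF \<F>(1,2)] by (elim exE conjE)
    have "C n \<subseteq> ?K" using BC(3)[of n] cozero_set_subset[OF C] by blast
    then show ?thesis using F \<F>(3) by (intro exI[of _ F]) auto
  qed
  then obtain F where F: "\<And>n. finite (F n)" "\<And>n. F n \<subseteq> carrier L"
    "\<And>n. C n \<subseteq> (\<Union>d\<in>F n. basic_open L d)" "\<And>n. (\<Union>d\<in>F n. basic_open L d) \<subseteq> U" by metis
  let ?F = "\<Union>n. F n"
  have c: "countable ?F" "?F \<subseteq> carrier L" using F(1,2) by (auto intro: countable_finite)
  have "(\<Union>d\<in>?F. basic_open L d) = (\<Union>n. \<Union>d\<in>F n. basic_open L d)" by simp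
  also have "\<dots> = (\<Union>n. C n)"
  proof
    show "(\<Union>n. \<Union>d\<in>F n. basic_open L d) \<subseteq> (\<Union>n. C n)" unfolding BC(2) by (intro UN_least F(4))
    show "(\<Union>n. C n) \<subseteq> (\<Union>n. \<Union>d\<in>F n. basic_open L d)" by (intro UN_mono F(3)) simp
  qed
  finally have "U = basic_open L (\<Squnion>?F)" using basic_open_sup[OF c] BC(2) by simp
  then show "U \<in> basic_open L ` carrier L" using countable_sup_closed[OF c] by (rule image_eqI)
qed

lemma preimage_elt:
  assumes "continuous_map (Max_space L) euclideanreal \<phi>" "open U"
  shows "preimage_elt L \<phi> U \<in> carrier L"
    and "basic_open L (preimage_elt L \<phi> U) = {M \<in> topspace (Max_space L). \<phi> M \<in> U}"
proof -
  obtain d where d: "d \<in> carrier L" "{M \<in> topspace (Max_space L). \<phi> M \<in> U} = basic_open L d"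
    using cozero_set_preimage[OF assms] cozero_set_Max_space_iff by auto
  have "preimage_elt L \<phi> U \<in> carrier L \<and>
      {M \<in> topspace (Max_space L). \<phi> M \<in> U} = basic_open L (preimage_elt L \<phi> U)"
    unfolding preimage_elt_def by (rule theI[of _ d]) (use d basic_open_inj in auto)
  then show "preimage_elt L \<phi> U \<in> carrier L"
    and "basic_open L (preimage_elt L \<phi> U) = {M \<in> topspace (Max_space L). \<phi> M \<in> U}" by auto
qed

lemma preimage_elt_notin:
  assumes "continuous_map (Max_space L) euclideanreal \<phi>" "open U" "maximal_lattice_ideal L M"
  shows "preimage_elt L \<phi> U \<notin> M \<longleftrightarrow> \<phi> M \<in> U"
proof -
  have "M \<in> basic_open L (preimage_elt L \<phi> U) \<longleftrightarrow> \<phi> M \<in> U"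
    unfolding preimage_elt(2)[OF assms(1,2)] by (simp add: topspace_Max_space assms(3))
  then show ?thesis by (simp add: basic_open_iff assms(3))
qed

text \<open>The tool that reduces identities between lattice elements to statements about the real
  number \<open>\<phi> M\<close> at each maximal ideal.\<close>

lemma preimage_elt_eqI:
  assumes "continuous_map (Max_space L) euclideanreal \<phi>" "open U" "d \<in> carrier L"
    and "\<And>M. maximal_lattice_ideal L M \<Longrightarrow> \<phi> M \<in> U \<longleftrightarrow> d \<notin> M"
  shows "preimage_elt L \<phi> U = d"
proof (rule basic_open_inj[OF preimage_elt(1)[OF assms(1,2)] assms(3)])
  have "{M \<in> topspace (Max_space L). \<phi> M \<in> U} = basic_open L d"
    unfolding topspace_Max_space basic_open_def using assms(4) by auto
  then show "basic_open L (preimage_elt L \<phi> U) = basic_open L d"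
    by (simp only: preimage_elt(2)[OF assms(1,2)])
qed

end

section \<open>Realisations of the ring of continuous functions\<close>

lemma transfer_ring:
  assumes R: "cring R" and inj: "inj_on \<Phi> (carrier R)"
  shows transfer_ring_iso: "\<Phi> \<in> ring_iso R (transfer_ring R \<Phi> (\<Phi> ` carrier R))"
    and cring_transfer_ring: "cring (transfer_ring R \<Phi> (\<Phi> ` carrier R))"
proof -
  let ?T = "transfer_ring R \<Phi> (\<Phi> ` carrier R)"
  show iso: "\<Phi> \<in> ring_iso R ?T"
    by (rule ring_iso_memI) (auto simp: transfer_ring_def Let_def bij_betw_def inj)
  \<comment> \<open>Transport along the isomorphism resets the zero of the target to the image of
    zero; \<open>transfer_ring\<close> already has it there.\<close>
  have "cring (?T\<lparr>zero := \<Phi> \<zero>\<^bsub>R\<^esub>\<rparr>)"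
    by (rule cring.ring_iso_imp_img_cring[OF R iso])
  also have "?T\<lparr>zero := \<Phi> \<zero>\<^bsub>R\<^esub>\<rparr> = ?T" by (simp add: transfer_ring_def Let_def)
  finally show "cring ?T" .
qed

text \<open>For the functor R, the base \<open>W\<close> consists of all open sets, for M of the rational intervals.\<close>

definition sample :: "'i set \<Rightarrow> ('i \<Rightarrow> real set) \<Rightarrow> 'a gorder \<Rightarrow> ('a set \<Rightarrow> real) \<Rightarrow> 'i \<Rightarrow> 'a" where
  "sample I W S \<phi> = (\<lambda>i\<in>I. preimage_elt S \<phi> (W i))"

text \<open>The carrier is the range of \<open>sample\<close> by decree; \<open>R_carrier_eq\<close>
  and \<open>M_carrier_eq\<close> show that the axioms of the two functors describe exactly this
  range.\<close>

definition sample_alg :: "'i set \<Rightarrow> ('i \<Rightarrow> real set) \<Rightarrow> 'a gorder \<Rightarrow> ('i \<Rightarrow> 'a) ring" where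
  "sample_alg I W S =
    transfer_ring (C_ring (Max_space S)) (sample I W S) (sample I W S ` carrier (C_ring (Max_space S)))"

definition sample_hom :: "'i set \<Rightarrow> ('a \<Rightarrow> 'b) \<Rightarrow> ('i \<Rightarrow> 'a) \<Rightarrow> 'i \<Rightarrow> 'b" where
  "sample_hom I g f = (\<lambda>i\<in>I. g (f i))"

lemma carrier_sample_alg: "carrier (sample_alg I W S) = sample I W S ` carrier (C_ring (Max_space S))"
  by (simp add: sample_alg_def transfer_ring_def Let_def)

text \<open>Indexed, rather than a set of open sets, because elements of M are functions on pairs
  and distinct pairs can name the same interval, for instance an empty one.\<close>

locale real_base =
  fixes I :: "'i set" and W :: "'i \<Rightarrow> real set"
  assumes open_base: "i \<in> I \<Longrightarrow> open (W i)"
    and base: "open U \<Longrightarrow> x \<in> U \<Longrightarrow> \<exists>i\<in>I. x \<in> W i \<and> W i \<subseteq> U"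

context cc_alexandrov
begin

text \<open>Pointwise form of \<open>basic_open_sup\<close>: a maximal ideal is closed under
  countable joins, not just finite ones.\<close>

lemma maximal_sup:
  assumes "maximal_lattice_ideal L M" "countable B" "B \<subseteq> carrier L"
  shows "\<Squnion>B \<notin> M \<longleftrightarrow> (\<exists>b\<in>B. b \<notin> M)"
proof -
  have "M \<in> basic_open L (\<Squnion>B) \<longleftrightarrow> (\<exists>b\<in>B. M \<in> basic_open L b)"
    unfolding basic_open_sup[OF assms(2,3)] by simp
  then show ?thesis by (simp add: basic_open_iff assms(1))
qed

lemma sample_apply: "i \<in> I \<Longrightarrow> sample I W L \<phi> i = preimage_elt L \<phi> (W i)"
  by (simp add: sample_def)

lemma sample_notin:
  assumes "real_base I W" "\<phi> \<in> carrier (C_ring (Max_space L))" "i \<in> I" "maximal_lattice_ideal L M"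
  shows "sample I W L \<phi> i \<notin> M \<longleftrightarrow> \<phi> M \<in> W i"
  using preimage_elt_notin[OF C_ring_continuous[OF assms(2)] real_base.open_base[OF assms(1,3)] assms(4)]
  by (simp add: sample_apply assms(3))

lemma sample_PiE:
  assumes "real_base I W" "\<phi> \<in> carrier (C_ring (Max_space L))"
  shows "sample I W L \<phi> \<in> I \<rightarrow>\<^sub>E carrier L"
  unfolding sample_def
  by (rule restrict_PiE_iff[THEN iffD2], rule ballI)
    (rule preimage_elt(1)[OF C_ring_continuous[OF assms(2)] real_base.open_base[OF assms(1)]])

lemma sample_inj:
  assumes "real_base I W" shows "inj_on (sample I W L) (carrier (C_ring (Max_space L)))"
proof (rule inj_onI)
  fix \<phi> \<psi> assume \<phi>: "\<phi> \<in> carrier (C_ring (Max_space L))" and \<psi>: "\<psi> \<in> carrier (C_ring (Max_space L))"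
    and eq: "sample I W L \<phi> = sample I W L \<psi>"
  show "\<phi> = \<psi>"
  proof (rule C_ring_eqI[OF \<phi> \<psi>], rule ccontr)
    fix M assume "M \<in> topspace (Max_space L)" and ne: "\<phi> M \<noteq> \<psi> M"
    then have M: "maximal_lattice_ideal L M" by (simp add: topspace_Max_space)
    obtain i where i: "i \<in> I" "\<phi> M \<in> W i" "W i \<subseteq> - {\<psi> M}"
      using real_base.base[OF assms, of "- {\<psi> M}" "\<phi> M"] ne by auto
    then show False
      using sample_notin[OF assms \<phi> i(1) M] sample_notin[OF assms \<psi> i(1) M] eq by auto
  qed
qed

text \<open>An abstract family comes from a function as soon as each maximal ideal picks out a real
  number lying in exactly those \<open>W i\<close> for which \<open>f i\<close> is outside the
  ideal. Continuity is then automatic, since the preimage of \<open>W i\<close> is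
  \<open>basic_open L (f i)\<close>.\<close>

lemma sample_surj:
  assumes rb: "real_base I W" and f: "f \<in> I \<rightarrow>\<^sub>E carrier L"
    and ex: "\<And>M. maximal_lattice_ideal L M \<Longrightarrow> \<exists>x. \<forall>i\<in>I. x \<in> W i \<longleftrightarrow> f i \<notin> M"
  shows "f \<in> sample I W L ` carrier (C_ring (Max_space L))"
proof -
  obtain \<phi> where \<phi>: "\<And>M i. maximal_lattice_ideal L M \<Longrightarrow> i \<in> I \<Longrightarrow> \<phi> M \<in> W i \<longleftrightarrow> f i \<notin> M"
    using ex by metis
  have fc: "f i \<in> carrier L" if "i \<in> I" for i using f that by (rule PiE_mem)
  have cont: "continuous_map (Max_space L) euclideanreal \<phi>"
    unfolding continuous_map_def
  proof (intro conjI allI impI)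
    fix U :: "real set" assume "openin euclideanreal U"
    then have U: "open U" by simp
    show "openin (Max_space L) {M \<in> topspace (Max_space L). \<phi> M \<in> U}"
    proof (subst openin_subopen, rule ballI)
      fix M assume "M \<in> {M \<in> topspace (Max_space L). \<phi> M \<in> U}"
      then have M: "maximal_lattice_ideal L M" "\<phi> M \<in> U" by (simp_all add: topspace_Max_space)
      obtain i where i: "i \<in> I" "\<phi> M \<in> W i" "W i \<subseteq> U" using real_base.base[OF rb U M(2)] by blast
      show "\<exists>T. openin (Max_space L) T \<and> M \<in> T \<and> T \<subseteq> {M \<in> topspace (Max_space L). \<phi> M \<in> U}"
      proof (intro exI conjI)
        show "openin (Max_space L) (basic_open L (f i))" by (rule openin_Max_space_basic[OF fc[OF i(1)]])
        show "M \<in> basic_open L (f i)" using M(1) \<phi>[OF M(1) i(1)] i(2) by (simp add: basic_open_iff)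
        show "basic_open L (f i) \<subseteq> {M \<in> topspace (Max_space L). \<phi> M \<in> U}"
          using \<phi>[OF _ i(1)] i(3) by (auto simp: basic_open_iff topspace_Max_space)
      qed
    qed
  qed simp
  let ?\<phi> = "restrict \<phi> (topspace (Max_space L))"
  have c: "?\<phi> \<in> carrier (C_ring (Max_space L))" by (rule restrict_in_C_ring[OF cont])
  have "sample I W L ?\<phi> i = f i" if i: "i \<in> I" for i
    unfolding sample_apply[OF i]
  proof (rule preimage_elt_eqI[OF C_ring_continuous[OF c] real_base.open_base[OF rb i] fc[OF i]])
    fix M assume M: "maximal_lattice_ideal L M"
    show "?\<phi> M \<in> W i \<longleftrightarrow> f i \<notin> M" using \<phi>[OF M i] M by (simp add: topspace_Max_space)
  qed
  then have "f = sample I W L ?\<phi>"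
    using f sample_PiE[OF rb c] by (intro PiE_ext[of f I "\<lambda>_. carrier L"]) auto
  then show ?thesis using c by (rule image_eqI)
qed

lemma sample_alg_iso:
  assumes "real_base I W"
  shows "sample I W L \<in> ring_iso (C_ring (Max_space L)) (sample_alg I W L)"
    and "cring (sample_alg I W L)"
  unfolding sample_alg_def
  using transfer_ring[OF cring_C_ring sample_inj[OF assms]] by simp_all

lemma cstar_algebra_sample_alg:
  assumes "real_base I W" shows "cstar_algebra (sample_alg I W L)"
proof (rule cstar_algebraI[OF sample_alg_iso(2)[OF assms] compact_space_Max_space Hausdorff_space_Max_space])
  show "sample_alg I W L \<simeq> C_ring (Max_space L)"
    using ring_iso_set_sym[OF cring.axioms(1)[OF cring_C_ring] sample_alg_iso(1)[OF assms]]
    unfolding is_ring_iso_def by auto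
qed

end

subsection \<open>Open sets as indices\<close>

lemma real_base_open: "real_base {U. open U} (\<lambda>U. U)"
  by standard auto

context cc_alexandrov
begin

text \<open>For a sampled function the countable subfamily comes from the Lindelof property of the
  reals. Conversely, at a maximal ideal \<open>M\<close> the open sets with value outside
  \<open>M\<close> form a completely prime filter, and sobriety of the real line makes it the filter
  of open neighbourhoods of one number.\<close>

lemma R_carrier_eq: "R_carrier L = sample {U. open U} (\<lambda>U. U) L ` carrier (C_ring (Max_space L))"
proof (intro subset_antisym subsetI)
  fix f assume "f \<in> sample {U. open U} (\<lambda>U. U) L ` carrier (C_ring (Max_space L))"
  then obtain \<phi> where \<phi>: "\<phi> \<in> carrier (C_ring (Max_space L))" and f: "f = sample {U. open U} (\<lambda>U. U) L \<phi>"
    by blast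
  note c = C_ring_continuous[OF \<phi>]
  have ff: "f \<in> {U. open U} \<rightarrow>\<^sub>E carrier L" unfolding f by (rule sample_PiE[OF real_base_open \<phi>])
  have fc: "f U \<in> carrier L" if "open U" for U using ff that by (rule_tac PiE_mem) auto
  have fU: "f U = preimage_elt L \<phi> U" if "open U" for U using that by (simp add: f sample_def)
  have fM: "f U \<notin> M \<longleftrightarrow> \<phi> M \<in> U" if "open U" "maximal_lattice_ideal L M" for U M
    using sample_notin[OF real_base_open \<phi>, of U M] that by (simp add: f)
  have feq: "f U = d" if U: "open U" "d \<in> carrier L"
    and d: "\<And>M. maximal_lattice_ideal L M \<Longrightarrow> \<phi> M \<in> U \<longleftrightarrow> d \<notin> M" for U d
    unfolding fU[OF U(1)] by (rule preimage_elt_eqI[OF c U d])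
  have "f UNIV = \<top>" by (rule feq) (simp_all add: maximal_top)
  moreover have "f (U \<inter> V) = f U \<sqinter> f V" if UV: "open U" "open V" for U V
  proof (rule feq)
    show "\<phi> M \<in> U \<inter> V \<longleftrightarrow> f U \<sqinter> f V \<notin> M" if M: "maximal_lattice_ideal L M" for M
      using maximal_meet[OF M fc[OF UV(1)] fc[OF UV(2)]] fM[OF UV(1) M] fM[OF UV(2) M] by simp
  qed (use UV fc in auto)
  moreover have "\<exists>\<V>\<subseteq>\<U>. countable (f ` \<V>) \<and> f (\<Union>\<U>) = \<Squnion>(f ` \<V>)" if \<U>: "\<forall>U\<in>\<U>. open U" for \<U>
  proof -
    obtain \<V> where \<V>: "\<V> \<subseteq> \<U>" "countable \<V>" "\<Union>\<V> = \<Union>\<U>"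
      using Lindelof[of \<U>] \<U> by metis
    have o: "open V" if "V \<in> \<V>" for V using \<V>(1) \<U> that by auto
    have B: "countable (f ` \<V>)" "f ` \<V> \<subseteq> carrier L" using \<V>(2) o fc by auto
    have "f (\<Union>\<U>) = \<Squnion>(f ` \<V>)"
    proof (rule feq)
      fix M assume M: "maximal_lattice_ideal L M"
      have "\<phi> M \<in> \<Union>\<U> \<longleftrightarrow> (\<exists>V\<in>\<V>. \<phi> M \<in> V)" unfolding \<V>(3)[symmetric] by simp
      also have "\<dots> \<longleftrightarrow> \<Squnion>(f ` \<V>) \<notin> M"
        unfolding maximal_sup[OF M B] using fM[OF o M] by simp
      finally show "\<phi> M \<in> \<Union>\<U> \<longleftrightarrow> \<Squnion>(f ` \<V>) \<notin> M" .
    qed (use \<U> countable_sup_closed[OF B] in auto)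
    then show ?thesis using \<V>(1) B(1) by blast
  qed
  ultimately show "f \<in> R_carrier L" unfolding R_carrier_def using ff by simp
next
  fix f assume "f \<in> R_carrier L"
  then have ff: "f \<in> {U. open U} \<rightarrow>\<^sub>E carrier L" and top: "f UNIV = \<top>"
    and inter: "\<And>U V. open U \<Longrightarrow> open V \<Longrightarrow> f (U \<inter> V) = f U \<sqinter> f V"
    and union: "\<And>\<U>. \<forall>U\<in>\<U>. open U \<Longrightarrow> \<exists>\<V>\<subseteq>\<U>. countable (f ` \<V>) \<and> f (\<Union>\<U>) = \<Squnion>(f ` \<V>)"
    by (simp_all add: R_carrier_def)
  have fc: "f U \<in> carrier L" if "open U" for U using ff that by (rule_tac PiE_mem) auto
  show "f \<in> sample {U. open U} (\<lambda>U. U) L ` carrier (C_ring (Max_space L))"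
  proof (rule sample_surj[OF real_base_open ff])
    fix M assume M: "maximal_lattice_ideal L M"
    have meet: "f (U \<inter> V) \<in> M \<longleftrightarrow> f U \<in> M \<or> f V \<in> M" if "open U" "open V" for U V
      unfolding inter[OF that] by (rule maximal_meet[OF M fc[OF that(1)] fc[OF that(2)]])
    have un: "\<exists>U\<in>\<U>. f U \<notin> M" if \<U>: "\<forall>U\<in>\<U>. open U" and n: "f (\<Union>\<U>) \<notin> M" for \<U>
    proof -
      obtain \<V> where \<V>: "\<V> \<subseteq> \<U>" "countable (f ` \<V>)" "f (\<Union>\<U>) = \<Squnion>(f ` \<V>)"
        using union[OF \<U>] by blast
      have "f ` \<V> \<subseteq> carrier L" using \<V>(1) \<U> fc by auto
      from n[unfolded \<V>(3) maximal_sup[OF M \<V>(2) this]] show ?thesis using \<V>(1) by auto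
    qed
    have emp: "f {} \<in> M" using un[of "{}"] by auto
    \<comment> \<open>Otherwise the open sets with value in \<open>M\<close> cover the line, and the
      union condition contradicts that \<open>f UNIV\<close>, being the top, is outside
      \<open>M\<close>.\<close>
    obtain x where x: "\<And>U. open U \<Longrightarrow> x \<in> U \<Longrightarrow> f U \<notin> M"
    proof (rule ccontr)
      assume "\<not> thesis"
      then have "\<forall>x. \<exists>U. open U \<and> x \<in> U \<and> f U \<in> M" using that by metis
      then have "\<Union>{U. open U \<and> f U \<in> M} = UNIV" by blast
      then show False using un[of "{U. open U \<and> f U \<in> M}"] top maximal_top[OF M] by simp
    qed
    have "x \<in> U" if U: "open U" "f U \<notin> M" for U
    proof (rule ccontr)
      assume nx: "x \<notin> U"
      \<comment> \<open>\<open>U\<close> is the union of its open parts that can be separated from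
        \<open>x\<close>, so one such \<open>V\<close> has value outside \<open>M\<close>. But
        \<open>V\<close> misses a neighbourhood \<open>T\<close> of \<open>x\<close>, whose value is
        outside \<open>M\<close> as well, while the value at the empty set is in
        \<open>M\<close>.\<close>
      let ?\<V> = "{V. open V \<and> V \<subseteq> U \<and> (\<exists>T. open T \<and> x \<in> T \<and> V \<inter> T = {})}"
      have "y \<in> \<Union>?\<V>" if y: "y \<in> U" for y
      proof -
        have "y \<noteq> x" using y nx by auto
        then obtain V T where VT: "open V" "open T" "y \<in> V" "x \<in> T" "V \<inter> T = {}"
          using hausdorff by metis
        have "V \<inter> U \<in> ?\<V>" using VT U(1) by (auto intro!: exI[of _ T])
        then show ?thesis using VT(3) y by (intro UnionI[of "V \<inter> U"]) simp_all
      qed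
      then have "\<Union>?\<V> = U" by blast
      then obtain V where V: "V \<in> ?\<V>" "f V \<notin> M" using un[of ?\<V>] U(2) by auto
      then obtain T where T: "open T" "x \<in> T" "V \<inter> T = {}" "open V" by blast
      show False using meet[OF T(4,1)] T(3) emp V(2) x[OF T(1,2)] by simp
    qed
    then show "\<exists>x. \<forall>U\<in>{U. open U}. x \<in> U \<longleftrightarrow> f U \<notin> M" using x by blast
  qed
qed

lemma R_alg_eq: "R_alg L = sample_alg {U. open U} (\<lambda>U. U) L"
proof -
  have "R_of_map L = sample {U. open U} (\<lambda>U. U) L" by (rule ext) (simp add: R_of_map_def sample_def)
  then show ?thesis by (simp add: R_alg_def sample_alg_def R_carrier_eq)
qed

end

subsection \<open>Rational intervals as indices\<close>

lemma rat_in_Q_minus [simp]: "ereal (of_rat q) \<in> Q_minus"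
  and rat_in_Q_plus [simp]: "ereal (of_rat q) \<in> Q_plus"
  and minf_in_Q_minus [simp]: "-\<infinity> \<in> Q_minus"
  and pinf_in_Q_plus [simp]: "\<infinity> \<in> Q_plus"
  by (simp_all add: Q_minus_def Q_plus_def)

lemma Q_minus_max: "p \<in> Q_minus \<Longrightarrow> p' \<in> Q_minus \<Longrightarrow> max p p' \<in> Q_minus"
  by (simp add: max_def)

lemma Q_plus_min: "p \<in> Q_plus \<Longrightarrow> p' \<in> Q_plus \<Longrightarrow> min p p' \<in> Q_plus"
  by (simp add: min_def)

lemma countable_Q: "countable Q_minus" "countable Q_plus"
  by (simp_all add: Q_minus_def Q_plus_def)

lemma rat_dense_ereal:
  fixes x y :: ereal assumes "x < y" obtains q where "x < ereal (of_rat q)" "ereal (of_rat q) < y"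
proof -
  obtain z where z: "x < ereal z" "ereal z < y" using ereal_dense2[OF assms] by blast
  obtain w where w: "ereal z < ereal w" "ereal w < y" using ereal_dense2[OF z(2)] by blast
  obtain q where "z < of_rat q" "of_rat q < w" using of_rat_dense[of z w] w(1) by auto
  then show ?thesis using that[of q] z w by (meson less_ereal.simps(1) less_trans)
qed

lemma open_interval_iff: "x \<in> open_interval (p, q) \<longleftrightarrow> p < ereal x \<and> ereal x < q"
  by (simp add: open_interval_def)

lemma open_open_interval: "open (open_interval (p, q))"
proof -
  have "open_interval (p, q) = ereal -` {p<..<q}" by (auto simp: open_interval_def)
  moreover have "open (ereal -` {p<..<q})" by (intro open_vimage continuous_on_ereal continuous_on_id open_greaterThanLessThan)
  ultimately show ?thesis by simp
qed

lemma real_base_interval: "real_base (Q_minus \<times> Q_plus) open_interval"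
proof
  fix i :: "ereal \<times> ereal" assume "i \<in> Q_minus \<times> Q_plus" then show "open (open_interval i)" by (cases i) (simp add: open_open_interval)
next
  fix U :: "real set" and x assume U: "open U" "x \<in> U"
  then obtain e where e: "e > 0" "ball x e \<subseteq> U" using open_contains_ball by blast
  obtain a where a: "x - e < of_rat a" "of_rat a < x" using of_rat_dense[of "x - e" x] e by auto
  obtain b where b: "x < of_rat b" "of_rat b < x + e" using of_rat_dense[of x "x + e"] e by auto
  have "open_interval (ereal (of_rat a), ereal (of_rat b)) \<subseteq> ball x e"
    using a b by (auto simp: open_interval_iff dist_real_def)
  then show "\<exists>i\<in>Q_minus \<times> Q_plus. x \<in> open_interval i \<and> open_interval i \<subseteq> U"
    using a b e(2) by (intro bexI[of _ "(ereal (of_rat a), ereal (of_rat b))"]) (auto simp: open_interval_iff)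
qed

text \<open>The point is the supremum of the left end points of the intervals in the filter \<open>P\<close>.\<close>

lemma interval_filter_point:
  fixes P :: "ereal \<Rightarrow> ereal \<Rightarrow> bool"
  assumes top: "P (-\<infinity>) \<infinity>"
    and inter: "\<And>p p' q q'. p \<in> Q_minus \<Longrightarrow> p' \<in> Q_minus \<Longrightarrow> q \<in> Q_plus \<Longrightarrow> q' \<in> Q_plus \<Longrightarrow>
      P (max p p') (min q q') \<longleftrightarrow> P p q \<and> P p' q'"
    and emp: "\<And>p q. p \<in> Q_minus \<Longrightarrow> q \<in> Q_plus \<Longrightarrow> p > q \<Longrightarrow> \<not> P p q"
    and split: "\<And>p q r s. p \<in> Q_minus \<Longrightarrow> q \<in> Q_minus \<Longrightarrow> r \<in> Q_plus \<Longrightarrow> s \<in> Q_plus \<Longrightarrow>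
      p \<le> q \<Longrightarrow> q < r \<Longrightarrow> r \<le> s \<Longrightarrow> P p s \<Longrightarrow> P p r \<or> P q s"
    and shrink: "\<And>p q. p \<in> Q_minus \<Longrightarrow> q \<in> Q_plus \<Longrightarrow> P p q \<Longrightarrow>
      \<exists>p'\<in>Q_minus. \<exists>q'\<in>Q_plus. p < p' \<and> p' < q' \<and> q' < q \<and> P p' q'"
  obtains x where "\<And>p q. p \<in> Q_minus \<Longrightarrow> q \<in> Q_plus \<Longrightarrow> p < ereal x \<and> ereal x < q \<longleftrightarrow> P p q"
proof -
  define E where "E = {p \<in> Q_minus. \<exists>q\<in>Q_plus. P p q}"
  define s where "s = Sup E"
  \<comment> \<open>Otherwise the two intervals meet in one whose left end exceeds its right end,
    which \<open>emp\<close> excludes.\<close>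
  have le: "p \<le> q'" if "p \<in> Q_minus" "q \<in> Q_plus" "P p q" "p' \<in> Q_minus" "q' \<in> Q_plus" "P p' q'" for p q p' q'
  proof (rule ccontr)
    assume "\<not> p \<le> q'"
    then have "q' < p" by simp
    have "min q q' \<le> q'" by simp
    also note \<open>q' < p\<close>
    also have "p \<le> max p p'" by simp
    finally have "max p p' > min q q'" .
    then show False
      using emp[OF Q_minus_max[OF that(1,4)] Q_plus_min[OF that(2,5)]] inter[OF that(1,4,2,5)] that(3,6) by simp
  qed
  have bd: "p \<le> s \<and> s \<le> q" if "p \<in> Q_minus" "q \<in> Q_plus" "P p q" for p q
  proof
    show "p \<le> s" unfolding s_def by (rule Sup_upper) (use that in \<open>auto simp: E_def\<close>)
    show "s \<le> q" unfolding s_def by (rule Sup_least) (use that le in \<open>auto simp: E_def\<close>)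
  qed
  \<comment> \<open>Passing to a smaller interval of the filter makes the weak bounds strict;
    applied to the whole line this also shows that \<open>s\<close> is finite.\<close>
  have st: "p < s \<and> s < q" if pq: "p \<in> Q_minus" "q \<in> Q_plus" "P p q" for p q
  proof -
    obtain p' q' where "p' \<in> Q_minus" "q' \<in> Q_plus" "p < p'" "q' < q" "P p' q'"
      using shrink[OF pq] by blast
    then show ?thesis using bd[of p' q'] by auto
  qed
  obtain a b where ab: "a \<in> Q_minus" "b \<in> Q_plus" "P a b"
    using shrink[OF minf_in_Q_minus pinf_in_Q_plus top] by blast
  have "-\<infinity> < s" "s < \<infinity>" using st[OF minf_in_Q_minus pinf_in_Q_plus top] by simp_all
  then obtain x where x: "s = ereal x" by (cases s) auto
  have "P p q" if pq: "p \<in> Q_minus" "q \<in> Q_plus" "p < s" "s < q" for p q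
  proof -
    \<comment> \<open>Clipping to \<open>(a, b)\<close> makes \<open>split\<close> applicable twice.
      An interval of the filter contains \<open>s\<close> strictly, so cutting \<open>(a, b)\<close>
      with some \<open>r < s\<close> rejects \<open>(a, r)\<close> and leaves
      \<open>(?p, b)\<close>; cutting that with some \<open>t > s\<close> rejects
      \<open>(t, b)\<close> and leaves \<open>(?p, ?q)\<close>.\<close>
    let ?p = "max p a" and ?q = "min q b"
    have m: "?p \<in> Q_minus" "?q \<in> Q_plus" "?p < s" "s < ?q"
      using Q_minus_max Q_plus_min pq ab st[OF ab] by auto
    obtain r where r: "?p < ereal (of_rat r)" "ereal (of_rat r) < s" using rat_dense_ereal[OF m(3)] .
    obtain t where t: "s < ereal (of_rat t)" "ereal (of_rat t) < ?q" using rat_dense_ereal[OF m(4)] .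
    have "ereal (of_rat r) \<le> b" using r(2) st[OF ab] by auto
    with split[OF ab(1) m(1) rat_in_Q_plus ab(2) _ r(1) _ ab(3)]
    have "P a (ereal (of_rat r)) \<or> P ?p b" by simp
    moreover have "\<not> P a (ereal (of_rat r))" using st[OF ab(1) rat_in_Q_plus, of r] r(2) by auto
    ultimately have 1: "P ?p b" by blast
    have "?p \<le> ereal (of_rat t)" using m(3) t(1) by auto
    with split[OF m(1) rat_in_Q_minus m(2) ab(2) _ t(2) _ 1]
    have "P ?p ?q \<or> P (ereal (of_rat t)) b" by simp
    moreover have "\<not> P (ereal (of_rat t)) b" using st[OF rat_in_Q_minus ab(2), of t] t(1) by auto
    ultimately have "P ?p ?q" by blast
    then show ?thesis using inter[OF pq(1) ab(1) pq(2) ab(2)] by simp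
  qed
  then show ?thesis using that[of x] st unfolding x by blast
qed

context cc_alexandrov
begin

text \<open>At a fixed maximal ideal the axioms turn, one by one, into the hypotheses of
  \<open>interval_filter_point\<close> for the intervals with value outside the ideal. In the other
  direction each axiom becomes a fact about the position of a real number; for the last one this is
  density of the rationals, and their countability makes the join available.\<close>

lemma M_carrier_eq: "M_carrier L = sample (Q_minus \<times> Q_plus) open_interval L ` carrier (C_ring (Max_space L))"
proof (intro subset_antisym subsetI)
  fix f assume "f \<in> sample (Q_minus \<times> Q_plus) open_interval L ` carrier (C_ring (Max_space L))"
  then obtain \<phi> where \<phi>: "\<phi> \<in> carrier (C_ring (Max_space L))"
    and f: "f = sample (Q_minus \<times> Q_plus) open_interval L \<phi>" by blast
  note c = C_ring_continuous[OF \<phi>]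
  have ff: "f \<in> Q_minus \<times> Q_plus \<rightarrow>\<^sub>E carrier L" unfolding f by (rule sample_PiE[OF real_base_interval \<phi>])
  have fc: "f (p, q) \<in> carrier L" if "p \<in> Q_minus" "q \<in> Q_plus" for p q
    using ff that by (rule_tac PiE_mem) auto
  have fM: "f (p, q) \<notin> M \<longleftrightarrow> p < ereal (\<phi> M) \<and> ereal (\<phi> M) < q"
    if "p \<in> Q_minus" "q \<in> Q_plus" "maximal_lattice_ideal L M" for p q M
    using sample_notin[OF real_base_interval \<phi>, of "(p, q)" M] that by (simp add: f open_interval_iff)
  have feq: "f (p, q) = d" if U: "p \<in> Q_minus" "q \<in> Q_plus" "d \<in> carrier L"
    and d: "\<And>M. maximal_lattice_ideal L M \<Longrightarrow> p < ereal (\<phi> M) \<and> ereal (\<phi> M) < q \<longleftrightarrow> d \<notin> M" for p q d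
  proof -
    have "f (p, q) = preimage_elt L \<phi> (open_interval (p, q))" using U by (simp add: f sample_def)
    also have "\<dots> = d" by (rule preimage_elt_eqI[OF c open_open_interval U(3)]) (simp add: open_interval_iff d)
    finally show ?thesis .
  qed
  have "f (-\<infinity>, \<infinity>) = \<top>" by (rule feq) (simp_all add: maximal_top)
  moreover have "f (max p p', min q q') = f (p, q) \<sqinter> f (p', q')"
    if Q: "p \<in> Q_minus" "p' \<in> Q_minus" "q \<in> Q_plus" "q' \<in> Q_plus" for p p' q q'
  proof (rule feq)
    fix M assume M: "maximal_lattice_ideal L M"
    show "max p p' < ereal (\<phi> M) \<and> ereal (\<phi> M) < min q q' \<longleftrightarrow> f (p, q) \<sqinter> f (p', q') \<notin> M"
      using maximal_meet[OF M fc[OF Q(1,3)] fc[OF Q(2,4)]] fM[OF Q(1,3) M] fM[OF Q(2,4) M] by auto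
  qed (use Q fc Q_minus_max Q_plus_min in auto)
  moreover have "f (p, q) = \<bottom>" if Q: "p \<in> Q_minus" "q \<in> Q_plus" "p > q" for p q
  proof (rule feq)
    fix M assume M: "maximal_lattice_ideal L M"
    show "p < ereal (\<phi> M) \<and> ereal (\<phi> M) < q \<longleftrightarrow> \<bottom> \<notin> M" using Q(3) maximal_bottom[OF M] by auto
  qed (use Q in auto)
  moreover have "f (p, r) \<squnion> f (q, s) = f (p, s)"
    if Q: "p \<in> Q_minus" "q \<in> Q_minus" "r \<in> Q_plus" "s \<in> Q_plus" "p \<le> q \<and> q < r \<and> r \<le> s" for p q r s
  proof (rule feq[symmetric])
    fix M assume M: "maximal_lattice_ideal L M"
    show "p < ereal (\<phi> M) \<and> ereal (\<phi> M) < s \<longleftrightarrow> f (p, r) \<squnion> f (q, s) \<notin> M"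
      using maximal_join[OF M fc[OF Q(1,3)] fc[OF Q(2,4)]] fM[OF Q(1,3) M] fM[OF Q(2,4) M] Q(5) by auto
  qed (use Q fc in auto)
  moreover have "\<Squnion>{f (p', q') | p' q'. p' \<in> Q_minus \<and> q' \<in> Q_plus \<and> p < p' \<and> p' < q' \<and> q' < q} = f (p, q)"
    (is "\<Squnion>?B = _") if Q: "p \<in> Q_minus" "q \<in> Q_plus" for p q
  proof -
    have "?B \<subseteq> f ` (Q_minus \<times> Q_plus)" by auto
    then have B: "countable ?B" "?B \<subseteq> carrier L"
      using countable_subset[of ?B "f ` (Q_minus \<times> Q_plus)"] countable_Q fc by auto
    show ?thesis
    proof (rule feq[symmetric])
      fix M assume M: "maximal_lattice_ideal L M"
      have "p < ereal (\<phi> M) \<and> ereal (\<phi> M) < q \<longleftrightarrow> (\<exists>b\<in>?B. b \<notin> M)"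
      proof
        assume x: "p < ereal (\<phi> M) \<and> ereal (\<phi> M) < q"
        obtain a where a: "p < ereal (of_rat a)" "ereal (of_rat a) < ereal (\<phi> M)"
          using rat_dense_ereal x by blast
        obtain b where b: "ereal (\<phi> M) < ereal (of_rat b)" "ereal (of_rat b) < q"
          using rat_dense_ereal x by blast
        have "f (ereal (of_rat a), ereal (of_rat b)) \<in> ?B"
          by (rule CollectI, rule exI[of _ "ereal (of_rat a)"], rule exI[of _ "ereal (of_rat b)"])
            (use a b less_trans[OF a(2) b(1)] in simp)
        moreover have "f (ereal (of_rat a), ereal (of_rat b)) \<notin> M"
          using fM[OF rat_in_Q_minus rat_in_Q_plus M] a b by simp
        ultimately show "\<exists>b\<in>?B. b \<notin> M" by blast
      next
        assume "\<exists>b\<in>?B. b \<notin> M"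
        then obtain p' q' where "p' \<in> Q_minus" "q' \<in> Q_plus" "p < p'" "q' < q" "f (p', q') \<notin> M" by blast
        then show "p < ereal (\<phi> M) \<and> ereal (\<phi> M) < q" using fM[of p' q' M] M by auto
      qed
      then show "p < ereal (\<phi> M) \<and> ereal (\<phi> M) < q \<longleftrightarrow> \<Squnion>?B \<notin> M" unfolding maximal_sup[OF M B] .
    qed (use Q countable_sup_closed[OF B] in auto)
  qed
  ultimately show "f \<in> M_carrier L" unfolding M_carrier_def using ff by simp
next
  fix f assume "f \<in> M_carrier L"
  then have ff: "f \<in> Q_minus \<times> Q_plus \<rightarrow>\<^sub>E carrier L" and top: "f (-\<infinity>, \<infinity>) = \<top>"
    and inter: "\<And>p p' q q'. p \<in> Q_minus \<Longrightarrow> p' \<in> Q_minus \<Longrightarrow> q \<in> Q_plus \<Longrightarrow> q' \<in> Q_plus \<Longrightarrow>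
      f (max p p', min q q') = f (p, q) \<sqinter> f (p', q')"
    and emp: "\<And>p q. p \<in> Q_minus \<Longrightarrow> q \<in> Q_plus \<Longrightarrow> p > q \<Longrightarrow> f (p, q) = \<bottom>"
    and split: "\<And>p q r s. p \<in> Q_minus \<Longrightarrow> q \<in> Q_minus \<Longrightarrow> r \<in> Q_plus \<Longrightarrow> s \<in> Q_plus \<Longrightarrow>
      p \<le> q \<Longrightarrow> q < r \<Longrightarrow> r \<le> s \<Longrightarrow> f (p, r) \<squnion> f (q, s) = f (p, s)"
    and shrink: "\<And>p q. p \<in> Q_minus \<Longrightarrow> q \<in> Q_plus \<Longrightarrow>
      \<Squnion>{f (p', q') | p' q'. p' \<in> Q_minus \<and> q' \<in> Q_plus \<and> p < p' \<and> p' < q' \<and> q' < q} = f (p, q)"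
    by (simp_all add: M_carrier_def)
  have fc: "f (p, q) \<in> carrier L" if "p \<in> Q_minus" "q \<in> Q_plus" for p q
    using ff that by (rule_tac PiE_mem) auto
  show "f \<in> sample (Q_minus \<times> Q_plus) open_interval L ` carrier (C_ring (Max_space L))"
  proof (rule sample_surj[OF real_base_interval ff])
    fix M assume M: "maximal_lattice_ideal L M"
    obtain x where x: "\<And>p q. p \<in> Q_minus \<Longrightarrow> q \<in> Q_plus \<Longrightarrow> p < ereal x \<and> ereal x < q \<longleftrightarrow> f (p, q) \<notin> M"
    proof (rule interval_filter_point[of "\<lambda>p q. f (p, q) \<notin> M"])
      show "f (-\<infinity>, \<infinity>) \<notin> M" unfolding top by (rule maximal_top[OF M])
    next
      fix p p' q q' assume Q: "p \<in> Q_minus" "p' \<in> Q_minus" "q \<in> Q_plus" "q' \<in> Q_plus"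
      show "f (max p p', min q q') \<notin> M \<longleftrightarrow> f (p, q) \<notin> M \<and> f (p', q') \<notin> M"
        unfolding inter[OF Q] using maximal_meet[OF M fc[OF Q(1,3)] fc[OF Q(2,4)]] by simp
    next
      fix p q assume Q: "p \<in> Q_minus" "q \<in> Q_plus" "p > q"
      show "\<not> f (p, q) \<notin> M" unfolding emp[OF Q] using maximal_bottom[OF M] by simp
    next
      fix p q r s assume Q: "p \<in> Q_minus" "q \<in> Q_minus" "r \<in> Q_plus" "s \<in> Q_plus"
        and le: "p \<le> q" "q < r" "r \<le> s" and n: "f (p, s) \<notin> M"
      show "f (p, r) \<notin> M \<or> f (q, s) \<notin> M"
        using n unfolding split[OF Q le, symmetric] using maximal_join[OF M fc[OF Q(1,3)] fc[OF Q(2,4)]] by simp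
    next
      fix p q assume Q: "p \<in> Q_minus" "q \<in> Q_plus" and n: "f (p, q) \<notin> M"
      let ?B = "{f (p', q') | p' q'. p' \<in> Q_minus \<and> q' \<in> Q_plus \<and> p < p' \<and> p' < q' \<and> q' < q}"
      have "?B \<subseteq> f ` (Q_minus \<times> Q_plus)" by auto
      then have B: "countable ?B" "?B \<subseteq> carrier L"
        using countable_subset[of ?B "f ` (Q_minus \<times> Q_plus)"] countable_Q fc by auto
      have "\<exists>b\<in>?B. b \<notin> M" using n unfolding shrink[OF Q, symmetric] maximal_sup[OF M B] .
      then show "\<exists>p'\<in>Q_minus. \<exists>q'\<in>Q_plus. p < p' \<and> p' < q' \<and> q' < q \<and> f (p', q') \<notin> M" by blast
    qed (rule that)
    show "\<exists>x. \<forall>i\<in>Q_minus \<times> Q_plus. x \<in> open_interval i \<longleftrightarrow> f i \<notin> M"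
      using x by (intro exI[of _ x]) (auto simp: open_interval_iff)
  qed
qed

lemma M_alg_eq: "M_alg L = sample_alg (Q_minus \<times> Q_plus) open_interval L"
proof -
  have "M_of_map L = sample (Q_minus \<times> Q_plus) open_interval L" by (rule ext) (simp add: M_of_map_def sample_def)
  then show ?thesis by (simp add: M_alg_def sample_alg_def M_carrier_eq)
qed

end

section \<open>Functoriality of the rings of continuous functions\<close>

lemma C_ring_pullback_hom:
  assumes "continuous_map Y X e"
  shows "(\<lambda>\<phi>. \<lambda>y\<in>topspace Y. \<phi> (e y)) \<in> ring_hom (C_ring X) (C_ring Y)"
proof -
  have e: "e y \<in> topspace X" if "y \<in> topspace Y" for y
    using assms that by (auto simp: continuous_map_def)
  show ?thesis
  proof (rule ring_hom_memI)
    fix \<phi> assume "\<phi> \<in> carrier (C_ring X)"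
    from continuous_map_compose[OF assms C_ring_continuous[OF this]]
    show "(\<lambda>y\<in>topspace Y. \<phi> (e y)) \<in> carrier (C_ring Y)"
      by (intro restrict_in_C_ring) (simp add: o_def)
  qed (auto simp: e fun_eq_iff)
qed

lemma C_ring_pullback_iso:
  assumes "homeomorphic_maps Y X e e'"
  shows "(\<lambda>\<phi>. \<lambda>y\<in>topspace Y. \<phi> (e y)) \<in> ring_iso (C_ring X) (C_ring Y)"
proof -
  have c: "continuous_map Y X e" "continuous_map X Y e'"
    and ee: "\<And>y. y \<in> topspace Y \<Longrightarrow> e' (e y) = y" "\<And>x. x \<in> topspace X \<Longrightarrow> e (e' x) = x"
    using assms by (auto simp: homeomorphic_maps_def)
  have m: "\<And>y. y \<in> topspace Y \<Longrightarrow> e y \<in> topspace X" "\<And>x. x \<in> topspace X \<Longrightarrow> e' x \<in> topspace Y"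
    using c by (auto simp: continuous_map_def)
  note h = C_ring_pullback_hom[OF c(1)] and h' = C_ring_pullback_hom[OF c(2)]
  have "bij_betw (\<lambda>\<phi>. \<lambda>y\<in>topspace Y. \<phi> (e y)) (carrier (C_ring X)) (carrier (C_ring Y))"
  proof (rule bij_betwI[where g = "\<lambda>\<psi>. \<lambda>x\<in>topspace X. \<psi> (e' x)"])
    show "(\<lambda>\<phi>. \<lambda>y\<in>topspace Y. \<phi> (e y)) \<in> carrier (C_ring X) \<rightarrow> carrier (C_ring Y)"
      using ring_hom_closed[OF h] by blast
    show "(\<lambda>\<psi>. \<lambda>x\<in>topspace X. \<psi> (e' x)) \<in> carrier (C_ring Y) \<rightarrow> carrier (C_ring X)"
      using ring_hom_closed[OF h'] by blast
    show "(\<lambda>x\<in>topspace X. (\<lambda>y\<in>topspace Y. \<phi> (e y)) (e' x)) = \<phi>" if "\<phi> \<in> carrier (C_ring X)" for \<phi>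
      by (rule C_ring_eqI[OF ring_hom_closed[OF h' ring_hom_closed[OF h that]] that]) (simp add: ee m)
    show "(\<lambda>y\<in>topspace Y. (\<lambda>x\<in>topspace X. \<psi> (e' x)) (e y)) = \<psi>" if "\<psi> \<in> carrier (C_ring Y)" for \<psi>
      by (rule C_ring_eqI[OF ring_hom_closed[OF h ring_hom_closed[OF h' that]] that]) (simp add: ee m)
  qed
  then show ?thesis using h by (simp add: ring_iso_def)
qed

text \<open>On \<open>A\<close> the map \<open>F\<close> is \<open>k\<close> after the inverse of
  \<open>h\<close>. This lets maps given by a formula of their own, such as
  \<open>sample_hom I g\<close>, inherit the homomorphism laws.\<close>

lemma ring_hom_along_iso:
  assumes h: "h \<in> ring_iso R A" and k: "k \<in> ring_hom R B"
    and F: "\<And>r. r \<in> carrier R \<Longrightarrow> F (h r) = k r" and R: "ring R"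
  shows "F \<in> ring_hom A B"
proof -
  note hh = ring_iso_memE[OF h]
  have surj: "\<exists>r\<in>carrier R. a = h r" if "a \<in> carrier A" for a
    using that hh(5) by (auto simp: bij_betw_def)
  show ?thesis
  proof (rule ring_hom_memI)
    fix a assume "a \<in> carrier A"
    then show "F a \<in> carrier B" using surj F ring_hom_closed[OF k] by force
  next
    fix a b assume "a \<in> carrier A" "b \<in> carrier A"
    then obtain r s where rs: "r \<in> carrier R" "s \<in> carrier R" "a = h r" "b = h s" using surj by meson
    show "F (a \<otimes>\<^bsub>A\<^esub> b) = F a \<otimes>\<^bsub>B\<^esub> F b"
      unfolding rs(3,4) hh(2)[OF rs(1,2), symmetric]
      using F rs(1,2) ring_hom_mult[OF k rs(1,2)] ring.ring_simprules(5)[OF R rs(1,2)] by simp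
    show "F (a \<oplus>\<^bsub>A\<^esub> b) = F a \<oplus>\<^bsub>B\<^esub> F b"
      unfolding rs(3,4) hh(3)[OF rs(1,2), symmetric]
      using F rs(1,2) ring_hom_add[OF k rs(1,2)] ring.ring_simprules(1)[OF R rs(1,2)] by simp
  next
    show "F \<one>\<^bsub>A\<^esub> = \<one>\<^bsub>B\<^esub>"
      unfolding hh(4)[symmetric]
      using F[OF ring.ring_simprules(6)[OF R]] ring_hom_one[OF k] by simp
  qed
qed

section \<open>Maps of maximal ideal spaces induced by lattice morphisms\<close>

locale alexandrov_hom = S: cc_alexandrov S + T: cc_alexandrov T
  for S :: "'a gorder" and T :: "'b gorder" +
  fixes g assumes hom: "g \<in> alex_hom S T"
begin

lemma hom_closed: "x \<in> carrier S \<Longrightarrow> g x \<in> carrier T"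
  and hom_top: "g \<top>\<^bsub>S\<^esub> = \<top>\<^bsub>T\<^esub>"
  and hom_bottom: "g \<bottom>\<^bsub>S\<^esub> = \<bottom>\<^bsub>T\<^esub>"
  and hom_meet: "x \<in> carrier S \<Longrightarrow> y \<in> carrier S \<Longrightarrow> g (x \<sqinter>\<^bsub>S\<^esub> y) = g x \<sqinter>\<^bsub>T\<^esub> g y"
  and hom_join: "x \<in> carrier S \<Longrightarrow> y \<in> carrier S \<Longrightarrow> g (x \<squnion>\<^bsub>S\<^esub> y) = g x \<squnion>\<^bsub>T\<^esub> g y"
  and hom_sup: "countable B \<Longrightarrow> B \<subseteq> carrier S \<Longrightarrow> g (\<Squnion>\<^bsub>S\<^esub>B) = \<Squnion>\<^bsub>T\<^esub>(g ` B)"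
  using hom by (auto simp: alex_hom_def)

definition pull :: "'b set \<Rightarrow> 'a set" where "pull N = {x \<in> carrier S. g x \<in> N}"

text \<open>Let \<open>b\<close> and \<open>c\<close> be approximating sequences for \<open>a\<close>. If \<open>g a \<notin> N\<close>, then \<open>g (c n) \<notin> N\<close> for
  some \<open>n\<close>, hence \<open>g (b n) \<in> N\<close> since \<open>N\<close> is prime; and \<open>b n \<squnion> a = \<top>\<close>.\<close>

lemma maximal_pull:
  assumes N: "maximal_lattice_ideal T N" shows "maximal_lattice_ideal S (pull N)"
  unfolding maximal_lattice_ideal_def
proof (intro conjI allI impI)
  show "lattice_ideal S (pull N)"
    unfolding lattice_ideal_def
  proof (intro conjI ballI impI)
    have "\<bottom>\<^bsub>S\<^esub> \<in> pull N" using hom_bottom T.maximal_bottom[OF N] by (simp add: pull_def)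
    then show "pull N \<noteq> {}" by blast
    fix x y assume x: "x \<in> pull N"
    then have xc: "x \<in> carrier S" "g x \<in> N" by (simp_all add: pull_def)
    show "y \<in> pull N" if y: "y \<in> carrier S" "y \<sqsubseteq>\<^bsub>S\<^esub> x"
    proof -
      have "y = y \<sqinter>\<^bsub>S\<^esub> x" using S.le_iff_join[OF y(1) xc(1)] y(2) by simp
      then have "g y = g y \<sqinter>\<^bsub>T\<^esub> g x" using hom_meet[OF y(1) xc(1)] by simp
      moreover have "g y \<sqinter>\<^bsub>T\<^esub> g x \<in> N"
        using T.maximal_meet[OF N hom_closed[OF y(1)] hom_closed[OF xc(1)]] xc(2) by simp
      ultimately show ?thesis using y(1) by (simp add: pull_def)
    qed
    assume y: "y \<in> pull N"
    then have yc: "y \<in> carrier S" "g y \<in> N" by (simp_all add: pull_def)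
    show "x \<squnion>\<^bsub>S\<^esub> y \<in> pull N"
      using T.maximal_join[OF N hom_closed[OF xc(1)] hom_closed[OF yc(1)]] xc yc hom_join[OF xc(1) yc(1)]
      by (simp add: pull_def)
  qed (simp add: pull_def)
  have "\<top>\<^bsub>S\<^esub> \<notin> pull N" using hom_top T.maximal_top[OF N] by (simp add: pull_def)
  then show "pull N \<noteq> carrier S" using S.top_closed by metis
  fix J assume "lattice_ideal S J \<and> pull N \<subseteq> J"
  then have J: "lattice_ideal S J" "pull N \<subseteq> J" by simp_all
  show "J = pull N \<or> J = carrier S"
  proof (cases "J \<subseteq> pull N")
    case False
    then obtain a where a: "a \<in> J" "a \<notin> pull N" by blast
    have ac: "a \<in> carrier S" by (rule S.lattice_ideal_closed[OF J(1) a(1)])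
    have ga: "g a \<notin> N" using a(2) ac by (simp add: pull_def)
    obtain b c :: "nat \<Rightarrow> 'a" where bc: "range b \<subseteq> carrier S" "range c \<subseteq> carrier S" "\<Squnion>\<^bsub>S\<^esub>(range c) = a"
      and n: "\<And>n. b n \<sqinter>\<^bsub>S\<^esub> c n = \<bottom>\<^bsub>S\<^esub>" "\<And>n. b n \<squnion>\<^bsub>S\<^esub> a = \<top>\<^bsub>S\<^esub>"
      using S.approximating_sequences[OF ac] by blast
    have cc: "c n \<in> carrier S" and bcc: "b n \<in> carrier S" for n using bc by auto
    have "g a = \<Squnion>\<^bsub>T\<^esub>(g ` range c)" using hom_sup[OF _ bc(2)] bc(3) by simp
    then have "\<Squnion>\<^bsub>T\<^esub>(g ` range c) \<notin> N" using ga by simp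
    moreover have "g ` range c \<subseteq> carrier T" using hom_closed[OF cc] by auto
    ultimately obtain n where gn: "g (c n) \<notin> N" using T.maximal_sup[OF N, of "g ` range c"] by auto
    have "g (b n) \<sqinter>\<^bsub>T\<^esub> g (c n) = \<bottom>\<^bsub>T\<^esub>"
      using hom_meet[OF bcc cc, of n n] hom_bottom n(1)[of n] by simp
    then have "g (b n) \<in> N"
      using T.maximal_meet[OF N hom_closed[OF bcc] hom_closed[OF cc], of n n] T.maximal_bottom[OF N] gn by simp
    then have "b n \<in> J" using J(2) bcc[of n] by (auto simp: pull_def)
    then have "\<top>\<^bsub>S\<^esub> \<in> J" using S.lattice_ideal_join[OF J(1) _ a(1)] n(2)[of n] by metis
    then show ?thesis using S.lattice_ideal_top[OF J(1)] by simp
  qed (use J(2) in simp)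
qed

lemma continuous_map_pull: "continuous_map (Max_space T) (Max_space S) pull"
  unfolding continuous_map_def
proof (intro conjI allI impI)
  show "pull \<in> topspace (Max_space T) \<rightarrow> topspace (Max_space S)"
    using maximal_pull by (simp add: T.topspace_Max_space S.topspace_Max_space)
  fix U assume U: "openin (Max_space S) U"
  show "openin (Max_space T) {N \<in> topspace (Max_space T). pull N \<in> U}"
  proof (subst openin_subopen, rule ballI)
    fix N assume "N \<in> {N \<in> topspace (Max_space T). pull N \<in> U}"
    then have N: "maximal_lattice_ideal T N" "pull N \<in> U" by (simp_all add: T.topspace_Max_space)
    obtain d where d: "d \<in> carrier S" "pull N \<in> basic_open S d" "basic_open S d \<subseteq> U"
      using S.openin_Max_spaceD[OF U N(2)] .
    show "\<exists>V. openin (Max_space T) V \<and> N \<in> V \<and> V \<subseteq> {N \<in> topspace (Max_space T). pull N \<in> U}"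
    proof (intro exI conjI)
      show "openin (Max_space T) (basic_open T (g d))" by (rule T.openin_Max_space_basic[OF hom_closed[OF d(1)]])
      show "N \<in> basic_open T (g d)" using N(1) d by (simp add: basic_open_def pull_def)
      show "basic_open T (g d) \<subseteq> {N \<in> topspace (Max_space T). pull N \<in> U}"
      proof
        fix N assume "N \<in> basic_open T (g d)"
        then have N: "maximal_lattice_ideal T N" "g d \<notin> N" by (simp_all add: basic_open_def)
        then have "pull N \<in> basic_open S d" using maximal_pull[OF N(1)] by (simp add: basic_open_def pull_def)
        then show "N \<in> {N \<in> topspace (Max_space T). pull N \<in> U}" using N(1) d(3) by (auto simp: T.topspace_Max_space)
      qed
    qed
  qed
qed

definition pullback :: "('a set \<Rightarrow> real) \<Rightarrow> 'b set \<Rightarrow> real" where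
  "pullback \<phi> = (\<lambda>N\<in>topspace (Max_space T). \<phi> (pull N))"

lemma pullback_hom: "pullback \<in> ring_hom (C_ring (Max_space S)) (C_ring (Max_space T))"
  using C_ring_pullback_hom[OF continuous_map_pull] by (simp add: pullback_def[abs_def])

text \<open>Tested at a maximal ideal \<open>N\<close>: applying \<open>g\<close> gives an element
  outside \<open>N\<close> exactly if the original one is outside \<open>pull N\<close>. So
  composing with \<open>g\<close> on samples is composing with \<open>pull\<close> on functions,
  which visibly respects the ring operations.\<close>

lemma preimage_elt_pullback:
  assumes \<phi>: "\<phi> \<in> carrier (C_ring (Max_space S))" and U: "open U"
  shows "preimage_elt T (pullback \<phi>) U = g (preimage_elt S \<phi> U)"
proof (rule T.preimage_elt_eqI[OF C_ring_continuous[OF ring_hom_closed[OF pullback_hom \<phi>]] U])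
  note c = C_ring_continuous[OF \<phi>]
  have cl: "preimage_elt S \<phi> U \<in> carrier S" by (rule S.preimage_elt(1)[OF c U])
  then show "g (preimage_elt S \<phi> U) \<in> carrier T" by (rule hom_closed)
  fix N assume N: "maximal_lattice_ideal T N"
  have "pullback \<phi> N \<in> U \<longleftrightarrow> \<phi> (pull N) \<in> U" using N by (simp add: pullback_def T.topspace_Max_space)
  also have "\<dots> \<longleftrightarrow> preimage_elt S \<phi> U \<notin> pull N"
    using S.preimage_elt_notin[OF c U maximal_pull[OF N]] by simp
  also have "\<dots> \<longleftrightarrow> g (preimage_elt S \<phi> U) \<notin> N" using cl by (simp add: pull_def)
  finally show "pullback \<phi> N \<in> U \<longleftrightarrow> g (preimage_elt S \<phi> U) \<notin> N" .
qed

lemma sample_hom_sample: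
  assumes "real_base I W" "\<phi> \<in> carrier (C_ring (Max_space S))"
  shows "sample_hom I g (sample I W S \<phi>) = sample I W T (pullback \<phi>)"
  using preimage_elt_pullback[OF assms(2)] real_base.open_base[OF assms(1)]
  by (auto simp: sample_hom_def sample_def fun_eq_iff)

lemma sample_hom_ring_hom:
  assumes rb: "real_base I W"
  shows "sample_hom I g \<in> ring_hom (sample_alg I W S) (sample_alg I W T)"
proof (rule ring_hom_along_iso[OF S.sample_alg_iso(1)[OF rb]])
  have "sample I W T \<in> ring_hom (C_ring (Max_space T)) (sample_alg I W T)"
    using T.sample_alg_iso(1)[OF rb] by (simp add: ring_iso_def)
  then show "sample I W T \<circ> pullback \<in> ring_hom (C_ring (Max_space S)) (sample_alg I W T)"
    by (rule ring_hom_trans[OF pullback_hom])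
  show "ring (C_ring (Max_space S))" by (rule cring.axioms(1)[OF cring_C_ring])
qed (simp add: sample_hom_sample[OF rb])

end

section \<open>Gelfand representation\<close>

text \<open>Nonnegative reals are squares, so the map is monotone; it fixes the rationals, which are
  dense. Thus real-valued homomorphisms of bare rings can be compared without assuming
  linearity.\<close>

lemma real_additive_multiplicative_id:
  fixes f :: "real \<Rightarrow> real"
  assumes add: "\<And>x y. f (x + y) = f x + f y" and mult: "\<And>x y. f (x * y) = f x * f y" and one: "f 1 = 1"
  shows "f x = x"
proof -
  have zero: "f 0 = 0" using add[of 0 0] by simp
  have neg: "f (- y) = - f y" for y using add[of y "- y"] zero by simp
  have nat: "f (of_nat n) = of_nat n" for n by (induction n) (simp_all add: zero add one)
  have int: "f (of_int i) = of_int i" for i by (cases i) (simp_all add: nat neg del: of_nat_Suc)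
  have rat: "f (of_rat q) = of_rat q" for q
  proof -
    obtain a b where q: "q = Fract a b" "b > 0" by (cases q) auto
    have "f (of_rat q) * of_int b = f (of_rat q * of_int b)" by (simp add: mult int)
    also have "(of_rat q :: real) * of_int b = of_int a" using q by (simp add: of_rat_rat)
    finally have "f (of_rat q) * of_int b = of_rat q * of_int b" using q by (simp add: int of_rat_rat)
    then show ?thesis using q(2) by simp
  qed
  have mono: "f y \<le> f z" if "y \<le> z" for y z
  proof -
    have "f z = f y + f (sqrt (z - y) * sqrt (z - y))"
      using that add[of y "z - y"] by (simp del: real_sqrt_mult_self add: real_sqrt_mult_self)
    then show ?thesis by (simp only: mult) simp
  qed
  show ?thesis
  proof (rule ccontr)
    assume "f x \<noteq> x"
    then consider "f x < x" | "x < f x" by linarith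
    then show False
    proof cases
      case 1
      then obtain q where "f x < of_rat q" "of_rat q < x" using of_rat_dense by blast
      then show False using mono[of "of_rat q" x] by (simp add: rat)
    next
      case 2
      then obtain q where "x < of_rat q" "of_rat q < f x" using of_rat_dense by blast
      then show False using mono[of x "of_rat q"] by (simp add: rat)
    qed
  qed
qed

lemma real_ring_simps [simp]:
  "carrier real_ring = UNIV" "mult real_ring = (*)" "add real_ring = (+)"
  "one real_ring = 1" "zero real_ring = 0"
  by (simp_all add: real_ring_def)

lemma cring_real_ring: "cring real_ring"
proof (rule cringI)
  show "abelian_group real_ring"
    by (rule abelian_groupI) (auto intro: exI[of _ "- x" for x])
  show "Group.comm_monoid real_ring"
    by (rule comm_monoidI) (auto simp: algebra_simps)
qed (auto simp: algebra_simps)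

text \<open>The point type is arbitrary, so that the same results serve both the spectrum of a ring
  and the functions on \<open>Max_space\<close> of a lattice.\<close>

locale cstar_presentation = A: cring A for A :: "'a ring" +
  fixes X :: "'x topology" and h :: "'a \<Rightarrow> 'x \<Rightarrow> real"
  assumes compact: "compact_space X" and Hausdorff: "Hausdorff_space X"
    and iso: "h \<in> ring_iso A (C_ring X)"
begin

lemma h_closed: "a \<in> carrier A \<Longrightarrow> h a \<in> carrier (C_ring X)"
  using ring_iso_memE(1)[OF iso] .

lemma h_mult: "a \<in> carrier A \<Longrightarrow> b \<in> carrier A \<Longrightarrow> x \<in> topspace X \<Longrightarrow> h (a \<otimes>\<^bsub>A\<^esub> b) x = h a x * h b x"
  using ring_iso_memE(2)[OF iso] by simp

lemma h_add: "a \<in> carrier A \<Longrightarrow> b \<in> carrier A \<Longrightarrow> x \<in> topspace X \<Longrightarrow> h (a \<oplus>\<^bsub>A\<^esub> b) x = h a x + h b x"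
  using ring_iso_memE(3)[OF iso] by simp

lemma h_one: "x \<in> topspace X \<Longrightarrow> h \<one>\<^bsub>A\<^esub> x = 1"
  using ring_iso_memE(4)[OF iso] by simp

lemma h_eqI:
  assumes "a \<in> carrier A" "b \<in> carrier A" "\<And>x. x \<in> topspace X \<Longrightarrow> h a x = h b x"
  shows "a = b"
proof (rule inj_onD[of h "carrier A"])
  show "inj_on h (carrier A)" using ring_iso_memE(5)[OF iso] by (rule bij_betw_imp_inj_on)
  show "h a = h b" by (rule C_ring_eqI[OF h_closed[OF assms(1)] h_closed[OF assms(2)] assms(3)])
qed (use assms in auto)

lemma h_zero: "x \<in> topspace X \<Longrightarrow> h \<zero>\<^bsub>A\<^esub> x = 0"
  using h_add[of "\<zero>\<^bsub>A\<^esub>" "\<zero>\<^bsub>A\<^esub>" x] by simp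

lemma lift:
  assumes "continuous_map X euclideanreal \<phi>"
  shows "\<exists>a\<in>carrier A. \<forall>x\<in>topspace X. h a x = \<phi> x"
proof -
  have "restrict \<phi> (topspace X) \<in> h ` carrier A"
    using restrict_in_C_ring[OF assms] ring_iso_memE(5)[OF iso] by (simp add: bij_betw_def)
  then obtain a where a: "a \<in> carrier A" "restrict \<phi> (topspace X) = h a" by blast
  have "\<forall>x\<in>topspace X. h a x = \<phi> x" by (simp flip: a(2))
  then show ?thesis using a(1) ..
qed

definition const :: "real \<Rightarrow> 'a" where
  "const r = (SOME a. a \<in> carrier A \<and> (\<forall>x\<in>topspace X. h a x = r))"

lemma const: "const r \<in> carrier A" "x \<in> topspace X \<Longrightarrow> h (const r) x = r"
proof -
  have "\<exists>a. a \<in> carrier A \<and> (\<forall>x\<in>topspace X. h a x = r)"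
    using lift[of "\<lambda>_. r"] by auto
  from someI_ex[OF this]
  show "const r \<in> carrier A" "x \<in> topspace X \<Longrightarrow> h (const r) x = r"
    unfolding const_def by blast+
qed

lemma const_add: "const (r + s) = const r \<oplus>\<^bsub>A\<^esub> const s"
  by (rule h_eqI) (simp_all add: const h_add)

lemma const_mult: "const (r * s) = const r \<otimes>\<^bsub>A\<^esub> const s"
  by (rule h_eqI) (simp_all add: const h_mult)

lemma const_one: "const 1 = \<one>\<^bsub>A\<^esub>"
  by (rule h_eqI) (simp_all add: const h_one)

lemma real_hom_const:
  assumes k: "k \<in> ring_hom A real_ring" shows "k (const r) = r"
proof (rule real_additive_multiplicative_id[where f = "\<lambda>r. k (const r)"])
  show "k (const (x + y)) = k (const x) + k (const y)" for x y
    unfolding const_add using ring_hom_add[OF k const(1) const(1)] by simp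
  show "k (const (x * y)) = k (const x) * k (const y)" for x y
    unfolding const_mult using ring_hom_mult[OF k const(1) const(1)] by simp
  show "k (const 1) = 1"
    unfolding const_one using ring_hom_one[OF k] by simp
qed

text \<open>Stated for any homomorphism to the reals, not only for evaluations: functoriality of D
  applies it to evaluations composed with ring homomorphisms.\<close>

lemma maximalideal_real_kernel:
  assumes k: "k \<in> ring_hom A real_ring"
  shows "maximalideal {a \<in> carrier A. k a = 0} A" (is "maximalideal ?K A")
proof (rule maximalidealI)
  have "ring_hom_ring A real_ring k"
    by (rule ring_hom_ringI2[OF A.ring_axioms cring.axioms(1)[OF cring_real_ring] k])
  from ring_hom_ring.kernel_is_ideal[OF this] show "ideal ?K A" by (simp only: a_kernel_def' real_ring_simps)
  have "\<one>\<^bsub>A\<^esub> \<notin> ?K" using ring_hom_one[OF k] by simp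
  then show "carrier A \<noteq> ?K" using A.one_closed by metis
  fix J assume J: "ideal J A" "?K \<subseteq> J" "J \<subseteq> carrier A"
  interpret J: ideal J A by (rule J(1))
  show "J = ?K \<or> J = carrier A"
  proof (cases "J \<subseteq> ?K")
    case False
    then obtain a where a: "a \<in> J" "k a \<noteq> 0" using J(3) by blast
    have ac: "a \<in> carrier A" using a J(3) by blast
    define b where "b = a \<oplus>\<^bsub>A\<^esub> const (- k a)"
    have bc: "b \<in> carrier A" using ac const by (simp add: b_def)
    have "k b = 0" using ring_hom_add[OF k ac const(1)] by (simp add: b_def real_hom_const[OF k])
    then have b: "b \<in> J" using bc J(2) by blast
    \<comment> \<open>Since \<open>b\<close> is \<open>a\<close> minus the constant
      \<open>k a\<close>, the unit is \<open>(a - b) / k a\<close>, a combination of two members of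
      \<open>J\<close>.\<close>
    define c where "c = (const (1 / k a) \<otimes>\<^bsub>A\<^esub> a) \<oplus>\<^bsub>A\<^esub> (const (- (1 / k a)) \<otimes>\<^bsub>A\<^esub> b)"
    have "c \<in> J" unfolding c_def by (intro J.a_closed J.I_l_closed a b const(1))
    moreover have "c = \<one>\<^bsub>A\<^esub>"
    proof (rule h_eqI)
      fix x assume x: "x \<in> topspace X"
      show "h c x = h \<one>\<^bsub>A\<^esub> x"
        unfolding c_def using x ac bc a(2)
        by (simp add: h_add h_mult const h_one b_def field_simps)
    qed (use \<open>c \<in> J\<close> J(3) in auto)
    ultimately show ?thesis using J.one_imp_carrier by simp
  qed (rule disjI1[OF subset_antisym[OF _ J(2)]])
qed

text \<open>A homomorphism \<open>l\<close> with the same kernel kills \<open>a\<close> minus the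
  constant \<open>k a\<close> and fixes constants, so \<open>l a = k a\<close>. This is the
  uniqueness behind the definite description in \<open>gelfand\<close>.\<close>

lemma gelfand_real_kernel:
  assumes k: "k \<in> ring_hom A real_ring" and a: "a \<in> carrier A"
  shows "gelfand A a {a \<in> carrier A. k a = 0} = k a"
  unfolding gelfand_def
proof (rule the_equality)
  show "\<exists>l\<in>ring_hom A real_ring. {x \<in> carrier A. l x = 0} = {a \<in> carrier A. k a = 0} \<and> l a = k a"
    using k by blast
  fix r assume "\<exists>l\<in>ring_hom A real_ring. {x \<in> carrier A. l x = 0} = {a \<in> carrier A. k a = 0} \<and> l a = r"
  then obtain l where l: "l \<in> ring_hom A real_ring" "{x \<in> carrier A. l x = 0} = {a \<in> carrier A. k a = 0}" "l a = r"
    by blast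
  let ?b = "a \<oplus>\<^bsub>A\<^esub> const (- k a)"
  have "?b \<in> {a \<in> carrier A. k a = 0}"
    using a const ring_hom_add[OF k a const(1)] by (simp add: real_hom_const[OF k])
  then have "l ?b = 0" unfolding l(2)[symmetric] by simp
  then show "r = k a" using ring_hom_add[OF l(1) a const(1)] l(3) by (simp add: real_hom_const[OF l(1)])
qed

definition pt :: "'x \<Rightarrow> 'a set" where "pt x = {a \<in> carrier A. h a x = 0}"

lemma eval_hom: "x \<in> topspace X \<Longrightarrow> (\<lambda>a. h a x) \<in> ring_hom A real_ring"
  by (rule ring_hom_memI) (simp_all add: h_mult h_add h_one)

lemma pt_max: "x \<in> topspace X \<Longrightarrow> pt x \<in> max_ideals A"
  unfolding pt_def max_ideals_def using maximalideal_real_kernel[OF eval_hom] by simp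

lemma gelfand_pt: "x \<in> topspace X \<Longrightarrow> a \<in> carrier A \<Longrightarrow> gelfand A a (pt x) = h a x"
  unfolding pt_def using gelfand_real_kernel[OF eval_hom] by simp

lemma pt_inj: "inj_on pt (topspace X)"
proof (rule inj_onI, rule ccontr)
  fix x y assume x: "x \<in> topspace X" and y: "y \<in> topspace X" and eq: "pt x = pt y" and ne: "x \<noteq> y"
  have "normal_space X"
    by (rule compact_Hausdorff_or_regular_imp_normal_space) (simp_all add: compact Hausdorff)
  moreover have "closedin X {x}" "closedin X {y}" "disjnt {x} {y}"
    using closedin_Hausdorff_singleton[OF Hausdorff] x y ne by (simp_all add: disjnt_def)
  ultimately obtain f :: "'x \<Rightarrow> real" where f: "continuous_map X euclideanreal f" "f ` {x} \<subseteq> {0}" "f ` {y} \<subseteq> {1}"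
    by (rule Urysohn_lemma_alt)
  obtain a where a: "a \<in> carrier A" "\<forall>x\<in>topspace X. h a x = f x" using lift[OF f(1)] ..
  have "a \<in> pt x" "a \<notin> pt y" using a f x y by (simp_all add: pt_def)
  then show False using eq by simp
qed

text \<open>By compactness finitely many members of \<open>I\<close> have no common zero; the sum of
  their squares is in \<open>I\<close>, is positive everywhere and so has a continuous
  inverse.\<close>

lemma ideal_no_zero:
  assumes I: "ideal I A" and nz: "\<And>x. x \<in> topspace X \<Longrightarrow> \<exists>a\<in>I. h a x \<noteq> 0"
  shows "\<one>\<^bsub>A\<^esub> \<in> I"
proof -
  interpret I: ideal I A by (rule I)
  have Ic: "a \<in> carrier A" if "a \<in> I" for a using that I.a_subset by blast
  have fin: "\<exists>b\<in>I. \<forall>x\<in>topspace X. h b x \<ge> 0 \<and> (\<forall>a\<in>F. h a x \<noteq> 0 \<longrightarrow> h b x > 0)"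
    if "finite F" "F \<subseteq> I" for F
    using that
  proof (induction F rule: finite_induct)
    case empty
    show ?case by (rule bexI[OF _ I.zero_closed]) (simp add: h_zero)
  next
    case (insert a F)
    then obtain b where b: "b \<in> I" "\<And>x. x \<in> topspace X \<Longrightarrow> h b x \<ge> 0"
      "\<And>x c. x \<in> topspace X \<Longrightarrow> c \<in> F \<Longrightarrow> h c x \<noteq> 0 \<Longrightarrow> h b x > 0" by blast
    have a: "a \<in> I" using insert.prems by simp
    let ?c = "b \<oplus>\<^bsub>A\<^esub> (a \<otimes>\<^bsub>A\<^esub> a)"
    have "?c \<in> I" by (intro I.a_closed I.I_l_closed a b(1) Ic)
    moreover have hc: "h ?c x = h b x + h a x * h a x" if "x \<in> topspace X" for x
      using that Ic[OF a] Ic[OF b(1)] by (simp add: h_add h_mult)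
    have "h ?c x \<ge> 0 \<and> (\<forall>c\<in>insert a F. h c x \<noteq> 0 \<longrightarrow> h ?c x > 0)" if x: "x \<in> topspace X" for x
    proof (intro conjI ballI impI)
      show "h ?c x \<ge> 0" unfolding hc[OF x] using b(2)[OF x] by simp
      fix c assume c: "c \<in> insert a F" "h c x \<noteq> 0"
      show "h ?c x > 0"
      proof (cases "c = a")
        case True
        then have "h a x * h a x > 0" using c(2) by (metis not_square_less_zero mult_eq_0_iff linorder_neqE)
        then show ?thesis unfolding hc[OF x] using b(2)[OF x] by linarith
      next
        case False
        then have "h b x > 0" using b(3)[OF x] c by auto
        moreover have "h a x * h a x \<ge> 0" by simp
        ultimately show ?thesis unfolding hc[OF x] by linarith
      qed
    qed
    ultimately show ?case by blast
  qed
  let ?U = "\<lambda>a. {x \<in> topspace X. h a x \<in> - {0}}"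
  have "openin X (?U a)" if "a \<in> I" for a
    by (rule openin_continuous_map_preimage[OF C_ring_continuous[OF h_closed[OF Ic[OF that]]]]) auto
  then have "\<exists>\<F>. finite \<F> \<and> \<F> \<subseteq> ?U ` I \<and> topspace X \<subseteq> \<Union>\<F>"
    using nz by (intro compactinD[OF compact[unfolded compact_space_def]]) auto
  then obtain \<F> where \<F>: "finite \<F>" "\<F> \<subseteq> ?U ` I" "topspace X \<subseteq> \<Union>\<F>" by (elim exE conjE)
  then obtain F where F: "F \<subseteq> I" "finite F" "\<F> = ?U ` F"
    using finite_subset_image[OF \<F>(1,2)] by (elim exE conjE)
  obtain b where b: "b \<in> I" "\<And>x. x \<in> topspace X \<Longrightarrow> h b x \<ge> 0 \<and> (\<forall>a\<in>F. h a x \<noteq> 0 \<longrightarrow> h b x > 0)"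
    using fin[OF F(2,1)] by blast
  have pos: "h b x > 0" if x: "x \<in> topspace X" for x
  proof -
    have "x \<in> (\<Union>a\<in>F. ?U a)" using \<F>(3) x unfolding F(3) by blast
    then obtain a where "a \<in> F" "h a x \<noteq> 0" by auto
    then show ?thesis using b(2)[OF x] by blast
  qed
  have "continuous_map X euclideanreal (\<lambda>x. inverse (h b x))"
    by (rule continuous_map_real_inverse[OF C_ring_continuous[OF h_closed[OF Ic[OF b(1)]]]]) (use pos in fastforce)
  from lift[OF this] obtain c where c: "c \<in> carrier A" "\<forall>x\<in>topspace X. h c x = inverse (h b x)" ..
  have "c \<otimes>\<^bsub>A\<^esub> b = \<one>\<^bsub>A\<^esub>"
  proof (rule h_eqI)
    fix x assume x: "x \<in> topspace X"
    show "h (c \<otimes>\<^bsub>A\<^esub> b) x = h \<one>\<^bsub>A\<^esub> x" using pos[OF x] x c Ic[OF b(1)] by (simp add: h_mult h_one)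
  qed (use c Ic[OF b(1)] in auto)
  then show ?thesis using I.I_l_closed[OF b(1) c(1)] by simp
qed

text \<open>By \<open>ideal_no_zero\<close> a proper ideal has a common zero \<open>x\<close> and is
  contained in \<open>pt x\<close>; maximality gives equality.\<close>

lemma max_ideals_eq: "max_ideals A = pt ` topspace X"
proof (intro subset_antisym subsetI)
  fix M assume "M \<in> max_ideals A"
  then interpret M: maximalideal M A by (simp add: max_ideals_def)
  have "\<one>\<^bsub>A\<^esub> \<notin> M" using M.one_imp_carrier M.I_notcarr by auto
  then obtain x where x: "x \<in> topspace X" "\<And>a. a \<in> M \<Longrightarrow> h a x = 0" using ideal_no_zero[OF M.ideal_axioms] by blast
  then have sub: "M \<subseteq> pt x" using M.a_subset by (auto simp: pt_def)
  interpret P: maximalideal "pt x" A using pt_max[OF x(1)] by (simp add: max_ideals_def)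
  have "pt x = M" using M.I_maximal[OF P.ideal_axioms sub P.a_subset] P.I_notcarr by auto
  then show "M \<in> pt ` topspace X" using x(1) by blast
qed (use pt_max in auto)

lemma coz_eq: "coz A a = pt ` {x \<in> topspace X. h a x \<noteq> 0}" if "a \<in> carrier A"
  unfolding coz_def max_ideals_eq using that by (auto simp: pt_def)

lemma gelfand_hom:
  assumes "M \<in> max_ideals A" shows "(\<lambda>a. gelfand A a M) \<in> ring_hom A real_ring"
    and "M = {a \<in> carrier A. gelfand A a M = 0}"
proof -
  obtain x where x: "x \<in> topspace X" "M = pt x" using assms max_ideals_eq by blast
  show "(\<lambda>a. gelfand A a M) \<in> ring_hom A real_ring"
    using eval_hom[OF x(1)] unfolding x(2) ring_hom_def
    by (simp add: gelfand_pt[OF x(1)])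
  show "M = {a \<in> carrier A. gelfand A a M = 0}"
    unfolding x(2) using gelfand_pt[OF x(1)] by (auto simp: pt_def)
qed

end

definition gelfand_map :: "'a ring \<Rightarrow> 'a \<Rightarrow> 'a set \<Rightarrow> real" where
  "gelfand_map A a = (\<lambda>M\<in>max_ideals A. gelfand A a M)"

text \<open>The spectrum of \<open>A\<close>: its maximal ideals, topologised so that the Gelfand transform
  becomes a presentation.\<close>

locale spectrum = cstar_presentation A X "gelfand_map A" for A :: "'a ring" and X :: "'a set topology" +
  assumes topspace_spectrum: "topspace X = max_ideals A"

text \<open>Since \<open>pt\<close> is a bijection onto the maximal ideals, the topology of
  \<open>X\<close> is carried over along its inverse; by \<open>gelfand_pt\<close> the presentation
  \<open>h\<close> then becomes the Gelfand transform.\<close>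

lemma (in cstar_presentation) spectrum_exists: "\<exists>Y. spectrum A Y"
proof -
  define e' where "e' = inv_into (topspace X) pt"
  define Y where "Y = pullback_topology (pt ` topspace X) e' X"
  have e'e: "e' (pt x) = x" if "x \<in> topspace X" for x
    using that pt_inj by (simp add: e'_def)
  have topY: "topspace Y = pt ` topspace X"
    by (auto simp: Y_def topspace_pullback_topology e'e)
  have c': "continuous_map Y X e'"
    using continuous_map_pullback[of X X id "pt ` topspace X" e'] by (simp add: Y_def)
  have c: "continuous_map X Y pt"
    unfolding Y_def
  proof (rule continuous_map_pullback')
    show "continuous_map X X (e' \<circ> pt)"
      by (rule continuous_map_eq[OF continuous_map_id]) (simp add: e'e)
  qed auto
  have hm: "homeomorphic_maps X Y pt e'"
    using c c' by (auto simp: homeomorphic_maps_def e'e topY)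
  then have "X homeomorphic_space Y"
    by (auto simp: homeomorphic_space_def)
  then have CH: "compact_space Y" "Hausdorff_space Y"
    using compact Hausdorff by (simp_all add: homeomorphic_compact_space homeomorphic_Hausdorff_space)
  have "(\<lambda>\<phi>. \<lambda>y\<in>topspace Y. \<phi> (e' y)) \<circ> h \<in> ring_iso A (C_ring Y)"
    by (rule ring_iso_set_trans[OF iso C_ring_pullback_iso[OF iffD1[OF homeomorphic_maps_sym hm]]])
  moreover have "((\<lambda>\<phi>. \<lambda>y\<in>topspace Y. \<phi> (e' y)) \<circ> h) a = gelfand_map A a" if "a \<in> carrier A" for a
    using that by (auto simp: gelfand_map_def topY max_ideals_eq gelfand_pt e'e fun_eq_iff)
  ultimately have "gelfand_map A \<in> ring_iso A (C_ring Y)"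
    by (rule A.ring_iso_restrict)
  then have "spectrum A Y"
    by unfold_locales (use CH in \<open>simp_all add: topY max_ideals_eq\<close>)
  then show ?thesis ..
qed

lemma cstar_algebra_spectrum:
  assumes "cstar_algebra A" obtains X where "spectrum A X"
proof -
  obtain X :: "'a set topology" and h where "cring A" "compact_space X" "Hausdorff_space X" "h \<in> ring_iso A (C_ring X)"
    using assms unfolding cstar_algebra_def is_ring_iso_def by blast
  then interpret cstar_presentation A X h by (simp add: cstar_presentation_def cstar_presentation_axioms_def)
  show ?thesis using spectrum_exists that by blast
qed

context spectrum
begin

lemma pt_eq: "M \<in> max_ideals A \<Longrightarrow> pt M = M"
  using gelfand_hom(2)[of M] by (simp add: pt_def gelfand_map_def)

lemma coz_spectrum: "a \<in> carrier A \<Longrightarrow> coz A a = {M \<in> topspace X. gelfand_map A a M \<noteq> 0}"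
  using coz_eq[of a] pt_eq by (force simp: topspace_spectrum image_iff)

lemma carrier_D_alg: "carrier (D_alg A) = {U. cozero_set X U}"
proof -
  have "carrier (D_alg A) = (\<lambda>\<phi>. {M \<in> topspace X. \<phi> M \<noteq> 0}) ` (gelfand_map A ` carrier A)"
    by (auto simp: D_alg_def coz_spectrum image_image)
  also have "gelfand_map A ` carrier A = carrier (C_ring X)"
    using ring_iso_memE(5)[OF iso] by (simp add: bij_betw_def)
  finally show ?thesis unfolding cozero_set_def by blast
qed

end

section \<open>The lattice of cozero sets of a compact space\<close>

definition cozero_lattice :: "'x topology \<Rightarrow> 'x set gorder" where
  "cozero_lattice X = \<lparr>carrier = {U. cozero_set X U}, eq = (=), le = (\<subseteq>)\<rparr>"

lemma cozero_lattice_simps [simp]: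
  "carrier (cozero_lattice X) = {U. cozero_set X U}"
  "le (cozero_lattice X) = (\<subseteq>)"
  "eq (cozero_lattice X) = (=)"
  by (simp_all add: cozero_lattice_def)

lemma partial_order_cozero_lattice: "partial_order (cozero_lattice X)"
  by unfold_locales auto

lemma cozero_lattice_lub:
  assumes "countable B" "\<And>U. U \<in> B \<Longrightarrow> cozero_set X U"
  shows "is_lub (cozero_lattice X) (\<Union>B) B"
  by (rule least_UpperI) (use assms in \<open>auto simp: Upper_def cozero_set_Union\<close>)

lemma cozero_lattice_glb:
  assumes "cozero_set X U" "cozero_set X V"
  shows "is_glb (cozero_lattice X) (U \<inter> V) {U, V}"
  by (rule greatest_LowerI) (use assms in \<open>auto simp: Lower_def cozero_set_Int\<close>)

lemma cozero_lattice_sup: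
  "countable B \<Longrightarrow> (\<And>U. U \<in> B \<Longrightarrow> cozero_set X U) \<Longrightarrow> \<Squnion>\<^bsub>cozero_lattice X\<^esub>B = \<Union>B"
  by (rule partial_order.sup_eqI[OF partial_order_cozero_lattice cozero_lattice_lub])

lemma cozero_lattice_join:
  "cozero_set X U \<Longrightarrow> cozero_set X V \<Longrightarrow> U \<squnion>\<^bsub>cozero_lattice X\<^esub> V = U \<union> V"
  unfolding join_def using cozero_lattice_sup[of "{U, V}" X] by auto

lemma cozero_lattice_meet:
  "cozero_set X U \<Longrightarrow> cozero_set X V \<Longrightarrow> U \<sqinter>\<^bsub>cozero_lattice X\<^esub> V = U \<inter> V"
  unfolding meet_def
  by (rule partial_order.inf_eqI[OF partial_order_cozero_lattice cozero_lattice_glb])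

lemma bounded_lattice_cozero_lattice: "bounded_lattice (cozero_lattice X)"
proof -
  interpret partial_order "cozero_lattice X" by (rule partial_order_cozero_lattice)
  show ?thesis
  proof unfold_locales
    fix U V assume UV: "U \<in> carrier (cozero_lattice X)" "V \<in> carrier (cozero_lattice X)"
    show "\<exists>s. is_lub (cozero_lattice X) s {U, V}"
      using cozero_lattice_lub[of "{U, V}" X] UV by auto
    show "\<exists>s. is_glb (cozero_lattice X) s {U, V}"
      using cozero_lattice_glb[of X U V] UV by auto
  next
    show "\<exists>U. least (cozero_lattice X) U (carrier (cozero_lattice X))"
      by (rule exI[of _ "{}"]) (simp add: least_def)
    show "\<exists>U. greatest (cozero_lattice X) U (carrier (cozero_lattice X))"
      by (rule exI[of _ "topspace X"]) (simp add: greatest_def cozero_set_subset)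
  qed
qed

lemma cozero_lattice_bottom: "\<bottom>\<^bsub>cozero_lattice X\<^esub> = {}"
  by (rule bounded_lattice.bottom_eq[OF bounded_lattice_cozero_lattice, symmetric]) simp_all

lemma cozero_lattice_top: "\<top>\<^bsub>cozero_lattice X\<^esub> = topspace X"
  by (rule bounded_lattice.top_eq[OF bounded_lattice_cozero_lattice, symmetric])
    (simp_all add: cozero_set_subset)

text \<open>Countable joins and finite meets are unions and intersections, so the axioms are the
  closure properties of cozero sets; compactness of \<open>X\<close> yields countable
  compactness.\<close>

lemma cc_alexandrov_cozero_lattice:
  assumes compact: "compact_space X" shows "cc_alexandrov_algebra (cozero_lattice X)"
proof -
  interpret bounded_lattice "cozero_lattice X" by (rule bounded_lattice_cozero_lattice)
  note simps = cozero_lattice_join cozero_lattice_meet cozero_lattice_bottom cozero_lattice_top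
    cozero_set_Int cozero_set_Un
  show ?thesis
  proof unfold_locales
    fix U V W assume "U \<in> carrier (cozero_lattice X)" "V \<in> carrier (cozero_lattice X)" "W \<in> carrier (cozero_lattice X)"
    then show "U \<sqinter>\<^bsub>cozero_lattice X\<^esub> (V \<squnion>\<^bsub>cozero_lattice X\<^esub> W) =
        (U \<sqinter>\<^bsub>cozero_lattice X\<^esub> V) \<squnion>\<^bsub>cozero_lattice X\<^esub> (U \<sqinter>\<^bsub>cozero_lattice X\<^esub> W)"
      by (simp add: simps Int_Un_distrib)
  next
    fix U V assume UV: "U \<in> carrier (cozero_lattice X)" "V \<in> carrier (cozero_lattice X)"
      and t: "U \<squnion>\<^bsub>cozero_lattice X\<^esub> V = \<top>\<^bsub>cozero_lattice X\<^esub>"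
    have c: "cozero_set X U" "cozero_set X V" and u: "U \<union> V = topspace X" using UV t by (simp_all add: simps)
    obtain C D where "cozero_set X C" "cozero_set X D" "C \<union> U = topspace X" "V \<union> D = topspace X" "C \<inter> D = {}"
      by (rule cozero_set_normal[OF c u])
    then show "\<exists>C\<in>carrier (cozero_lattice X). \<exists>D\<in>carrier (cozero_lattice X).
        C \<squnion>\<^bsub>cozero_lattice X\<^esub> U = \<top>\<^bsub>cozero_lattice X\<^esub> \<and> V \<squnion>\<^bsub>cozero_lattice X\<^esub> D = \<top>\<^bsub>cozero_lattice X\<^esub> \<and>
        C \<sqinter>\<^bsub>cozero_lattice X\<^esub> D = \<bottom>\<^bsub>cozero_lattice X\<^esub>"
      using c by (intro bexI[of _ C] bexI[of _ D]) (simp_all add: simps)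
  next
    fix B assume B: "countable B" "B \<subseteq> carrier (cozero_lattice X)"
    then have Bc: "cozero_set X V" if "V \<in> B" for V using that by auto
    show "\<exists>s. is_lub (cozero_lattice X) s B"
      using cozero_lattice_lub[OF B(1) Bc] by blast
    show "U \<sqinter>\<^bsub>cozero_lattice X\<^esub> \<Squnion>\<^bsub>cozero_lattice X\<^esub>B =
        \<Squnion>\<^bsub>cozero_lattice X\<^esub>((\<lambda>b. U \<sqinter>\<^bsub>cozero_lattice X\<^esub> b) ` B)" if U: "U \<in> carrier (cozero_lattice X)" for U
    proof -
      have img: "(\<lambda>b. U \<sqinter>\<^bsub>cozero_lattice X\<^esub> b) ` B = (\<inter>) U ` B"
        using U Bc by (intro image_cong) (simp_all add: simps)
      have "\<Squnion>\<^bsub>cozero_lattice X\<^esub>((\<inter>) U ` B) = \<Union>((\<inter>) U ` B)"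
        using U Bc B(1) by (intro cozero_lattice_sup) (auto simp: cozero_set_Int)
      moreover have "cozero_set X (\<Union>B)" using B(1) Bc by (rule cozero_set_Union)
      ultimately show ?thesis
        unfolding img using U cozero_lattice_sup[OF B(1) Bc] by (simp add: simps)
    qed
    assume t: "\<Squnion>\<^bsub>cozero_lattice X\<^esub>B = \<top>\<^bsub>cozero_lattice X\<^esub>"
    have "topspace X = \<Union>B" using t cozero_lattice_sup[OF B(1) Bc] by (simp add: simps)
    then have "\<exists>F. finite F \<and> F \<subseteq> B \<and> topspace X \<subseteq> \<Union>F"
      using Bc by (intro compactinD[OF compact[unfolded compact_space_def]]) (auto simp: cozero_set_openin)
    then obtain F where F: "finite F" "F \<subseteq> B" "topspace X \<subseteq> \<Union>F" by (elim exE conjE)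
    have Fc: "cozero_set X V" if "V \<in> F" for V using Bc F(2) that by auto
    have "\<Union>F = topspace X" using F(3) Fc cozero_set_subset[of X] by blast
    then have "\<Squnion>\<^bsub>cozero_lattice X\<^esub>F = \<top>\<^bsub>cozero_lattice X\<^esub>"
      using cozero_lattice_sup[OF countable_finite[OF F(1)] Fc] by (simp add: simps)
    then show "\<exists>F. finite F \<and> F \<subseteq> B \<and> \<Squnion>\<^bsub>cozero_lattice X\<^esub>F = \<top>\<^bsub>cozero_lattice X\<^esub>"
      using F(1,2) by blast
  next
    fix U assume "U \<in> carrier (cozero_lattice X)"
    then have U: "cozero_set X U" by simp
    obtain B C :: "nat \<Rightarrow> 'a set" where B: "\<And>n. cozero_set X (B n)" and C: "\<And>n. cozero_set X (C n)"
      and n: "(\<Union>n. C n) = U" "\<And>n. B n \<inter> C n = {}" "\<And>n. B n \<union> U = topspace X"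
      using cozero_set_approximation[OF U] by metis
    have "\<Squnion>\<^bsub>cozero_lattice X\<^esub>(range C) = U"
      using cozero_lattice_sup[of "range C" X] C n(1) by auto
    then show "\<exists>b c :: nat \<Rightarrow> _. range b \<subseteq> carrier (cozero_lattice X) \<and> range c \<subseteq> carrier (cozero_lattice X) \<and>
        \<Squnion>\<^bsub>cozero_lattice X\<^esub>(range c) = U \<and>
        (\<forall>n. b n \<sqinter>\<^bsub>cozero_lattice X\<^esub> c n = \<bottom>\<^bsub>cozero_lattice X\<^esub> \<and>
          b n \<squnion>\<^bsub>cozero_lattice X\<^esub> U = \<top>\<^bsub>cozero_lattice X\<^esub>)"
      using B C U n(2,3) by (intro exI[of _ B] exI[of _ C]) (auto simp: simps)
  qed
qed

section \<open>Points of the space as maximal ideals of its cozero lattice\<close>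

definition cozero_ideal :: "'x topology \<Rightarrow> 'x \<Rightarrow> 'x set set" where
  "cozero_ideal X x = {U. cozero_set X U \<and> x \<notin> U}"

locale compact_Hausdorff =
  fixes X :: "'x topology"
  assumes compact: "compact_space X" and Hausdorff: "Hausdorff_space X"
begin

sublocale coz: cc_alexandrov "cozero_lattice X"
  by (rule cc_alexandrov.intro[OF cc_alexandrov_cozero_lattice[OF compact]])

text \<open>If a larger ideal has a member \<open>V\<close> containing \<open>x\<close>, then
  \<open>x\<close> lies in some approximation \<open>C n\<close> of \<open>V\<close>. The matching
  \<open>B n\<close> misses \<open>x\<close>, so it is in the ideal too, and together with
  \<open>V\<close> it covers the space.\<close>

lemma maximal_cozero_ideal:
  assumes x: "x \<in> topspace X" shows "maximal_lattice_ideal (cozero_lattice X) (cozero_ideal X x)"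
  unfolding maximal_lattice_ideal_def
proof (intro conjI allI impI)
  show "lattice_ideal (cozero_lattice X) (cozero_ideal X x)"
    unfolding lattice_ideal_def
  proof (intro conjI ballI impI)
    have "{} \<in> cozero_ideal X x" by (simp add: cozero_ideal_def)
    then show "cozero_ideal X x \<noteq> {}" by blast
  qed (auto simp: cozero_ideal_def cozero_lattice_join cozero_set_Un)
  have "topspace X \<notin> cozero_ideal X x" using x by (simp add: cozero_ideal_def)
  then show "cozero_ideal X x \<noteq> carrier (cozero_lattice X)" by auto
  fix J assume "lattice_ideal (cozero_lattice X) J \<and> cozero_ideal X x \<subseteq> J"
  then have J: "lattice_ideal (cozero_lattice X) J" "cozero_ideal X x \<subseteq> J" by simp_all
  show "J = cozero_ideal X x \<or> J = carrier (cozero_lattice X)"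
  proof (cases "J \<subseteq> cozero_ideal X x")
    case False
    then obtain V where V: "V \<in> J" "V \<notin> cozero_ideal X x" by blast
    have Vc: "cozero_set X V" using coz.lattice_ideal_closed[OF J(1) V(1)] by simp
    then have xV: "x \<in> V" using V(2) by (simp add: cozero_ideal_def)
    obtain B C :: "nat \<Rightarrow> 'x set" where B: "\<And>n. cozero_set X (B n)"
      and n: "(\<Union>n. C n) = V" "\<And>n. B n \<inter> C n = {}" "\<And>n. B n \<union> V = topspace X"
      using cozero_set_approximation[OF Vc] by metis
    obtain n where "x \<in> C n" using xV n(1) by blast
    then have "B n \<in> cozero_ideal X x" using n(2)[of n] B by (auto simp: cozero_ideal_def)
    then have "B n \<squnion>\<^bsub>cozero_lattice X\<^esub> V \<in> J" using J V(1) by (intro coz.lattice_ideal_join) auto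
    then have "\<top>\<^bsub>cozero_lattice X\<^esub> \<in> J"
      by (simp add: cozero_lattice_join[OF B Vc] n(3) cozero_lattice_top)
    then show ?thesis using coz.lattice_ideal_top[OF J(1)] by simp
  qed (rule disjI1[OF subset_antisym[OF _ J(2)]])
qed

text \<open>The members of \<open>P\<close> cannot cover \<open>X\<close>, since a finite subcover
  would put the top into \<open>P\<close>. So all of them miss some point \<open>x\<close>, and
  maximality does the rest.\<close>

lemma maximal_is_cozero_ideal:
  assumes P: "maximal_lattice_ideal (cozero_lattice X) P"
  shows "\<exists>x\<in>topspace X. P = cozero_ideal X x"
proof -
  note I = coz.maximal_imp_ideal[OF P]
  have Pc: "cozero_set X U" if "U \<in> P" for U using coz.lattice_ideal_closed[OF I that] by simp
  have "\<exists>x\<in>topspace X. \<forall>U\<in>P. x \<notin> U"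
  proof (rule ccontr)
    assume "\<not> ?thesis"
    then have "topspace X \<subseteq> \<Union>P" by blast
    then have "\<exists>F. finite F \<and> F \<subseteq> P \<and> topspace X \<subseteq> \<Union>F"
      using Pc by (intro compactinD[OF compact[unfolded compact_space_def]]) (auto simp: cozero_set_openin)
    then obtain F where F: "finite F" "F \<subseteq> P" "topspace X \<subseteq> \<Union>F" by (elim exE conjE)
    have Fc: "cozero_set X V" if "V \<in> F" for V using Pc F(2) that by auto
    have "\<Union>F = topspace X" using F(3) Fc cozero_set_subset[of X] by blast
    then have "\<top>\<^bsub>cozero_lattice X\<^esub> \<in> P"
      using coz.lattice_ideal_finite_sup[OF I F(1,2)] cozero_lattice_sup[OF countable_finite[OF F(1)] Fc]
      by (simp add: cozero_lattice_top)
    then show False using coz.maximal_top[OF P] by contradiction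
  qed
  then obtain x where x: "x \<in> topspace X" "P \<subseteq> cozero_ideal X x"
    using Pc by (auto simp: cozero_ideal_def)
  note Q = maximal_cozero_ideal[OF x(1)]
  have "cozero_ideal X x = P \<or> cozero_ideal X x = carrier (cozero_lattice X)"
    using P coz.maximal_imp_ideal[OF Q] x(2) unfolding maximal_lattice_ideal_def by simp
  moreover have "cozero_ideal X x \<noteq> carrier (cozero_lattice X)"
    using Q unfolding maximal_lattice_ideal_def by simp
  ultimately show ?thesis using x(1) by auto
qed

text \<open>A continuous bijection from a compact space to a Hausdorff space: the preimage of the
  basic set of \<open>U\<close> is \<open>U\<close> itself, and Urysohn functions separate
  points.\<close>

lemma homeomorphic_map_cozero_ideal:
  "homeomorphic_map X (Max_space (cozero_lattice X)) (cozero_ideal X)"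
proof (rule continuous_imp_homeomorphic_map[OF _ compact coz.Hausdorff_space_Max_space])
  show img: "cozero_ideal X ` topspace X = topspace (Max_space (cozero_lattice X))"
    unfolding coz.topspace_Max_space
    using maximal_cozero_ideal maximal_is_cozero_ideal by (intro subset_antisym) auto
  show "continuous_map X (Max_space (cozero_lattice X)) (cozero_ideal X)"
    unfolding Max_space_def
  proof (rule continuous_on_generated_topo)
    show "cozero_ideal X ` topspace X \<subseteq> \<Union>(basic_open (cozero_lattice X) ` carrier (cozero_lattice X))"
      using img unfolding Max_space_def by simp
    fix V assume "V \<in> basic_open (cozero_lattice X) ` carrier (cozero_lattice X)"
    then obtain U where U: "cozero_set X U" "V = basic_open (cozero_lattice X) U" by auto
    have "cozero_ideal X -` V \<inter> topspace X = U"
      using maximal_cozero_ideal cozero_set_subset[OF U(1)] U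
      by (auto simp: basic_open_def cozero_ideal_def)
    then show "openin X (cozero_ideal X -` V \<inter> topspace X)" using cozero_set_openin[OF U(1)] by simp
  qed
  show "inj_on (cozero_ideal X) (topspace X)"
  proof (rule inj_onI, rule ccontr)
    fix x y assume x: "x \<in> topspace X" and y: "y \<in> topspace X"
      and eq: "cozero_ideal X x = cozero_ideal X y" and ne: "x \<noteq> y"
    have "normal_space X"
      by (rule compact_Hausdorff_or_regular_imp_normal_space) (simp_all add: compact Hausdorff)
    moreover have "closedin X {x}" "closedin X {y}" "disjnt {x} {y}"
      using closedin_Hausdorff_singleton[OF Hausdorff] x y ne by (simp_all add: disjnt_def)
    ultimately obtain f :: "'x \<Rightarrow> real" where f: "continuous_map X euclideanreal f" "f ` {x} \<subseteq> {0}" "f ` {y} \<subseteq> {1}"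
      by (rule Urysohn_lemma_alt)
    let ?U = "{z \<in> topspace X. f z \<noteq> 0}"
    have "cozero_set X ?U" by (rule cozero_setI[OF f(1)]) simp
    then have "?U \<in> cozero_ideal X x" "?U \<notin> cozero_ideal X y" using f y by (simp_all add: cozero_ideal_def)
    then show False using eq by simp
  qed
qed

text \<open>Read through the homeomorphism with \<open>Max_space\<close>, the element sampled at
  \<open>i\<close> is the plain preimage of \<open>W i\<close>, because a cozero set is outside the
  ideal of \<open>x\<close> exactly if it contains \<open>x\<close>.\<close>

lemma sample_cozero_lattice_iso:
  assumes rb: "real_base I W"
  shows "(\<lambda>\<phi>. \<lambda>i\<in>I. {x \<in> topspace X. \<phi> x \<in> W i}) \<in> ring_iso (C_ring X) (sample_alg I W (cozero_lattice X))"
proof -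
  let ?S = "cozero_lattice X"
  obtain e' where hm: "homeomorphic_maps X (Max_space ?S) (cozero_ideal X) e'"
    using homeomorphic_map_cozero_ideal unfolding homeomorphic_map_maps ..
  let ?F = "\<lambda>\<phi>. \<lambda>P\<in>topspace (Max_space ?S). \<phi> (e' P)"
  have F: "?F \<in> ring_iso (C_ring X) (C_ring (Max_space ?S))"
    by (rule C_ring_pullback_iso[OF iffD1[OF homeomorphic_maps_sym hm]])
  have "sample I W ?S \<circ> ?F \<in> ring_iso (C_ring X) (sample_alg I W ?S)"
    by (rule ring_iso_set_trans[OF F coz.sample_alg_iso(1)[OF rb]])
  moreover have "(sample I W ?S \<circ> ?F) \<phi> = (\<lambda>i\<in>I. {x \<in> topspace X. \<phi> x \<in> W i})"
    if \<phi>: "\<phi> \<in> carrier (C_ring X)" for \<phi>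
  proof (rule ext)
    fix i
    have "preimage_elt ?S (?F \<phi>) (W i) = {x \<in> topspace X. \<phi> x \<in> W i}" if i: "i \<in> I"
    proof (rule coz.preimage_elt_eqI)
      show "continuous_map (Max_space ?S) euclideanreal (?F \<phi>)"
        by (rule C_ring_continuous[OF ring_iso_memE(1)[OF F \<phi>]])
      show o: "open (W i)" by (rule real_base.open_base[OF rb i])
      show c: "{x \<in> topspace X. \<phi> x \<in> W i} \<in> carrier ?S"
        using cozero_set_preimage[OF C_ring_continuous[OF \<phi>] o] by simp
      fix P assume P: "maximal_lattice_ideal ?S P"
      obtain x where x: "x \<in> topspace X" "P = cozero_ideal X x"
        using maximal_is_cozero_ideal[OF P] by blast
      have "e' P = x" using hm x by (simp add: homeomorphic_maps_def)
      then show "?F \<phi> P \<in> W i \<longleftrightarrow> {x \<in> topspace X. \<phi> x \<in> W i} \<notin> P"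
        using P c x by (simp add: coz.topspace_Max_space cozero_ideal_def)
    qed
    then show "(sample I W ?S \<circ> ?F) \<phi> i = (\<lambda>i\<in>I. {x \<in> topspace X. \<phi> x \<in> W i}) i"
      by (simp add: sample_def)
  qed
  ultimately show ?thesis by (rule ring.ring_iso_restrict[OF cring.axioms(1)[OF cring_C_ring]])
qed

end

section \<open>The functor D\<close>

sublocale cstar_presentation \<subseteq> compact_Hausdorff X
  by standard (rule compact Hausdorff)+

lemma (in spectrum) D_alg_eq: "D_alg A = cozero_lattice X"
  using carrier_D_alg by (simp add: D_alg_def cozero_lattice_def)

lemma cc_alexandrov_D_alg:
  assumes "cstar_algebra A" shows "cc_alexandrov (D_alg A)"
proof -
  obtain X where "spectrum A X" using cstar_algebra_spectrum[OF assms] .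
  then interpret spectrum A X .
  show ?thesis unfolding D_alg_eq by (rule coz.cc_alexandrov_axioms)
qed

locale cstar_hom = A: spectrum A X + B: spectrum B Y
  for A :: "'a ring" and X and B :: "'b ring" and Y +
  fixes f assumes hom: "f \<in> ring_hom A B"
begin

definition contract :: "'b set \<Rightarrow> 'a set" where "contract N = {a \<in> carrier A. f a \<in> N}"

text \<open>The contraction of \<open>N\<close> is the kernel of a real-valued homomorphism, namely
  \<open>f\<close> followed by the value at \<open>N\<close>; this gives both its maximality and the
  values at it.\<close>

lemma contract:
  assumes N: "N \<in> max_ideals B"
  shows contract_max: "contract N \<in> max_ideals A"
    and gelfand_contract: "a \<in> carrier A \<Longrightarrow> gelfand A a (contract N) = gelfand B (f a) N"
proof -
  have k: "(\<lambda>a. gelfand B (f a) N) \<in> ring_hom A real_ring"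
    using ring_hom_trans[OF hom B.gelfand_hom(1)[OF N]] by (simp add: o_def)
  have eq: "contract N = {a \<in> carrier A. gelfand B (f a) N = 0}"
  proof -
    have "f a \<in> N \<longleftrightarrow> gelfand B (f a) N = 0" if "a \<in> carrier A" for a
      using B.gelfand_hom(2)[OF N] ring_hom_closed[OF hom that] by blast
    then show ?thesis unfolding contract_def by blast
  qed
  show "contract N \<in> max_ideals A"
    unfolding eq max_ideals_def using A.maximalideal_real_kernel[OF k] by simp
  show "gelfand A a (contract N) = gelfand B (f a) N" if "a \<in> carrier A"
    unfolding eq by (rule A.gelfand_real_kernel[OF k that])
qed

lemma coz_contract:
  assumes "a \<in> carrier A" shows "coz B (f a) = {N \<in> max_ideals B. contract N \<in> coz A a}"
  using assms contract_max by (auto simp: coz_def contract_def)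

text \<open>The definite description is sound: by \<open>coz_contract\<close> the set
  \<open>coz B (f a)\<close> is the preimage of \<open>coz A a\<close> under
  \<open>contract\<close>, so it does not depend on the representative \<open>a\<close>.\<close>

lemma D_hom_coz:
  assumes a: "a \<in> carrier A" shows "D_hom A B f (coz A a) = coz B (f a)"
  unfolding D_hom_def
proof (rule the_equality)
  show "\<exists>b\<in>carrier A. coz A a = coz A b \<and> coz B (f a) = coz B (f b)" using a by blast
  fix V assume "\<exists>b\<in>carrier A. coz A a = coz A b \<and> V = coz B (f b)"
  then show "V = coz B (f a)" using coz_contract[OF a] coz_contract by auto
qed

lemma D_hom_eq:
  assumes "U \<in> carrier (D_alg A)" shows "D_hom A B f U = {N \<in> max_ideals B. contract N \<in> U}"
proof -
  obtain a where a: "a \<in> carrier A" "U = coz A a" using assms by (auto simp: D_alg_def)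
  show ?thesis unfolding a(2) D_hom_coz[OF a(1)] by (rule coz_contract[OF a(1)])
qed

lemma D_hom_closed:
  assumes "U \<in> carrier (D_alg A)" shows "D_hom A B f U \<in> carrier (D_alg B)"
proof -
  obtain a where a: "a \<in> carrier A" "U = coz A a" using assms by (auto simp: D_alg_def)
  show ?thesis unfolding a(2) D_hom_coz[OF a(1)] using ring_hom_closed[OF hom a(1)] by (simp add: D_alg_def)
qed

text \<open>\<open>D_hom A B f\<close> is preimage under \<open>contract\<close>, which commutes
  with unions and intersections.\<close>

lemma D_hom_alex_hom: "D_hom A B f \<in> alex_hom (D_alg A) (D_alg B)"
proof -
  have cl: "cozero_set Y (D_hom A B f U)" if "cozero_set X U" for U
    using D_hom_closed[of U] that by (simp add: A.D_alg_eq B.D_alg_eq)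
  have eq: "D_hom A B f U = {N \<in> topspace Y. contract N \<in> U}" if "cozero_set X U" for U
    using D_hom_eq[of U] that by (simp add: A.D_alg_eq B.topspace_spectrum)
  have cm: "contract N \<in> topspace X" if "N \<in> topspace Y" for N
    using contract_max[of N] that by (simp add: A.topspace_spectrum B.topspace_spectrum)
  have sup: "D_hom A B f (\<Squnion>\<^bsub>cozero_lattice X\<^esub>\<U>) = \<Squnion>\<^bsub>cozero_lattice Y\<^esub>(D_hom A B f ` \<U>)"
    if \<U>: "countable \<U>" "\<U> \<subseteq> carrier (cozero_lattice X)" for \<U>
  proof -
    have c: "cozero_set X U" if "U \<in> \<U>" for U using that \<U>(2) by auto
    have "\<Squnion>\<^bsub>cozero_lattice Y\<^esub>(D_hom A B f ` \<U>) = \<Union>(D_hom A B f ` \<U>)"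
      using \<U>(1) c cl by (intro cozero_lattice_sup) auto
    also have "\<dots> = {N \<in> topspace Y. contract N \<in> \<Union>\<U>}" using eq[OF c] by auto
    finally show ?thesis
      using eq[OF cozero_set_Union[OF \<U>(1) c]] by (simp add: cozero_lattice_sup[OF \<U>(1) c])
  qed
  show ?thesis
    unfolding alex_hom_def A.D_alg_eq B.D_alg_eq
  proof (intro CollectI conjI ballI allI impI)
    show "D_hom A B f \<in> carrier (cozero_lattice X) \<rightarrow> carrier (cozero_lattice Y)" using cl by simp
    show "D_hom A B f \<top>\<^bsub>cozero_lattice X\<^esub> = \<top>\<^bsub>cozero_lattice Y\<^esub>"
      unfolding cozero_lattice_top using eq[of "topspace X"] cm by auto
    show "D_hom A B f \<bottom>\<^bsub>cozero_lattice X\<^esub> = \<bottom>\<^bsub>cozero_lattice Y\<^esub>"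
      unfolding cozero_lattice_bottom using eq[of "{}"] by simp
  next
    fix U V assume "U \<in> carrier (cozero_lattice X)" "V \<in> carrier (cozero_lattice X)"
    then have c: "cozero_set X U" "cozero_set X V" by simp_all
    show "D_hom A B f (U \<sqinter>\<^bsub>cozero_lattice X\<^esub> V) = D_hom A B f U \<sqinter>\<^bsub>cozero_lattice Y\<^esub> D_hom A B f V"
      unfolding cozero_lattice_meet[OF c] cozero_lattice_meet[OF cl[OF c(1)] cl[OF c(2)]]
      unfolding eq[OF c(1)] eq[OF c(2)] eq[OF cozero_set_Int[OF c]] by blast
    show "D_hom A B f (U \<squnion>\<^bsub>cozero_lattice X\<^esub> V) = D_hom A B f U \<squnion>\<^bsub>cozero_lattice Y\<^esub> D_hom A B f V"
      unfolding cozero_lattice_join[OF c] cozero_lattice_join[OF cl[OF c(1)] cl[OF c(2)]]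
      unfolding eq[OF c(1)] eq[OF c(2)] eq[OF cozero_set_Un[OF c]] by blast
  qed (use sup in blast)
qed

end

lemma cstar_hom_exists:
  assumes "cstar_algebra A" "cstar_algebra B" "f \<in> ring_hom A B"
  obtains X Y where "cstar_hom A X B Y f"
proof -
  obtain X where X: "spectrum A X" using cstar_algebra_spectrum[OF assms(1)] .
  obtain Y where Y: "spectrum B Y" using cstar_algebra_spectrum[OF assms(2)] .
  show ?thesis using that X Y assms(3) by (simp add: cstar_hom_def cstar_hom_axioms_def)
qed

lemma D_hom_id:
  assumes A: "cstar_algebra A" and U: "U \<in> carrier (D_alg A)"
  shows "D_hom A A (\<lambda>x. x) U = U"
proof -
  have "(\<lambda>x. x) \<in> ring_hom A A" by (rule ring_hom_memI) simp_all
  then obtain X Y where "cstar_hom A X A Y (\<lambda>x. x)" using cstar_hom_exists[OF A A] by blast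
  then interpret cstar_hom A X A Y "\<lambda>x. x" .
  obtain a where "a \<in> carrier A" "U = coz A a" using U by (auto simp: D_alg_def)
  then show ?thesis using D_hom_coz by simp
qed

lemma D_hom_comp:
  assumes A: "cstar_algebra A" and B: "cstar_algebra B" and C: "cstar_algebra C"
    and f: "f \<in> ring_hom A B" and g: "g \<in> ring_hom B C" and U: "U \<in> carrier (D_alg A)"
  shows "D_hom A C (g \<circ> f) U = D_hom B C g (D_hom A B f U)"
proof -
  obtain X Y where "cstar_hom A X B Y f" using cstar_hom_exists[OF A B f] .
  then interpret f: cstar_hom A X B Y f .
  \<comment> \<open>The space chosen for \<open>B\<close> here may differ from the earlier one,
    which is harmless because \<open>D_hom_coz\<close> mentions only the rings.\<close>
  obtain Y' Z where "cstar_hom B Y' C Z g" using cstar_hom_exists[OF B C g] .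
  then interpret g: cstar_hom B Y' C Z g .
  obtain X' Z' where "cstar_hom A X' C Z' (g \<circ> f)"
    using cstar_hom_exists[OF A C ring_hom_trans[OF f g]] .
  then interpret gf: cstar_hom A X' C Z' "g \<circ> f" .
  obtain a where a: "a \<in> carrier A" "U = coz A a" using U by (auto simp: D_alg_def)
  show ?thesis
    unfolding a(2) f.D_hom_coz[OF a(1)] gf.D_hom_coz[OF a(1)] g.D_hom_coz[OF ring_hom_closed[OF f a(1)]]
    by simp
qed

section \<open>Unit and counit\<close>

definition sample_unit :: "'i set \<Rightarrow> ('i \<Rightarrow> real set) \<Rightarrow> 'a ring \<Rightarrow> 'a \<Rightarrow> 'i \<Rightarrow> 'a set set" where
  "sample_unit I W A a = (\<lambda>i\<in>I. {M \<in> max_ideals A. gelfand A a M \<in> W i})"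

lemma (in spectrum) sample_unit_iso:
  assumes "real_base I W"
  shows "sample_unit I W A \<in> ring_iso A (sample_alg I W (D_alg A))"
proof -
  have "(\<lambda>\<phi>. \<lambda>i\<in>I. {x \<in> topspace X. \<phi> x \<in> W i}) \<circ> gelfand_map A \<in> ring_iso A (sample_alg I W (D_alg A))"
    unfolding D_alg_eq by (rule ring_iso_set_trans[OF iso sample_cozero_lattice_iso[OF assms]])
  moreover have "((\<lambda>\<phi>. \<lambda>i\<in>I. {x \<in> topspace X. \<phi> x \<in> W i}) \<circ> gelfand_map A) a = sample_unit I W A a" for a
  proof -
    have "{M \<in> max_ideals A. gelfand_map A a M \<in> W i} = {M \<in> max_ideals A. gelfand A a M \<in> W i}" for i
      by (auto simp: gelfand_map_def)
    then show ?thesis by (simp add: sample_unit_def topspace_spectrum)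
  qed
  ultimately show ?thesis by (rule A.ring_iso_restrict)
qed

lemma (in spectrum) gelfand_preimage:
  assumes "a \<in> carrier A" "open U" shows "{M \<in> max_ideals A. gelfand A a M \<in> U} \<in> carrier (D_alg A)"
proof -
  have "{M \<in> topspace X. gelfand_map A a M \<in> U} = {M \<in> max_ideals A. gelfand A a M \<in> U}"
    by (auto simp: gelfand_map_def topspace_spectrum)
  then show ?thesis
    using cozero_set_preimage[OF C_ring_continuous[OF h_closed[OF assms(1)]] assms(2)]
    by (simp add: D_alg_eq)
qed

text \<open>By \<open>gelfand_contract\<close>, preimage under \<open>contract\<close> turns
  conditions on the values of \<open>a\<close> into the same conditions on the values of
  \<open>f a\<close>.\<close>

lemma (in cstar_hom) sample_unit_natural:
  assumes rb: "real_base I W" and a: "a \<in> carrier A"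
  shows "sample_unit I W B (f a) = sample_hom I (D_hom A B f) (sample_unit I W A a)"
proof (rule ext)
  fix i
  show "sample_unit I W B (f a) i = sample_hom I (D_hom A B f) (sample_unit I W A a) i"
  proof (cases "i \<in> I")
    case True
    have "D_hom A B f {M \<in> max_ideals A. gelfand A a M \<in> W i} =
        {N \<in> max_ideals B. contract N \<in> {M \<in> max_ideals A. gelfand A a M \<in> W i}}"
      by (rule D_hom_eq[OF A.gelfand_preimage[OF a real_base.open_base[OF rb True]]])
    also have "\<dots> = {N \<in> max_ideals B. gelfand B (f a) N \<in> W i}"
      using contract_max gelfand_contract[OF _ a] by auto
    finally show ?thesis using True by (simp add: sample_hom_def sample_unit_def)
  qed (simp add: sample_hom_def sample_unit_def)
qed

text \<open>An order isomorphism carries bounds to bounds in both directions, so all joins and meets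
  are preserved at once. The counit and its inverse are both obtained from this.\<close>

lemma order_iso_alex_hom:
  fixes S :: "'a gorder" and T :: "'b gorder"
  assumes "cc_alexandrov S" "cc_alexandrov T"
    and f: "\<And>x. x \<in> carrier S \<Longrightarrow> f x \<in> carrier T" and g: "\<And>y. y \<in> carrier T \<Longrightarrow> g y \<in> carrier S"
    and gf: "\<And>x. x \<in> carrier S \<Longrightarrow> g (f x) = x" and fg: "\<And>y. y \<in> carrier T \<Longrightarrow> f (g y) = y"
    and le: "\<And>x y. x \<in> carrier S \<Longrightarrow> y \<in> carrier S \<Longrightarrow> f x \<sqsubseteq>\<^bsub>T\<^esub> f y \<longleftrightarrow> x \<sqsubseteq>\<^bsub>S\<^esub> y"
  shows "f \<in> alex_hom S T"
proof -
  interpret S: cc_alexandrov S by fact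
  interpret T: cc_alexandrov T by fact
  have le1: "f x \<sqsubseteq>\<^bsub>T\<^esub> z \<longleftrightarrow> x \<sqsubseteq>\<^bsub>S\<^esub> g z" if "x \<in> carrier S" "z \<in> carrier T" for x z
    using le[OF that(1) g[OF that(2)]] fg[OF that(2)] by simp
  have le2: "z \<sqsubseteq>\<^bsub>T\<^esub> f x \<longleftrightarrow> g z \<sqsubseteq>\<^bsub>S\<^esub> x" if "x \<in> carrier S" "z \<in> carrier T" for x z
    using le[OF g[OF that(2)] that(1)] fg[OF that(2)] by simp
  have lub: "is_lub T (f s) (f ` B)" if s: "is_lub S s B" and B: "B \<subseteq> carrier S" for s B
  proof (rule least_UpperI)
    have sc: "s \<in> carrier S" by (rule least_closed[OF s])
    then show "f s \<in> carrier T" by (rule f)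
    show "f ` B \<subseteq> carrier T" using B f by auto
    fix y assume "y \<in> f ` B"
    then obtain b where b: "b \<in> B" "y = f b" by blast
    then show "y \<sqsubseteq>\<^bsub>T\<^esub> f s" using least_Upper_above[OF s b(1) B] le[OF _ sc] B by auto
  next
    have sc: "s \<in> carrier S" by (rule least_closed[OF s])
    fix z assume z: "z \<in> Upper T (f ` B)"
    then have zc: "z \<in> carrier T" "\<And>b. b \<in> B \<Longrightarrow> f b \<sqsubseteq>\<^bsub>T\<^esub> z"
      using B f by (auto simp: Upper_def)
    have "g z \<in> Upper S B"
      using zc(2) le1[OF _ zc(1)] B g[OF zc(1)] by (intro Upper_memI) auto
    then show "f s \<sqsubseteq>\<^bsub>T\<^esub> z" using least_le[OF s] le1[OF sc zc(1)] by simp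
  qed
  have glb: "is_glb T (f s) (f ` B)" if s: "is_glb S s B" and B: "B \<subseteq> carrier S" for s B
  proof (rule greatest_LowerI)
    have sc: "s \<in> carrier S" by (rule greatest_closed[OF s])
    then show "f s \<in> carrier T" by (rule f)
    show "f ` B \<subseteq> carrier T" using B f by auto
    fix y assume "y \<in> f ` B"
    then obtain b where b: "b \<in> B" "y = f b" by blast
    then show "f s \<sqsubseteq>\<^bsub>T\<^esub> y" using greatest_Lower_below[OF s b(1) B] le[OF sc] B by auto
  next
    have sc: "s \<in> carrier S" by (rule greatest_closed[OF s])
    fix z assume z: "z \<in> Lower T (f ` B)"
    then have zc: "z \<in> carrier T" "\<And>b. b \<in> B \<Longrightarrow> z \<sqsubseteq>\<^bsub>T\<^esub> f b"
      using B f by (auto simp: Lower_def)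
    have "g z \<in> Lower S B"
      using zc(2) le2[OF _ zc(1)] B g[OF zc(1)] by (intro Lower_memI) auto
    then show "z \<sqsubseteq>\<^bsub>T\<^esub> f s" using greatest_le[OF s] le2[OF sc zc(1)] by simp
  qed
  show ?thesis
    unfolding alex_hom_def
  proof (intro CollectI conjI ballI allI impI)
    show "f \<in> carrier S \<rightarrow> carrier T" using f by blast
    show "f \<top>\<^bsub>S\<^esub> = \<top>\<^bsub>T\<^esub>" by (rule T.top_eq) (simp_all add: f le2 g)
    show "f \<bottom>\<^bsub>S\<^esub> = \<bottom>\<^bsub>T\<^esub>" by (rule T.bottom_eq) (simp_all add: f le1 g)
  next
    fix x y assume xy: "x \<in> carrier S" "y \<in> carrier S"
    show "f (x \<sqinter>\<^bsub>S\<^esub> y) = f x \<sqinter>\<^bsub>T\<^esub> f y"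
      unfolding meet_def using glb[OF S.inf_of_two_greatest[OF xy]] xy
      by (intro T.inf_eqI[symmetric]) simp
    show "f (x \<squnion>\<^bsub>S\<^esub> y) = f x \<squnion>\<^bsub>T\<^esub> f y"
      unfolding join_def using lub[OF S.sup_of_two_least[OF xy]] xy
      by (intro T.sup_eqI[symmetric]) simp
  next
    fix B assume "countable B \<and> B \<subseteq> carrier S"
    then have B: "countable B" "B \<subseteq> carrier S" by simp_all
    show "f (\<Squnion>\<^bsub>S\<^esub>B) = \<Squnion>\<^bsub>T\<^esub>(f ` B)"
      by (rule T.sup_eqI[OF lub[OF S.countable_sup_lub[OF B] B(2)], symmetric])
  qed
qed

section \<open>The counit as a lattice isomorphism\<close>

lemma open_nonzero: "open (- {0 :: real})"
  by (intro open_Compl closed_singleton)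

text \<open>In the applications, \<open>nz f\<close> is the element of the lattice that corresponds to the cozero
  set of the continuous function encoded by \<open>f\<close>.\<close>

definition coz_counit :: "'b ring \<Rightarrow> ('b \<Rightarrow> 'a) \<Rightarrow> 'b set set \<Rightarrow> 'a" where
  "coz_counit A nz V = (THE d. \<exists>f\<in>carrier A. V = coz A f \<and> d = nz f)"

context cc_alexandrov
begin

context
  fixes I :: "'i set" and W and nz :: "('i \<Rightarrow> 'a) \<Rightarrow> 'a"
  assumes rb: "real_base I W"
    and nz: "\<And>\<phi>. \<phi> \<in> carrier (C_ring (Max_space L)) \<Longrightarrow> nz (sample I W L \<phi>) = preimage_elt L \<phi> (- {0})"
begin

text \<open>The inverse of \<open>sample\<close> presents the algebra on \<open>Max_space L\<close>,
  so \<open>pres.pt\<close> matches the maximal ideals of the lattice with those of the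
  ring.\<close>

interpretation pres: cstar_presentation "sample_alg I W L" "Max_space L"
  "inv_into (carrier (C_ring (Max_space L))) (sample I W L)"
proof -
  interpret cring "sample_alg I W L" by (rule sample_alg_iso(2)[OF rb])
  show "cstar_presentation (sample_alg I W L) (Max_space L) (inv_into (carrier (C_ring (Max_space L))) (sample I W L))"
    by unfold_locales (simp_all add: compact_space_Max_space Hausdorff_space_Max_space
        ring_iso_set_sym[OF cring.axioms(1)[OF cring_C_ring] sample_alg_iso(1)[OF rb]])
qed

lemma coz_sample:
  assumes \<phi>: "\<phi> \<in> carrier (C_ring (Max_space L))"
  shows "coz (sample_alg I W L) (sample I W L \<phi>) = pres.pt ` basic_open L (preimage_elt L \<phi> (- {0}))"
proof -
  have s: "sample I W L \<phi> \<in> carrier (sample_alg I W L)" using \<phi> by (simp add: carrier_sample_alg)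
  have "basic_open L (preimage_elt L \<phi> (- {0})) = {M \<in> topspace (Max_space L). \<phi> M \<noteq> 0}"
    using preimage_elt(2)[OF C_ring_continuous[OF \<phi>] open_nonzero] by simp
  then show ?thesis unfolding pres.coz_eq[OF s] by (simp add: inv_into_f_f[OF sample_inj[OF rb] \<phi>])
qed

lemma pt_basic_open_subset:
  assumes "d \<in> carrier L" "e \<in> carrier L"
  shows "pres.pt ` basic_open L d \<subseteq> pres.pt ` basic_open L e \<longleftrightarrow> d \<sqsubseteq> e"
proof -
  have "pres.pt ` basic_open L d \<subseteq> pres.pt ` basic_open L e \<longleftrightarrow> basic_open L d \<subseteq> basic_open L e"
    using basic_open_subset by (intro inj_on_image_subset_iff[OF pres.pt_inj]) (auto simp: topspace_Max_space)
  also have "\<dots> \<longleftrightarrow> d \<sqsubseteq> e" using basic_open_le[OF assms] basic_open_mono[OF assms] by blast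
  finally show ?thesis .
qed

text \<open>The description is unambiguous: by \<open>coz_sample\<close> and
  \<open>pt_basic_open_subset\<close>, equal cozero sets come from equal lattice elements.\<close>

lemma coz_counit_sample:
  assumes \<phi>: "\<phi> \<in> carrier (C_ring (Max_space L))"
  shows "coz_counit (sample_alg I W L) nz (coz (sample_alg I W L) (sample I W L \<phi>)) = preimage_elt L \<phi> (- {0})"
  unfolding coz_counit_def
proof (rule the_equality)
  show "\<exists>f\<in>carrier (sample_alg I W L). coz (sample_alg I W L) (sample I W L \<phi>) = coz (sample_alg I W L) f \<and>
      preimage_elt L \<phi> (- {0}) = nz f"
    using \<phi> nz[OF \<phi>] by (intro bexI[of _ "sample I W L \<phi>"]) (simp_all add: carrier_sample_alg)
  fix d assume "\<exists>f\<in>carrier (sample_alg I W L).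
    coz (sample_alg I W L) (sample I W L \<phi>) = coz (sample_alg I W L) f \<and> d = nz f"
  then obtain \<psi> where \<psi>: "\<psi> \<in> carrier (C_ring (Max_space L))"
    and eq: "coz (sample_alg I W L) (sample I W L \<phi>) = coz (sample_alg I W L) (sample I W L \<psi>)"
    and d: "d = nz (sample I W L \<psi>)" by (auto simp: carrier_sample_alg)
  have c: "preimage_elt L \<phi> (- {0}) \<in> carrier L" "preimage_elt L \<psi> (- {0}) \<in> carrier L"
    by (rule preimage_elt(1)[OF C_ring_continuous[OF \<phi>] open_nonzero]
        preimage_elt(1)[OF C_ring_continuous[OF \<psi>] open_nonzero])+
  have "preimage_elt L \<phi> (- {0}) \<sqsubseteq> preimage_elt L \<psi> (- {0})" "preimage_elt L \<psi> (- {0}) \<sqsubseteq> preimage_elt L \<phi> (- {0})"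
    using pt_basic_open_subset[OF c] pt_basic_open_subset[OF c(2,1)] eq
    unfolding coz_sample[OF \<phi>] coz_sample[OF \<psi>] by simp_all
  then have "preimage_elt L \<phi> (- {0}) = preimage_elt L \<psi> (- {0})" by (rule le_antisym[OF _ _ c])
  then show "d = preimage_elt L \<phi> (- {0})" by (simp add: d nz[OF \<psi>])
qed

text \<open>The inverse sends \<open>d\<close> to the image of \<open>basic_open L d\<close> under
  \<open>pres.pt\<close>, which belongs to \<open>D_alg\<close> because every basic set is a cozero
  set. Both maps preserve and reflect the order.\<close>

lemma coz_counit_iso:
  "coz_counit (sample_alg I W L) nz \<in> alex_iso (D_alg (sample_alg I W L)) L"
proof -
  let ?A = "sample_alg I W L"
  let ?e = "coz_counit ?A nz" and ?g = "\<lambda>d. pres.pt ` basic_open L d"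
  have D: "cc_alexandrov (D_alg ?A)" by (rule cc_alexandrov_D_alg[OF cstar_algebra_sample_alg[OF rb]])
  have L: "cc_alexandrov L" by (rule cc_alexandrov_axioms)
  have sc: "\<exists>d\<in>carrier L. U = ?g d \<and> ?e U = d" if U: "U \<in> carrier (D_alg ?A)" for U
  proof -
    obtain \<phi> where \<phi>: "\<phi> \<in> carrier (C_ring (Max_space L))" "U = coz ?A (sample I W L \<phi>)"
      using U by (auto simp: D_alg_def carrier_sample_alg)
    have "preimage_elt L \<phi> (- {0}) \<in> carrier L"
      by (rule preimage_elt(1)[OF C_ring_continuous[OF \<phi>(1)] open_nonzero])
    moreover have "U = ?g (preimage_elt L \<phi> (- {0}))" unfolding \<phi>(2) by (rule coz_sample[OF \<phi>(1)])
    moreover have "?e U = preimage_elt L \<phi> (- {0})" unfolding \<phi>(2) by (rule coz_counit_sample[OF \<phi>(1)])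
    ultimately show ?thesis by (intro bexI conjI)
  qed
  have gD: "?g d \<in> carrier (D_alg ?A) \<and> ?e (?g d) = d" if d: "d \<in> carrier L" for d
  proof -
    have "cozero_set (Max_space L) (basic_open L d)" using d by (simp add: cozero_set_Max_space_iff)
    then obtain \<phi> where \<phi>: "\<phi> \<in> carrier (C_ring (Max_space L))"
      "basic_open L d = {M \<in> topspace (Max_space L). \<phi> M \<noteq> 0}" unfolding cozero_set_def by blast
    have "basic_open L (preimage_elt L \<phi> (- {0})) = basic_open L d"
      using preimage_elt(2)[OF C_ring_continuous[OF \<phi>(1)] open_nonzero] \<phi>(2) by simp
    then have pd: "preimage_elt L \<phi> (- {0}) = d"
      using preimage_elt(1)[OF C_ring_continuous[OF \<phi>(1)] open_nonzero] d by (intro basic_open_inj) simp_all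
    have "?g d = coz ?A (sample I W L \<phi>)" using coz_sample[OF \<phi>(1)] pd by simp
    then show ?thesis
      using coz_counit_sample[OF \<phi>(1)] pd \<phi>(1) by (simp add: D_alg_def carrier_sample_alg)
  qed
  have eD: "?e U \<in> carrier L" "?g (?e U) = U" if "U \<in> carrier (D_alg ?A)" for U
    using sc[OF that] by auto
  have "?e \<in> alex_hom (D_alg ?A) L"
  proof (rule order_iso_alex_hom[OF D L, of ?e ?g])
    fix U V assume UV: "U \<in> carrier (D_alg ?A)" "V \<in> carrier (D_alg ?A)"
    show "?e U \<sqsubseteq> ?e V \<longleftrightarrow> U \<sqsubseteq>\<^bsub>D_alg ?A\<^esub> V"
      using pt_basic_open_subset[OF eD(1)[OF UV(1)] eD(1)[OF UV(2)]] eD(2)[OF UV(1)] eD(2)[OF UV(2)]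
      by (simp add: D_alg_def)
  qed (use eD gD in blast)+
  moreover have "?g \<in> alex_hom L (D_alg ?A)"
  proof (rule order_iso_alex_hom[OF L D, of ?g ?e])
    fix d e assume de: "d \<in> carrier L" "e \<in> carrier L"
    show "?g d \<sqsubseteq>\<^bsub>D_alg ?A\<^esub> ?g e \<longleftrightarrow> d \<sqsubseteq> e"
      using pt_basic_open_subset[OF de] by (simp add: D_alg_def)
  qed (use eD gD in blast)+
  ultimately show ?thesis
    unfolding alex_iso_def by (intro CollectI conjI bexI[of _ ?g] ballI) (simp_all add: eD(2) gD)
qed

end

end

context alexandrov_hom
begin

text \<open>On the cozero set of the sample of \<open>\<phi>\<close>, both sides are the element for
  the preimage of the nonzero reals under \<open>pullback \<phi>\<close>.\<close>

lemma coz_counit_natural: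
  assumes rb: "real_base I W"
    and nzS: "\<And>\<phi>. \<phi> \<in> carrier (C_ring (Max_space S)) \<Longrightarrow> nzS (sample I W S \<phi>) = preimage_elt S \<phi> (- {0})"
    and nzT: "\<And>\<phi>. \<phi> \<in> carrier (C_ring (Max_space T)) \<Longrightarrow> nzT (sample I W T \<phi>) = preimage_elt T \<phi> (- {0})"
    and V: "V \<in> carrier (D_alg (sample_alg I W S))"
  shows "coz_counit (sample_alg I W T) nzT (D_hom (sample_alg I W S) (sample_alg I W T) (sample_hom I g) V) =
    g (coz_counit (sample_alg I W S) nzS V)"
proof -
  obtain X Y where "cstar_hom (sample_alg I W S) X (sample_alg I W T) Y (sample_hom I g)"
    using cstar_hom_exists[OF S.cstar_algebra_sample_alg[OF rb] T.cstar_algebra_sample_alg[OF rb]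
      sample_hom_ring_hom[OF rb]] .
  then interpret h: cstar_hom "sample_alg I W S" X "sample_alg I W T" Y "sample_hom I g" .
  obtain \<phi> where \<phi>: "\<phi> \<in> carrier (C_ring (Max_space S))" "V = coz (sample_alg I W S) (sample I W S \<phi>)"
    using V by (auto simp: D_alg_def carrier_sample_alg)
  have s: "sample I W S \<phi> \<in> carrier (sample_alg I W S)" using \<phi> by (simp add: carrier_sample_alg)
  have "coz_counit (sample_alg I W S) nzS V = preimage_elt S \<phi> (- {0})"
    unfolding \<phi>(2) by (rule S.coz_counit_sample[where nz = nzS, OF rb _ \<phi>(1)]) (rule nzS)
  moreover have "coz_counit (sample_alg I W T) nzT (coz (sample_alg I W T) (sample I W T (pullback \<phi>))) =
      preimage_elt T (pullback \<phi>) (- {0})"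
    by (rule T.coz_counit_sample[where nz = nzT, OF rb _ ring_hom_closed[OF pullback_hom \<phi>(1)]]) (rule nzT)
  ultimately show ?thesis
    unfolding \<phi>(2) h.D_hom_coz[OF s] sample_hom_sample[OF rb \<phi>(1)]
    using preimage_elt_pullback[OF \<phi>(1) open_nonzero] by simp
qed

end

section \<open>The equivalence of categories\<close>

text \<open>Samples are undefined off \<open>I\<close>, as are the results of
  \<open>sample_hom\<close>, so the two functions agree everywhere.\<close>

lemma sample_hom_id:
  "f \<in> carrier (sample_alg I W S) \<Longrightarrow> sample_hom I (\<lambda>x. x) f = f"
  by (auto simp: carrier_sample_alg sample_hom_def sample_def fun_eq_iff)

lemma sample_hom_comp: "sample_hom I (h \<circ> g) f = sample_hom I h (sample_hom I g f)"
  by (simp add: sample_hom_def fun_eq_iff)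

lemma alexandrov_homI:
  "cc_alexandrov_algebra S \<Longrightarrow> cc_alexandrov_algebra T \<Longrightarrow> g \<in> alex_hom S T \<Longrightarrow> alexandrov_hom S T g"
  by (simp add: alexandrov_hom_def alexandrov_hom_axioms_def cc_alexandrov_def)

lemma cc_alexandrov_algebra_D_alg: "cstar_algebra A \<Longrightarrow> cc_alexandrov_algebra (D_alg A)"
  using cc_alexandrov_D_alg by (simp add: cc_alexandrov_def)

lemma D_hom_in_alex_hom:
  assumes "cstar_algebra A" "cstar_algebra B" "f \<in> ring_hom A B"
  shows "D_hom A B f \<in> alex_hom (D_alg A) (D_alg B)"
proof -
  obtain X Y where "cstar_hom A X B Y f" using cstar_hom_exists[OF assms] .
  then interpret cstar_hom A X B Y f .
  show ?thesis by (rule D_hom_alex_hom)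
qed

lemma sample_unit_ring_iso:
  assumes "cstar_algebra A" "real_base I W"
  shows "sample_unit I W A \<in> ring_iso A (sample_alg I W (D_alg A))"
proof -
  obtain X where "spectrum A X" using cstar_algebra_spectrum[OF assms(1)] .
  then interpret spectrum A X .
  show ?thesis by (rule sample_unit_iso[OF assms(2)])
qed

lemma sample_unit_naturality:
  assumes "cstar_algebra A" "cstar_algebra B" "f \<in> ring_hom A B" "real_base I W" "a \<in> carrier A"
  shows "sample_unit I W B (f a) = sample_hom I (D_hom A B f) (sample_unit I W A a)"
proof -
  obtain X Y where "cstar_hom A X B Y f" using cstar_hom_exists[OF assms(1-3)] .
  then interpret cstar_hom A X B Y f .
  show ?thesis by (rule sample_unit_natural[OF assms(4,5)])
qed

lemma R_hom_eq: "R_hom = sample_hom {U. open U}"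
  by (simp add: R_hom_def sample_hom_def fun_eq_iff)

lemma R_unit_eq: "R_unit = sample_unit {U. open U} (\<lambda>U. U)"
  by (simp add: R_unit_def sample_unit_def fun_eq_iff)

lemma R_counit_eq: "R_counit S = coz_counit (R_alg S) (\<lambda>f. f (- {0}))"
  by (simp add: R_counit_def coz_counit_def fun_eq_iff)

lemma M_hom_eq: "M_hom = sample_hom (Q_minus \<times> Q_plus)"
  by (simp add: M_hom_def sample_hom_def fun_eq_iff)

lemma M_unit_eq: "M_unit = sample_unit (Q_minus \<times> Q_plus) open_interval"
  by (simp add: M_unit_def sample_unit_def fun_eq_iff)

lemma M_counit_eq: "M_counit S = coz_counit (M_alg S) (\<lambda>f. f (-\<infinity>, 0) \<squnion>\<^bsub>S\<^esub> f (0, \<infinity>))"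
  by (simp add: M_counit_def coz_counit_def fun_eq_iff)

context cc_alexandrov
begin

lemma R_counit_value:
  "sample {U. open U} (\<lambda>U. U) L \<phi> (- {0}) = preimage_elt L \<phi> (- {0})"
  by (rule sample_apply) (simp add: open_nonzero)

text \<open>A real number is nonzero exactly if it lies in one of the two open rays ending at 0, and
  maximal ideals turn the join into this disjunction; 0 is rational, hence admissible as either end
  point.\<close>

lemma M_counit_value:
  assumes \<phi>: "\<phi> \<in> carrier (C_ring (Max_space L))"
  shows "sample (Q_minus \<times> Q_plus) open_interval L \<phi> (-\<infinity>, 0) \<squnion>
      sample (Q_minus \<times> Q_plus) open_interval L \<phi> (0, \<infinity>) = preimage_elt L \<phi> (- {0})"
    (is "?a \<squnion> ?b = _")
proof -
  have "(0 :: ereal) = ereal (of_rat 0)" by simp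
  then have Q: "(0 :: ereal) \<in> Q_minus" "(0 :: ereal) \<in> Q_plus" by (metis rat_in_Q_minus, metis rat_in_Q_plus)
  have c: "?a \<in> carrier L" "?b \<in> carrier L"
    using PiE_mem[OF sample_PiE[OF real_base_interval \<phi>]] Q by simp_all
  show ?thesis
  proof (rule preimage_elt_eqI[OF C_ring_continuous[OF \<phi>] open_nonzero, symmetric])
    fix M assume M: "maximal_lattice_ideal L M"
    show "\<phi> M \<in> - {0} \<longleftrightarrow> ?a \<squnion> ?b \<notin> M"
      using maximal_join[OF M c] sample_notin[OF real_base_interval \<phi> _ M, of "(-\<infinity>, 0)"]
        sample_notin[OF real_base_interval \<phi> _ M, of "(0, \<infinity>)"] Q
      by (auto simp: open_interval_iff)
  qed (use c in simp)
qed

lemma R_counit_iso: "R_counit L \<in> alex_iso (D_alg (R_alg L)) L"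
  unfolding R_counit_eq R_alg_eq
  by (rule coz_counit_iso[OF real_base_open]) (rule R_counit_value)

lemma M_counit_iso: "M_counit L \<in> alex_iso (D_alg (M_alg L)) L"
  unfolding M_counit_eq M_alg_eq
  by (rule coz_counit_iso[OF real_base_interval]) (rule M_counit_value)

end

context alexandrov_hom
begin

lemma R_hom_ring_hom: "R_hom g \<in> ring_hom (R_alg S) (R_alg T)"
  unfolding R_hom_eq S.R_alg_eq T.R_alg_eq by (rule sample_hom_ring_hom[OF real_base_open])

lemma M_hom_ring_hom: "M_hom g \<in> ring_hom (M_alg S) (M_alg T)"
  unfolding M_hom_eq S.M_alg_eq T.M_alg_eq by (rule sample_hom_ring_hom[OF real_base_interval])

lemma R_counit_natural:
  assumes "V \<in> carrier (D_alg (R_alg S))"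
  shows "R_counit T (D_hom (R_alg S) (R_alg T) (R_hom g) V) = g (R_counit S V)"
  using assms unfolding R_counit_eq R_hom_eq S.R_alg_eq T.R_alg_eq
  by (rule coz_counit_natural[OF real_base_open, rotated -1]) (rule S.R_counit_value T.R_counit_value)+

lemma M_counit_natural:
  assumes "V \<in> carrier (D_alg (M_alg S))"
  shows "M_counit T (D_hom (M_alg S) (M_alg T) (M_hom g) V) = g (M_counit S V)"
  using assms unfolding M_counit_eq M_hom_eq S.M_alg_eq T.M_alg_eq
  by (rule coz_counit_natural[OF real_base_interval, rotated -1]) (rule S.M_counit_value T.M_counit_value; assumption)+

end

lemma R_alg_eq: "cc_alexandrov_algebra S \<Longrightarrow> R_alg S = sample_alg {U. open U} (\<lambda>U. U) S"
  by (rule cc_alexandrov.R_alg_eq[OF cc_alexandrov.intro])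

lemma M_alg_eq: "cc_alexandrov_algebra S \<Longrightarrow> M_alg S = sample_alg (Q_minus \<times> Q_plus) open_interval S"
  by (rule cc_alexandrov.M_alg_eq[OF cc_alexandrov.intro])

text \<open>\<open>R_alg (D_alg A)\<close> lives over another type than \<open>A\<close>, so the
  equivalence is expressed by explicit unit and counit isomorphisms with their naturality squares.
  Equations between morphisms are asserted on carriers, because morphisms count up to equality
  there.\<close>

theorem theorem3p7:
  shows "
     \<comment> \<open>D is a functor\<close>
     (\<forall>A :: 'a ring. cstar_algebra A \<longrightarrow> cc_alexandrov_algebra (D_alg A)) \<and>
     (\<forall>(A :: 'a ring) (B :: 'b ring) f.
        cstar_algebra A \<and> cstar_algebra B \<and> f \<in> ring_hom A B \<longrightarrow>
        D_hom A B f \<in> alex_hom (D_alg A) (D_alg B)) \<and>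
     (\<forall>A :: 'a ring. cstar_algebra A \<longrightarrow>
        (\<forall>U\<in>carrier (D_alg A). D_hom A A (\<lambda>x. x) U = U)) \<and>
     (\<forall>(A :: 'a ring) (B :: 'b ring) (C :: 'c ring) f g.
        cstar_algebra A \<and> cstar_algebra B \<and> cstar_algebra C \<and>
        f \<in> ring_hom A B \<and> g \<in> ring_hom B C \<longrightarrow>
        (\<forall>U\<in>carrier (D_alg A). D_hom A C (g \<circ> f) U = D_hom B C g (D_hom A B f U))) \<and>
     \<comment> \<open>R is a functor\<close>
     (\<forall>S :: 'd gorder. cc_alexandrov_algebra S \<longrightarrow> cstar_algebra (R_alg S)) \<and>
     (\<forall>(S :: 'd gorder) (T :: 'e gorder) g.
        cc_alexandrov_algebra S \<and> cc_alexandrov_algebra T \<and> g \<in> alex_hom S T \<longrightarrow>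
        R_hom g \<in> ring_hom (R_alg S) (R_alg T)) \<and>
     (\<forall>S :: 'd gorder. cc_alexandrov_algebra S \<longrightarrow>
        (\<forall>f\<in>carrier (R_alg S). R_hom (\<lambda>x. x) f = f)) \<and>
     (\<forall>(S :: 'd gorder) (T :: 'e gorder) (V :: 'f gorder) g h.
        cc_alexandrov_algebra S \<and> cc_alexandrov_algebra T \<and> cc_alexandrov_algebra V \<and>
        g \<in> alex_hom S T \<and> h \<in> alex_hom T V \<longrightarrow>
        (\<forall>f\<in>carrier (R_alg S). R_hom (h \<circ> g) f = R_hom h (R_hom g f))) \<and>
     \<comment> \<open>M is a functor\<close>
     (\<forall>S :: 'd gorder. cc_alexandrov_algebra S \<longrightarrow> cstar_algebra (M_alg S)) \<and>
     (\<forall>(S :: 'd gorder) (T :: 'e gorder) g.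
        cc_alexandrov_algebra S \<and> cc_alexandrov_algebra T \<and> g \<in> alex_hom S T \<longrightarrow>
        M_hom g \<in> ring_hom (M_alg S) (M_alg T)) \<and>
     (\<forall>S :: 'd gorder. cc_alexandrov_algebra S \<longrightarrow>
        (\<forall>f\<in>carrier (M_alg S). M_hom (\<lambda>x. x) f = f)) \<and>
     (\<forall>(S :: 'd gorder) (T :: 'e gorder) (V :: 'f gorder) g h.
        cc_alexandrov_algebra S \<and> cc_alexandrov_algebra T \<and> cc_alexandrov_algebra V \<and>
        g \<in> alex_hom S T \<and> h \<in> alex_hom T V \<longrightarrow>
        (\<forall>f\<in>carrier (M_alg S). M_hom (h \<circ> g) f = M_hom h (M_hom g f))) \<and>
     \<comment> \<open>natural isomorphisms from the identity to R D and from D R to the identity\<close>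
     (\<forall>A :: 'a ring. cstar_algebra A \<longrightarrow>
        R_unit A \<in> ring_iso A (R_alg (D_alg A))) \<and>
     (\<forall>(A :: 'a ring) (B :: 'b ring) f.
        cstar_algebra A \<and> cstar_algebra B \<and> f \<in> ring_hom A B \<longrightarrow>
        (\<forall>a\<in>carrier A. R_unit B (f a) = R_hom (D_hom A B f) (R_unit A a))) \<and>
     (\<forall>S :: 'd gorder. cc_alexandrov_algebra S \<longrightarrow>
        R_counit S \<in> alex_iso (D_alg (R_alg S)) S) \<and>
     (\<forall>(S :: 'd gorder) (T :: 'e gorder) g.
        cc_alexandrov_algebra S \<and> cc_alexandrov_algebra T \<and> g \<in> alex_hom S T \<longrightarrow>
        (\<forall>W\<in>carrier (D_alg (R_alg S)).
           R_counit T (D_hom (R_alg S) (R_alg T) (R_hom g) W) = g (R_counit S W))) \<and>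
     \<comment> \<open>natural isomorphisms from the identity to M D and from D M to the identity\<close>
     (\<forall>A :: 'a ring. cstar_algebra A \<longrightarrow>
        M_unit A \<in> ring_iso A (M_alg (D_alg A))) \<and>
     (\<forall>(A :: 'a ring) (B :: 'b ring) f.
        cstar_algebra A \<and> cstar_algebra B \<and> f \<in> ring_hom A B \<longrightarrow>
        (\<forall>a\<in>carrier A. M_unit B (f a) = M_hom (D_hom A B f) (M_unit A a))) \<and>
     (\<forall>S :: 'd gorder. cc_alexandrov_algebra S \<longrightarrow>
        M_counit S \<in> alex_iso (D_alg (M_alg S)) S) \<and>
     (\<forall>(S :: 'd gorder) (T :: 'e gorder) g.
        cc_alexandrov_algebra S \<and> cc_alexandrov_algebra T \<and> g \<in> alex_hom S T \<longrightarrow>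
        (\<forall>W\<in>carrier (D_alg (M_alg S)).
           M_counit T (D_hom (M_alg S) (M_alg T) (M_hom g) W) = g (M_counit S W)))"
proof (intro conjI allI impI ballI; (elim conjE)?)
  note R = real_base_open and M = real_base_interval
  note cc = cc_alexandrov.intro
  {
    fix A :: "'a ring" assume A: "cstar_algebra A"
    note D = cc_alexandrov_algebra_D_alg[OF A]
    show "cc_alexandrov_algebra (D_alg A)" by (rule D)
    show "R_unit A \<in> ring_iso A (R_alg (D_alg A))"
      unfolding R_unit_eq R_alg_eq[OF D] by (rule sample_unit_ring_iso[OF A R])
    show "M_unit A \<in> ring_iso A (M_alg (D_alg A))"
      unfolding M_unit_eq M_alg_eq[OF D] by (rule sample_unit_ring_iso[OF A M])
    show "D_hom A A (\<lambda>x. x) U = U" if "U \<in> carrier (D_alg A)" for U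
      by (rule D_hom_id[OF A that])
  next
    fix A :: "'a ring" and B :: "'b ring" and f
    assume AB: "cstar_algebra A" "cstar_algebra B" "f \<in> ring_hom A B"
    show "D_hom A B f \<in> alex_hom (D_alg A) (D_alg B)" by (rule D_hom_in_alex_hom[OF AB])
    fix a assume a: "a \<in> carrier A"
    show "R_unit B (f a) = R_hom (D_hom A B f) (R_unit A a)"
      unfolding R_unit_eq R_hom_eq by (rule sample_unit_naturality[OF AB R a])
    show "M_unit B (f a) = M_hom (D_hom A B f) (M_unit A a)"
      unfolding M_unit_eq M_hom_eq by (rule sample_unit_naturality[OF AB M a])
  next
    fix A :: "'a ring" and B :: "'b ring" and C :: "'c ring" and f g U
    assume "cstar_algebra A" "cstar_algebra B" "cstar_algebra C" "f \<in> ring_hom A B" "g \<in> ring_hom B C"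
      "U \<in> carrier (D_alg A)"
    then show "D_hom A C (g \<circ> f) U = D_hom B C g (D_hom A B f U)" by (rule D_hom_comp)
  next
    fix S :: "'d gorder" assume S: "cc_alexandrov_algebra S"
    show "cstar_algebra (R_alg S)"
      unfolding R_alg_eq[OF S] by (rule cc_alexandrov.cstar_algebra_sample_alg[OF cc[OF S] R])
    show "cstar_algebra (M_alg S)"
      unfolding M_alg_eq[OF S] by (rule cc_alexandrov.cstar_algebra_sample_alg[OF cc[OF S] M])
    show "R_hom (\<lambda>x. x) f = f" if "f \<in> carrier (R_alg S)" for f
      unfolding R_hom_eq using that unfolding R_alg_eq[OF S] by (rule sample_hom_id)
    show "M_hom (\<lambda>x. x) f = f" if "f \<in> carrier (M_alg S)" for f
      unfolding M_hom_eq using that unfolding M_alg_eq[OF S] by (rule sample_hom_id)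
    show "R_counit S \<in> alex_iso (D_alg (R_alg S)) S" by (rule cc_alexandrov.R_counit_iso[OF cc[OF S]])
    show "M_counit S \<in> alex_iso (D_alg (M_alg S)) S" by (rule cc_alexandrov.M_counit_iso[OF cc[OF S]])
  next
    fix S :: "'d gorder" and T :: "'e gorder" and g
    assume "cc_alexandrov_algebra S" "cc_alexandrov_algebra T" "g \<in> alex_hom S T"
    then interpret alexandrov_hom S T g by (rule alexandrov_homI)
    show "R_hom g \<in> ring_hom (R_alg S) (R_alg T)" by (rule R_hom_ring_hom)
    show "M_hom g \<in> ring_hom (M_alg S) (M_alg T)" by (rule M_hom_ring_hom)
    show "R_counit T (D_hom (R_alg S) (R_alg T) (R_hom g) W) = g (R_counit S W)"
      if "W \<in> carrier (D_alg (R_alg S))" for W by (rule R_counit_natural[OF that])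
    show "M_counit T (D_hom (M_alg S) (M_alg T) (M_hom g) W) = g (M_counit S W)"
      if "W \<in> carrier (D_alg (M_alg S))" for W by (rule M_counit_natural[OF that])
  next
    fix S :: "'d gorder" and g :: "'d \<Rightarrow> 'e" and h :: "'e \<Rightarrow> 'f"
    show "R_hom (h \<circ> g) f = R_hom h (R_hom g f)" for f unfolding R_hom_eq by (rule sample_hom_comp)
    show "M_hom (h \<circ> g) f = M_hom h (M_hom g f)" for f unfolding M_hom_eq by (rule sample_hom_comp)
  }
qed

end
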